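(* Let \(\mathcal V\) be a universe. (i) There is a nontrivial small \(\delta_{\mathcal V}\)-complete poset if and only if the type \(\Omega^{\lnot\lnot}_{\mathcal V}\) is \(\mathcal V\)-small. (ii) There is a positive small \(\delta_{\mathcal V}\)-complete poset if and only if the type \(\Omega_{\mathcal V}\) is \(\mathcal V\)-small.
   Context: Work in univalent foundations: intensional Martin-Löf type theory with a hierarchy of universes, \(\Sigma\), \(\Pi\), identity types, function extensionality, propositional extensionality, and propositional truncations \(\|X\|\) (living in the same universe as \(X\)). "There is" means that one can construct such a structure; the carrier may live in any universe. A type \(X\) is \(\mathcal V\)-small if there is a type \(Y:\mathcal V\) with \(Y\simeq X\). \(\Omega_{\mathcal V}\) is the type of propositions (subsingletons) in \(\mathcal V\); \(\Omega^{\lnot\lnot}_{\mathcal V}\) is the type of propositions \(P:\mathcal V\) with \(\lnot\lnot P\to P\). A poset is a type \(X\) with a proposition-valued reflexive, transitive, antisymmetric relation \(\sqsubseteq\). It is \(\delta_{\mathcal V}\)-complete if for all \(x,y:X\) with \(x\sqsubseteq y\) and every proposition \(P:\mathcal V\), the family \(\delta_{x,y,P}:\mathbf 1+P\to X\) given by \(\mathrm{inl}(\star)\mapsto x\), \(\mathrm{inr}(p)\mapsto y\) has a supremum \(\bigvee\delta_{x,y,P}\). It is nontrivial if it comes with designated \(x,y:X\) with \(x\sqsubseteq y\) and \(x\neq y\). For a \(\delta_{\mathcal V}\)-complete poset, \(x\) is strictly below \(y\) if \(x\sqsubseteq y\) and for every \(z\sqsupseteq y\) and every proposition \(P:\mathcal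 V\), the equality \(z=\bigvee\delta_{x,z,P}\) implies \(P\). It is positive if it comes with designated \(x,y\) with \(x\) strictly below \(y\). It is locally small if there is \(\sqsubseteq_{\mathcal V}:X\to X\to\mathcal V\) with \((x\sqsubseteq y)\simeq(x\sqsubseteq_{\mathcal V}y)\) for all \(x,y\); it is small if it is locally small and its carrier is \(\mathcal V\)-small. *)

theory Defs
  imports Main
begin

text \<open>
  The theorem is about what can be constructed in predicative type theory.  HOL itself is classical
  and impredicative (there, the type of propositions is trivially small), so the type theory is
  embedded deeply: raw terms, conversion, typing judgement.  A type ``has'' an element iff some
  closed term of that type is derivable.

  The object theory is intensional Martin-Loef type theory with universes
  \<open>Univ 0 : Univ 1 : \<dots>\<close> (a la Russell, not cumulative, closed under \<open>\<Pi>\<close> and \<open>\<Sigma>\<close> via \<open>max\<close>),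
  \<open>\<Pi>\<close>, \<open>\<Sigma>\<close>, identity types, the empty and the unit type, binary sums, function extensionality,
  propositional extensionality and propositional truncation.  Univalence, \<open>\<eta>\<close>-conversion and
  cumulativity are not included; adding them can only make more types inhabited.
\<close>

section \<open>Raw terms\<close>

text \<open>
  De Bruijn indices; \<open>Pi A B\<close>, \<open>Sig A B\<close> and \<open>Lam A b\<close> bind one variable in their second
  argument.  Eliminators take their motive and branches as functions of the object theory.
\<close>

datatype tm =
    Var nat | Univ nat
  | Pi tm tm | Lam tm tm | App tm tm
  | Sig tm tm | MkPair tm tm | Split tm tm tm
  | Empty | Abort tm tm
  | Unit | Star | UElim tm tm tm
  | Plus tm tm | InL tm | InR tm | Case tm tm tm tm
  | Eq tm tm tm | Rfl tm | J tm tm tm tm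
  | Tr tm | TrIn tm | TrProp tm tm | TrRec tm tm tm tm
  | FunExt tm tm tm | PropExt tm tm tm tm

primrec lift :: "nat \<Rightarrow> nat \<Rightarrow> tm \<Rightarrow> tm" where
  "lift d k (Var n) = Var (if n < k then n else n + d)"
| "lift d k (Univ i) = Univ i"
| "lift d k (Pi A B) = Pi (lift d k A) (lift d (Suc k) B)"
| "lift d k (Lam A b) = Lam (lift d k A) (lift d (Suc k) b)"
| "lift d k (App f a) = App (lift d k f) (lift d k a)"
| "lift d k (Sig A B) = Sig (lift d k A) (lift d (Suc k) B)"
| "lift d k (MkPair a b) = MkPair (lift d k a) (lift d k b)"
| "lift d k (Split C c p) = Split (lift d k C) (lift d k c) (lift d k p)"
| "lift d k Empty = Empty"
| "lift d k (Abort C e) = Abort (lift d k C) (lift d k e)"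
| "lift d k Unit = Unit"
| "lift d k Star = Star"
| "lift d k (UElim C c u) = UElim (lift d k C) (lift d k c) (lift d k u)"
| "lift d k (Plus A B) = Plus (lift d k A) (lift d k B)"
| "lift d k (InL a) = InL (lift d k a)"
| "lift d k (InR b) = InR (lift d k b)"
| "lift d k (Case C f g s) = Case (lift d k C) (lift d k f) (lift d k g) (lift d k s)"
| "lift d k (Eq A a b) = Eq (lift d k A) (lift d k a) (lift d k b)"
| "lift d k (Rfl a) = Rfl (lift d k a)"
| "lift d k (J C c b p) = J (lift d k C) (lift d k c) (lift d k b) (lift d k p)"
| "lift d k (Tr A) = Tr (lift d k A)"
| "lift d k (TrIn a) = TrIn (lift d k a)"
| "lift d k (TrProp x y) = TrProp (lift d k x) (lift d k y)"
| "lift d k (TrRec P h f x) = TrRec (lift d k P) (lift d k h) (lift d k f) (lift d k x)"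
| "lift d k (FunExt f g h) = FunExt (lift d k f) (lift d k g) (lift d k h)"
| "lift d k (PropExt p q f g) = PropExt (lift d k p) (lift d k q) (lift d k f) (lift d k g)"

abbreviation wk :: "nat \<Rightarrow> tm \<Rightarrow> tm" where
  "wk d t \<equiv> lift d 0 t"

text \<open>\<open>subst k s t\<close> replaces index \<open>k\<close> in \<open>t\<close> by \<open>s\<close> and lowers the indices above \<open>k\<close>.\<close>

primrec subst :: "nat \<Rightarrow> tm \<Rightarrow> tm \<Rightarrow> tm" where
  "subst k s (Var n) = (if n < k then Var n else if n = k then wk k s else Var (n - 1))"
| "subst k s (Univ i) = Univ i"
| "subst k s (Pi A B) = Pi (subst k s A) (subst (Suc k) s B)"
| "subst k s (Lam A b) = Lam (subst k s A) (subst (Suc k) s b)"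
| "subst k s (App f a) = App (subst k s f) (subst k s a)"
| "subst k s (Sig A B) = Sig (subst k s A) (subst (Suc k) s B)"
| "subst k s (MkPair a b) = MkPair (subst k s a) (subst k s b)"
| "subst k s (Split C c p) = Split (subst k s C) (subst k s c) (subst k s p)"
| "subst k s Empty = Empty"
| "subst k s (Abort C e) = Abort (subst k s C) (subst k s e)"
| "subst k s Unit = Unit"
| "subst k s Star = Star"
| "subst k s (UElim C c u) = UElim (subst k s C) (subst k s c) (subst k s u)"
| "subst k s (Plus A B) = Plus (subst k s A) (subst k s B)"
| "subst k s (InL a) = InL (subst k s a)"
| "subst k s (InR b) = InR (subst k s b)"
| "subst k s (Case C f g t) = Case (subst k s C) (subst k s f) (subst k s g) (subst k s t)"
| "subst k s (Eq A a b) = Eq (subst k s A) (subst k s a) (subst k s b)"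
| "subst k s (Rfl a) = Rfl (subst k s a)"
| "subst k s (J C c b p) = J (subst k s C) (subst k s c) (subst k s b) (subst k s p)"
| "subst k s (Tr A) = Tr (subst k s A)"
| "subst k s (TrIn a) = TrIn (subst k s a)"
| "subst k s (TrProp x y) = TrProp (subst k s x) (subst k s y)"
| "subst k s (TrRec P h f x) = TrRec (subst k s P) (subst k s h) (subst k s f) (subst k s x)"
| "subst k s (FunExt f g h) = FunExt (subst k s f) (subst k s g) (subst k s h)"
| "subst k s (PropExt p q f g) = PropExt (subst k s p) (subst k s q) (subst k s f) (subst k s g)"


section \<open>Conversion\<close>

text \<open>
  Definitional equality is conversion of raw terms, as in pure type systems.  The extensionality
  axioms and the truncation carry no computation rules.
\<close>

inductive conv :: "tm \<Rightarrow> tm \<Rightarrow> bool"  (infix "\<cong>" 50) where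
  beta: "App (Lam A b) a \<cong> subst 0 a b"
| split_pair: "Split C c (MkPair a b) \<cong> App (App c a) b"
| unit_star: "UElim C c Star \<cong> c"
| case_inl: "Case C f g (InL a) \<cong> App f a"
| case_inr: "Case C f g (InR b) \<cong> App g b"
| J_refl: "J C c b (Rfl a) \<cong> c"
| refl: "t \<cong> t"
| sym: "t \<cong> u \<Longrightarrow> u \<cong> t"
| trans: "t \<cong> u \<Longrightarrow> u \<cong> v \<Longrightarrow> t \<cong> v"
| Pi: "A \<cong> A' \<Longrightarrow> B \<cong> B' \<Longrightarrow> Pi A B \<cong> Pi A' B'"
| Lam: "A \<cong> A' \<Longrightarrow> b \<cong> b' \<Longrightarrow> Lam A b \<cong> Lam A' b'"
| App: "f \<cong> f' \<Longrightarrow> a \<cong> a' \<Longrightarrow> App f a \<cong> App f' a'"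
| Sig: "A \<cong> A' \<Longrightarrow> B \<cong> B' \<Longrightarrow> Sig A B \<cong> Sig A' B'"
| MkPair: "a \<cong> a' \<Longrightarrow> b \<cong> b' \<Longrightarrow> MkPair a b \<cong> MkPair a' b'"
| Split: "C \<cong> C' \<Longrightarrow> c \<cong> c' \<Longrightarrow> p \<cong> p' \<Longrightarrow> Split C c p \<cong> Split C' c' p'"
| Abort: "C \<cong> C' \<Longrightarrow> e \<cong> e' \<Longrightarrow> Abort C e \<cong> Abort C' e'"
| UElim: "C \<cong> C' \<Longrightarrow> c \<cong> c' \<Longrightarrow> u \<cong> u' \<Longrightarrow> UElim C c u \<cong> UElim C' c' u'"
| Plus: "A \<cong> A' \<Longrightarrow> B \<cong> B' \<Longrightarrow> Plus A B \<cong> Plus A' B'"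
| InL: "a \<cong> a' \<Longrightarrow> InL a \<cong> InL a'"
| InR: "b \<cong> b' \<Longrightarrow> InR b \<cong> InR b'"
| Case: "C \<cong> C' \<Longrightarrow> f \<cong> f' \<Longrightarrow> g \<cong> g' \<Longrightarrow> s \<cong> s' \<Longrightarrow> Case C f g s \<cong> Case C' f' g' s'"
| Eq: "A \<cong> A' \<Longrightarrow> a \<cong> a' \<Longrightarrow> b \<cong> b' \<Longrightarrow> Eq A a b \<cong> Eq A' a' b'"
| Rfl: "a \<cong> a' \<Longrightarrow> Rfl a \<cong> Rfl a'"
| J: "C \<cong> C' \<Longrightarrow> c \<cong> c' \<Longrightarrow> b \<cong> b' \<Longrightarrow> p \<cong> p' \<Longrightarrow> J C c b p \<cong> J C' c' b' p'"
| Tr: "A \<cong> A' \<Longrightarrow> Tr A \<cong> Tr A'"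
| TrIn: "a \<cong> a' \<Longrightarrow> TrIn a \<cong> TrIn a'"
| TrProp: "x \<cong> x' \<Longrightarrow> y \<cong> y' \<Longrightarrow> TrProp x y \<cong> TrProp x' y'"
| TrRec: "P \<cong> P' \<Longrightarrow> h \<cong> h' \<Longrightarrow> f \<cong> f' \<Longrightarrow> x \<cong> x' \<Longrightarrow> TrRec P h f x \<cong> TrRec P' h' f' x'"
| FunExt: "f \<cong> f' \<Longrightarrow> g \<cong> g' \<Longrightarrow> h \<cong> h' \<Longrightarrow> FunExt f g h \<cong> FunExt f' g' h'"
| PropExt: "p \<cong> p' \<Longrightarrow> q \<cong> q' \<Longrightarrow> f \<cong> f' \<Longrightarrow> g \<cong> g' \<Longrightarrow> PropExt p q f g \<cong> PropExt p' q' f' g'"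


section \<open>Typing\<close>

abbreviation Arr :: "tm \<Rightarrow> tm \<Rightarrow> tm" where
  "Arr A B \<equiv> Pi A (wk 1 B)"

abbreviation IsProp :: "tm \<Rightarrow> tm" where
  "IsProp A \<equiv> Pi A (Pi (wk 1 A) (Eq (wk 2 A) (Var 1) (Var 0)))"

text \<open>In a context the most recently declared variable comes first.\<close>

inductive ctx :: "tm list \<Rightarrow> bool"
  and typing :: "tm list \<Rightarrow> tm \<Rightarrow> tm \<Rightarrow> bool"  ("(_ \<turnstile>/ _ \<^bold>:/ _)" [51, 51, 51] 50)
where
  ctx_Nil: "ctx []"
| ctx_Cons: "ctx \<Gamma> \<Longrightarrow> \<Gamma> \<turnstile> A \<^bold>: Univ i \<Longrightarrow> ctx (A # \<Gamma>)"

| Var: "ctx \<Gamma> \<Longrightarrow> n < length \<Gamma> \<Longrightarrow> \<Gamma> \<turnstile> Var n \<^bold>: wk (Suc n) (\<Gamma> ! n)"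
| Conv: "\<Gamma> \<turnstile> t \<^bold>: A \<Longrightarrow> A \<cong> B \<Longrightarrow> \<Gamma> \<turnstile> B \<^bold>: Univ i \<Longrightarrow> \<Gamma> \<turnstile> t \<^bold>: B"
| Univ: "ctx \<Gamma> \<Longrightarrow> \<Gamma> \<turnstile> Univ i \<^bold>: Univ (Suc i)"

| Pi: "\<Gamma> \<turnstile> A \<^bold>: Univ i \<Longrightarrow> A # \<Gamma> \<turnstile> B \<^bold>: Univ j \<Longrightarrow> \<Gamma> \<turnstile> Pi A B \<^bold>: Univ (max i j)"
| Lam: "\<Gamma> \<turnstile> Pi A B \<^bold>: Univ i \<Longrightarrow> A # \<Gamma> \<turnstile> b \<^bold>: B \<Longrightarrow> \<Gamma> \<turnstile> Lam A b \<^bold>: Pi A B"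
| App: "\<Gamma> \<turnstile> f \<^bold>: Pi A B \<Longrightarrow> \<Gamma> \<turnstile> a \<^bold>: A \<Longrightarrow> \<Gamma> \<turnstile> App f a \<^bold>: subst 0 a B"

| Sig: "\<Gamma> \<turnstile> A \<^bold>: Univ i \<Longrightarrow> A # \<Gamma> \<turnstile> B \<^bold>: Univ j \<Longrightarrow> \<Gamma> \<turnstile> Sig A B \<^bold>: Univ (max i j)"
| MkPair: "\<Gamma> \<turnstile> Sig A B \<^bold>: Univ i \<Longrightarrow> \<Gamma> \<turnstile> a \<^bold>: A \<Longrightarrow> \<Gamma> \<turnstile> b \<^bold>: subst 0 a B \<Longrightarrow>
    \<Gamma> \<turnstile> MkPair a b \<^bold>: Sig A B"
| Split: "\<Gamma> \<turnstile> C \<^bold>: Pi (Sig A B) (Univ k) \<Longrightarrow>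
    \<Gamma> \<turnstile> c \<^bold>: Pi A (Pi B (App (wk 2 C) (MkPair (Var 1) (Var 0)))) \<Longrightarrow>
    \<Gamma> \<turnstile> p \<^bold>: Sig A B \<Longrightarrow> \<Gamma> \<turnstile> Split C c p \<^bold>: App C p"

| Empty: "ctx \<Gamma> \<Longrightarrow> \<Gamma> \<turnstile> Empty \<^bold>: Univ 0"
| Abort: "\<Gamma> \<turnstile> C \<^bold>: Pi Empty (Univ k) \<Longrightarrow> \<Gamma> \<turnstile> e \<^bold>: Empty \<Longrightarrow> \<Gamma> \<turnstile> Abort C e \<^bold>: App C e"

| Unit: "ctx \<Gamma> \<Longrightarrow> \<Gamma> \<turnstile> Unit \<^bold>: Univ 0"
| Star: "ctx \<Gamma> \<Longrightarrow> \<Gamma> \<turnstile> Star \<^bold>: Unit"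
| UElim: "\<Gamma> \<turnstile> C \<^bold>: Pi Unit (Univ k) \<Longrightarrow> \<Gamma> \<turnstile> c \<^bold>: App C Star \<Longrightarrow> \<Gamma> \<turnstile> u \<^bold>: Unit \<Longrightarrow>
    \<Gamma> \<turnstile> UElim C c u \<^bold>: App C u"

| Plus: "\<Gamma> \<turnstile> A \<^bold>: Univ i \<Longrightarrow> \<Gamma> \<turnstile> B \<^bold>: Univ j \<Longrightarrow> \<Gamma> \<turnstile> Plus A B \<^bold>: Univ (max i j)"
| InL: "\<Gamma> \<turnstile> Plus A B \<^bold>: Univ i \<Longrightarrow> \<Gamma> \<turnstile> a \<^bold>: A \<Longrightarrow> \<Gamma> \<turnstile> InL a \<^bold>: Plus A B"
| InR: "\<Gamma> \<turnstile> Plus A B \<^bold>: Univ i \<Longrightarrow> \<Gamma> \<turnstile> b \<^bold>: B \<Longrightarrow> \<Gamma> \<turnstile> InR b \<^bold>: Plus A B"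
| Case: "\<Gamma> \<turnstile> C \<^bold>: Pi (Plus A B) (Univ k) \<Longrightarrow>
    \<Gamma> \<turnstile> f \<^bold>: Pi A (App (wk 1 C) (InL (Var 0))) \<Longrightarrow>
    \<Gamma> \<turnstile> g \<^bold>: Pi B (App (wk 1 C) (InR (Var 0))) \<Longrightarrow>
    \<Gamma> \<turnstile> s \<^bold>: Plus A B \<Longrightarrow> \<Gamma> \<turnstile> Case C f g s \<^bold>: App C s"

| Eq: "\<Gamma> \<turnstile> A \<^bold>: Univ i \<Longrightarrow> \<Gamma> \<turnstile> a \<^bold>: A \<Longrightarrow> \<Gamma> \<turnstile> b \<^bold>: A \<Longrightarrow> \<Gamma> \<turnstile> Eq A a b \<^bold>: Univ i"
| Rfl: "\<Gamma> \<turnstile> a \<^bold>: A \<Longrightarrow> \<Gamma> \<turnstile> Rfl a \<^bold>: Eq A a a"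
| J: "\<Gamma> \<turnstile> C \<^bold>: Pi A (Pi (Eq (wk 1 A) (wk 1 a) (Var 0)) (Univ k)) \<Longrightarrow>
    \<Gamma> \<turnstile> c \<^bold>: App (App C a) (Rfl a) \<Longrightarrow>
    \<Gamma> \<turnstile> b \<^bold>: A \<Longrightarrow> \<Gamma> \<turnstile> p \<^bold>: Eq A a b \<Longrightarrow> \<Gamma> \<turnstile> J C c b p \<^bold>: App (App C b) p"

| Tr: "\<Gamma> \<turnstile> A \<^bold>: Univ i \<Longrightarrow> \<Gamma> \<turnstile> Tr A \<^bold>: Univ i"
| TrIn: "\<Gamma> \<turnstile> a \<^bold>: A \<Longrightarrow> \<Gamma> \<turnstile> TrIn a \<^bold>: Tr A"
| TrProp: "\<Gamma> \<turnstile> x \<^bold>: Tr A \<Longrightarrow> \<Gamma> \<turnstile> y \<^bold>: Tr A \<Longrightarrow> \<Gamma> \<turnstile> TrProp x y \<^bold>: Eq (Tr A) x y"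
| TrRec: "\<Gamma> \<turnstile> P \<^bold>: Univ k \<Longrightarrow> \<Gamma> \<turnstile> h \<^bold>: IsProp P \<Longrightarrow> \<Gamma> \<turnstile> f \<^bold>: Arr A P \<Longrightarrow> \<Gamma> \<turnstile> x \<^bold>: Tr A \<Longrightarrow>
    \<Gamma> \<turnstile> TrRec P h f x \<^bold>: P"

| FunExt: "\<Gamma> \<turnstile> f \<^bold>: Pi A B \<Longrightarrow> \<Gamma> \<turnstile> g \<^bold>: Pi A B \<Longrightarrow>
    \<Gamma> \<turnstile> h \<^bold>: Pi A (Eq B (App (wk 1 f) (Var 0)) (App (wk 1 g) (Var 0))) \<Longrightarrow>
    \<Gamma> \<turnstile> FunExt f g h \<^bold>: Eq (Pi A B) f g"
| PropExt: "\<Gamma> \<turnstile> P \<^bold>: Univ i \<Longrightarrow> \<Gamma> \<turnstile> Q \<^bold>: Univ i \<Longrightarrow>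
    \<Gamma> \<turnstile> p \<^bold>: IsProp P \<Longrightarrow> \<Gamma> \<turnstile> q \<^bold>: IsProp Q \<Longrightarrow>
    \<Gamma> \<turnstile> f \<^bold>: Arr P Q \<Longrightarrow> \<Gamma> \<turnstile> g \<^bold>: Arr Q P \<Longrightarrow>
    \<Gamma> \<turnstile> PropExt p q f g \<^bold>: Eq (Univ i) P Q"


section \<open>Terms with named binders\<close>

text \<open>
  To write object-level types readably, binders are represented by HOL functions.  An expression
  \<open>t :: ex\<close> yields the de Bruijn term \<open>t d\<close> when it is placed under \<open>d\<close> binders; a bound variable
  remembers the depth of its binder and computes its index from the depth at which it is used.
  Hence expressions may be moved under further binders without explicit weakening, and a
  closed expression \<open>T\<close> denotes the closed term \<open>T 0\<close>.
\<close>

type_synonym ex = "nat \<Rightarrow> tm"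

definition bound :: "nat \<Rightarrow> ex" where
  "bound l = (\<lambda>d. Var (d - Suc l))"

definition pi :: "ex \<Rightarrow> (ex \<Rightarrow> ex) \<Rightarrow> ex" where
  "pi A B = (\<lambda>d. Pi (A d) (B (bound d) (Suc d)))"

definition lam :: "ex \<Rightarrow> (ex \<Rightarrow> ex) \<Rightarrow> ex" where
  "lam A b = (\<lambda>d. Lam (A d) (b (bound d) (Suc d)))"

definition sig :: "ex \<Rightarrow> (ex \<Rightarrow> ex) \<Rightarrow> ex" where
  "sig A B = (\<lambda>d. Sig (A d) (B (bound d) (Suc d)))"

definition univ :: "nat \<Rightarrow> ex" where
  "univ i = (\<lambda>d. Univ i)"

definition app :: "ex \<Rightarrow> ex \<Rightarrow> ex"  (infixl "\<cdot>" 80) where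
  "f \<cdot> a = (\<lambda>d. App (f d) (a d))"

definition arr :: "ex \<Rightarrow> ex \<Rightarrow> ex"  (infixr "\<rightarrow>" 60) where
  "A \<rightarrow> B = pi A (\<lambda>_. B)"

definition both :: "ex \<Rightarrow> ex \<Rightarrow> ex"  (infixr "\<otimes>" 65) where
  "A \<otimes> B = sig A (\<lambda>_. B)"

definition split :: "ex \<Rightarrow> ex \<Rightarrow> ex \<Rightarrow> ex" where
  "split C c p = (\<lambda>d. Split (C d) (c d) (p d))"

definition empty :: ex where
  "empty = (\<lambda>d. Empty)"

definition unit :: ex where
  "unit = (\<lambda>d. Unit)"

definition plus :: "ex \<Rightarrow> ex \<Rightarrow> ex" where
  "plus A B = (\<lambda>d. Plus (A d) (B d))"

definition cases :: "ex \<Rightarrow> ex \<Rightarrow> ex \<Rightarrow> ex \<Rightarrow> ex" where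
  "cases C f g s = (\<lambda>d. Case (C d) (f d) (g d) (s d))"

definition eq :: "ex \<Rightarrow> ex \<Rightarrow> ex \<Rightarrow> ex" where
  "eq A a b = (\<lambda>d. Eq (A d) (a d) (b d))"

text \<open>First projection from \<open>sig A B\<close>, expressed by \<open>\<Sigma>\<close>-elimination.\<close>

definition proj1 :: "ex \<Rightarrow> (ex \<Rightarrow> ex) \<Rightarrow> ex \<Rightarrow> ex" where
  "proj1 A B p = split (lam (sig A B) (\<lambda>_. A)) (lam A (\<lambda>a. lam (B a) (\<lambda>_. a))) p"

definition inhabited :: "ex \<Rightarrow> bool" where
  "inhabited T \<longleftrightarrow> (\<exists>t. [] \<turnstile> t \<^bold>: T 0)"


section \<open>Propositions and smallness\<close>

definition neg :: "ex \<Rightarrow> ex" where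
  "neg A = (A \<rightarrow> empty)"

definition is_prop :: "ex \<Rightarrow> ex" where
  "is_prop A = pi A (\<lambda>x. pi A (\<lambda>y. eq A x y))"

text \<open>Equivalences are maps equipped with a right inverse and a left inverse.\<close>

definition equiv :: "ex \<Rightarrow> ex \<Rightarrow> ex" where
  "equiv A B = sig (A \<rightarrow> B) (\<lambda>f.
      sig (B \<rightarrow> A) (\<lambda>g. pi B (\<lambda>b. eq B (f \<cdot> (g \<cdot> b)) b)) \<otimes>
      sig (B \<rightarrow> A) (\<lambda>h. pi A (\<lambda>a. eq A (h \<cdot> (f \<cdot> a)) a)))"

definition small :: "nat \<Rightarrow> ex \<Rightarrow> ex" where
  "small v A = sig (univ v) (\<lambda>Y. equiv Y A)"

definition Omega :: "nat \<Rightarrow> ex" where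
  "Omega v = sig (univ v) (\<lambda>P. is_prop P)"

definition Omega_notnot :: "nat \<Rightarrow> ex" where
  "Omega_notnot v = sig (univ v) (\<lambda>P. is_prop P \<otimes> (neg (neg P) \<rightarrow> P))"


section \<open>Posets\<close>

text \<open>Throughout, \<open>X\<close> is the carrier and \<open>R : X \<rightarrow> X \<rightarrow> univ t\<close> the order \<open>\<sqsubseteq>\<close>.\<close>

definition prop_valued :: "ex \<Rightarrow> ex \<Rightarrow> ex" where
  "prop_valued X R = pi X (\<lambda>x. pi X (\<lambda>y. is_prop (R \<cdot> x \<cdot> y)))"

definition reflexive :: "ex \<Rightarrow> ex \<Rightarrow> ex" where
  "reflexive X R = pi X (\<lambda>x. R \<cdot> x \<cdot> x)"

definition transitive :: "ex \<Rightarrow> ex \<Rightarrow> ex" where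
  "transitive X R =
    pi X (\<lambda>x. pi X (\<lambda>y. pi X (\<lambda>z. R \<cdot> x \<cdot> y \<rightarrow> R \<cdot> y \<cdot> z \<rightarrow> R \<cdot> x \<cdot> z)))"

definition antisymmetric :: "ex \<Rightarrow> ex \<Rightarrow> ex" where
  "antisymmetric X R = pi X (\<lambda>x. pi X (\<lambda>y. R \<cdot> x \<cdot> y \<rightarrow> R \<cdot> y \<cdot> x \<rightarrow> eq X x y))"

text \<open>\<open>s\<close> is a supremum of the family \<open>\<alpha> : I \<rightarrow> X\<close>.\<close>

definition is_sup :: "ex \<Rightarrow> ex \<Rightarrow> ex \<Rightarrow> ex \<Rightarrow> ex \<Rightarrow> ex" where
  "is_sup X R I \<alpha> s =
    pi I (\<lambda>i. R \<cdot> (\<alpha> \<cdot> i) \<cdot> s) \<otimes>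
    pi X (\<lambda>u. pi I (\<lambda>i. R \<cdot> (\<alpha> \<cdot> i) \<cdot> u) \<rightarrow> R \<cdot> s \<cdot> u)"

text \<open>The family \<open>\<delta>\<^sub>x\<^sub>,\<^sub>y\<^sub>,\<^sub>P : 1 + P \<rightarrow> X\<close>.\<close>

definition delta :: "ex \<Rightarrow> ex \<Rightarrow> ex \<Rightarrow> ex \<Rightarrow> ex" where
  "delta X x y P = lam (plus unit P) (\<lambda>i.
      cases (lam (plus unit P) (\<lambda>_. X)) (lam unit (\<lambda>_. x)) (lam P (\<lambda>_. y)) i)"

definition is_delta_sup :: "ex \<Rightarrow> ex \<Rightarrow> ex \<Rightarrow> ex \<Rightarrow> ex \<Rightarrow> ex \<Rightarrow> ex" where
  "is_delta_sup X R x y P s = is_sup X R (plus unit P) (delta X x y P) s"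

definition delta_complete :: "nat \<Rightarrow> ex \<Rightarrow> ex \<Rightarrow> ex" where
  "delta_complete v X R =
    pi X (\<lambda>x. pi X (\<lambda>y. R \<cdot> x \<cdot> y \<rightarrow>
      pi (univ v) (\<lambda>P. is_prop P \<rightarrow> sig X (\<lambda>s. is_delta_sup X R x y P s))))"

text \<open>
  The supremum of \<open>\<delta>\<^sub>x\<^sub>,\<^sub>y\<^sub>,\<^sub>P\<close> provided by \<open>c : delta_complete v X R\<close>, for \<open>le : x \<sqsubseteq> y\<close> and
  \<open>h : is_prop P\<close>.
\<close>

definition delta_sup :: "ex \<Rightarrow> ex \<Rightarrow> ex \<Rightarrow> ex \<Rightarrow> ex \<Rightarrow> ex \<Rightarrow> ex \<Rightarrow> ex \<Rightarrow> ex" where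
  "delta_sup X R c x y le P h =
    proj1 X (\<lambda>s. is_delta_sup X R x y P s) (c \<cdot> x \<cdot> y \<cdot> le \<cdot> P \<cdot> h)"

definition nontrivial :: "ex \<Rightarrow> ex \<Rightarrow> ex" where
  "nontrivial X R = sig X (\<lambda>x. sig X (\<lambda>y. R \<cdot> x \<cdot> y \<otimes> neg (eq X x y)))"

text \<open>
  The proof of \<open>x \<sqsubseteq> z\<close> needed to form the supremum of \<open>\<delta>\<^sub>x\<^sub>,\<^sub>z\<^sub>,\<^sub>P\<close> is obtained from
  \<open>x \<sqsubseteq> y \<sqsubseteq> z\<close> by the transitivity proof \<open>tr\<close>.
\<close>

definition strictly_below :: "nat \<Rightarrow> ex \<Rightarrow> ex \<Rightarrow> ex \<Rightarrow> ex \<Rightarrow> ex \<Rightarrow> ex \<Rightarrow> ex" where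
  "strictly_below v X R tr c x y =
    sig (R \<cdot> x \<cdot> y) (\<lambda>xy.
      pi X (\<lambda>z. pi (R \<cdot> y \<cdot> z) (\<lambda>yz.
        pi (univ v) (\<lambda>P. pi (is_prop P) (\<lambda>h.
          eq X z (delta_sup X R c x z (tr \<cdot> x \<cdot> y \<cdot> z \<cdot> xy \<cdot> yz) P h) \<rightarrow> P)))))"

definition positive :: "nat \<Rightarrow> ex \<Rightarrow> ex \<Rightarrow> ex \<Rightarrow> ex \<Rightarrow> ex" where
  "positive v X R tr c = sig X (\<lambda>x. sig X (\<lambda>y. strictly_below v X R tr c x y))"

definition locally_small :: "nat \<Rightarrow> ex \<Rightarrow> ex \<Rightarrow> ex" where
  "locally_small v X R = sig (X \<rightarrow> X \<rightarrow> univ v) (\<lambda>S.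
      pi X (\<lambda>x. pi X (\<lambda>y. equiv (R \<cdot> x \<cdot> y) (S \<cdot> x \<cdot> y))))"

definition small_poset :: "nat \<Rightarrow> ex \<Rightarrow> ex \<Rightarrow> ex" where
  "small_poset v X R = locally_small v X R \<otimes> small v X"

text \<open>
  The type of small \<open>\<delta>\<close>-complete posets with carrier in \<open>univ w\<close>, order valued in \<open>univ t\<close>, and
  further structure \<open>E X R tr c\<close>, where \<open>tr\<close> is the proof of transitivity and \<open>c\<close> the
  \<open>\<delta>\<close>-completeness structure.
\<close>

definition small_delta_complete_poset_with ::
    "nat \<Rightarrow> nat \<Rightarrow> nat \<Rightarrow> (ex \<Rightarrow> ex \<Rightarrow> ex \<Rightarrow> ex \<Rightarrow> ex) \<Rightarrow> ex" where
  "small_delta_complete_poset_with v w t E =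
    sig (univ w) (\<lambda>X. sig (X \<rightarrow> X \<rightarrow> univ t) (\<lambda>R.
      prop_valued X R \<otimes> reflexive X R \<otimes> sig (transitive X R) (\<lambda>tr.
        antisymmetric X R \<otimes> small_poset v X R \<otimes>
        sig (delta_complete v X R) (\<lambda>c. E X R tr c))))"

definition nontrivial_small_poset :: "nat \<Rightarrow> nat \<Rightarrow> nat \<Rightarrow> ex" where
  "nontrivial_small_poset v w t =
    small_delta_complete_poset_with v w t (\<lambda>X R tr c. nontrivial X R)"

definition positive_small_poset :: "nat \<Rightarrow> nat \<Rightarrow> nat \<Rightarrow> ex" where
  "positive_small_poset v w t =
    small_delta_complete_poset_with v w t (\<lambda>X R tr c. positive v X R tr c)"

end

theory Submission
  imports Defs
begin

text \<open>
  If \<open>x \<sqsubseteq> y\<close> and \<open>x \<noteq> y\<close>, the map \<open>P \<mapsto> \<Or>\<delta>\<^sub>x\<^sub>,\<^sub>y\<^sub>,\<^sub>P\<close> from \<open>\<not>\<not>\<close>-stable propositions to \<open>X\<close> has the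
  retraction \<open>z \<mapsto> \<not> (z \<sqsubseteq> x)\<close>.  If \<open>x\<close> is strictly below \<open>y\<close>, the same map on all propositions has the
  retraction \<open>z \<mapsto> \<parallel>y \<sqsubseteq> z\<parallel>\<close>.  As the order and \<open>X\<close> are small, so is every retract of \<open>X\<close>.
  Conversely, propositions ordered by implication form a \<open>\<delta>\<close>-complete poset between falsity and truth:
  the supremum of \<open>\<delta>\<^sub>P\<^sub>,\<^sub>Q\<^sub>,\<^sub>A\<close> is \<open>P \<or> (A \<and> Q)\<close>, truncated or doubly negated.

  Each step is a closed term of the object theory.  It is checked by a bidirectional type checker
  whose rules are derived from weakening, substitution and regularity of the typing judgement.
\<close>

section \<open>Lifting and substitution\<close>

text \<open>Conversion is untyped and subject reduction is not among the derived rules. Hence a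
  normal form is used as a type only after a universe has been inferred for it afresh; regularity
  supplies most other well-formedness conditions. For the checker only soundness counts: exhausted
  fuel can make a check fail, never make a wrong one succeed.

  Universes are not cumulative, so levels must match exactly: the type of propositions of
  \<open>Univ v\<close> lies in \<open>Univ (Suc v)\<close>, and falsity and truth have to be
  rebuilt in \<open>Univ v\<close>. The object theory cannot quantify over levels; they are HOL
  variables of each derivation.

  The two retractions differ because x \<noteq> y is negative information, which recovers a
  proposition only up to double negation, while strictness yields the proposition itself. Both are
  formed with the small copy \<open>S\<close> of the order, so that their values lie in
  \<open>Univ v\<close>.\<close>

lemma lift_lift_merge: "k \<le> k' \<Longrightarrow> k' \<le> k + d \<Longrightarrow> lift d' k' (lift d k t) = lift (d + d') k t"
  by (induction t arbitrary: k k') auto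

lemma lift_lift_swap: "k' \<le> k \<Longrightarrow> lift d (k + d') (lift d' k' t) = lift d' k' (lift d k t)"
proof (induction t arbitrary: k k')
  case (Pi A B) then show ?case using Pi.IH(2)[of "Suc k'" "Suc k"] by simp
next
  case (Lam A B) then show ?case using Lam.IH(2)[of "Suc k'" "Suc k"] by simp
next
  case (Sig A B) then show ?case using Sig.IH(2)[of "Suc k'" "Suc k"] by simp
qed auto

lemma subst_lift_cancel: "k \<le> j \<Longrightarrow> j \<le> k + d \<Longrightarrow> subst j s (lift (Suc d) k t) = lift d k t"
  by (induction t arbitrary: k j) auto

lemma lift_subst: "lift d (j + k) (subst j s t) = subst j (lift d k s) (lift d (Suc (j + k)) t)"
proof (induction t arbitrary: j)
  case (Var n)
  then show ?case using lift_lift_swap[of 0 k d j s] by (auto simp: add.commute)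
next
  case (Pi A B) then show ?case using Pi.IH(2)[of "Suc j"] by simp
next
  case (Lam A B) then show ?case using Lam.IH(2)[of "Suc j"] by simp
next
  case (Sig A B) then show ?case using Sig.IH(2)[of "Suc j"] by simp
qed simp_all

lemma subst_lift: "k \<le> j \<Longrightarrow> subst (j + d) s (lift d k t) = lift d k (subst j s t)"
proof (induction t arbitrary: k j)
  case (Var n)
  then show ?case using lift_lift_merge[of 0 k j d s] by (auto simp: add.commute)
next
  case (Pi A B) then show ?case using Pi.IH(2)[of "Suc k" "Suc j"] by simp
next
  case (Lam A B) then show ?case using Lam.IH(2)[of "Suc k" "Suc j"] by simp
next
  case (Sig A B) then show ?case using Sig.IH(2)[of "Suc k" "Suc j"] by simp
qed simp_all

lemma subst_subst:
  "subst (j + k) s (subst j u t) = subst j (subst k s u) (subst (Suc (j + k)) s t)"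
proof (induction t arbitrary: j)
  case (Var n)
  have "n < j \<or> n = j \<or> (j < n \<and> n < Suc (j + k)) \<or> n = Suc (j + k) \<or> Suc (j + k) < n" by arith
  then show ?case
    using subst_lift[of 0 k j s u] subst_lift_cancel[of 0 j "j + k" "subst k s u" s]
    by (auto simp: add.commute)
next
  case (Pi A B) then show ?case using Pi.IH(2)[of "Suc j"] by simp
next
  case (Lam A B) then show ?case using Lam.IH(2)[of "Suc j"] by simp
next
  case (Sig A B) then show ?case using Sig.IH(2)[of "Suc j"] by simp
qed simp_all

lemmas lift_subst_0 = lift_subst[where j = 0, simplified]
lemmas subst_subst_0 = subst_subst[where j = 0, simplified]

lemma lift_wk: "lift d (k + d') (wk d' t) = wk d' (lift d k t)"
  by (rule lift_lift_swap) simp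

lemma subst_wk: "subst (k + d) s (wk d t) = wk d (subst k s t)"
  by (rule subst_lift) simp

lemmas lift_wk_Suc = lift_wk[where d' = "Suc 0", simplified] lift_wk[where d' = 2, simplified]
lemmas subst_wk_Suc = subst_wk[where d = "Suc 0", simplified] subst_wk[where d = 2, simplified]

text \<open>Index \<open>k\<close> is replaced by itself and the higher indices move up and down
  again. This is what remains when a weakened term is instantiated with the newest variable.\<close>

lemma subst_Var_lift: "subst k (Var 0) (lift (Suc 0) (Suc k) t) = t"
  by (induction t arbitrary: k) auto

lemma lift_0: "lift 0 k t = t"
  by (induction t arbitrary: k) auto

lemma subst_wk_1: "subst 0 s (wk (Suc 0) t) = t"
  by (simp add: subst_lift_cancel lift_0)

lemma conv_lift: "t \<cong> u \<Longrightarrow> lift d k t \<cong> lift d k u"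
proof (induction arbitrary: k rule: conv.induct)
  case (beta A b a)
  show ?case using conv.beta[of "lift d k A" "lift d (Suc k) b" "lift d k a"]
    by (simp add: lift_subst_0)
next
  case (trans t u v)
  then show ?case by (meson conv.trans)
qed (auto intro: conv.intros)

lemma conv_subst: "t \<cong> u \<Longrightarrow> subst k s t \<cong> subst k s u"
proof (induction arbitrary: k rule: conv.induct)
  case (beta A b a)
  show ?case using conv.beta[of "subst k s A" "subst (Suc k) s b" "subst k s a"]
    by (simp add: subst_subst_0)
next
  case (trans t u v)
  then show ?case by (meson conv.trans)
qed (auto intro: conv.intros)

section \<open>Weakening, substitution and regularity\<close>

text \<open>The new declaration sits below \<Delta>, so an entry of \<Delta> sees it at the index
  that counts the entries of \<Delta> older than itself.\<close>

primrec lift_ctx :: "tm list \<Rightarrow> tm list" where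
  "lift_ctx [] = []"
| "lift_ctx (B # \<Delta>) = lift 1 (length \<Delta>) B # lift_ctx \<Delta>"

primrec subst_ctx :: "tm \<Rightarrow> tm list \<Rightarrow> tm list" where
  "subst_ctx s [] = []"
| "subst_ctx s (B # \<Delta>) = subst (length \<Delta>) s B # subst_ctx s \<Delta>"

lemma length_lift_ctx [simp]: "length (lift_ctx \<Delta>) = length \<Delta>"
  by (induction \<Delta>) auto

lemma length_subst_ctx [simp]: "length (subst_ctx s \<Delta>) = length \<Delta>"
  by (induction \<Delta>) auto

lemma nth_lift_ctx:
  "n < length \<Delta> \<Longrightarrow> wk (Suc n) (lift_ctx \<Delta> ! n) = lift 1 (length \<Delta>) (wk (Suc n) (\<Delta> ! n))"
proof (induction \<Delta> arbitrary: n)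
  case (Cons B \<Delta>)
  show ?case
  proof (cases n)
    case 0
    then show ?thesis using lift_wk[of 1 "length \<Delta>" 1 B] by simp
  next
    case (Suc m)
    then have "lift 1 0 (wk (Suc m) (lift_ctx \<Delta> ! m)) = lift 1 0 (lift 1 (length \<Delta>) (wk (Suc m) (\<Delta> ! m)))"
      using Cons by simp
    then show ?thesis using Suc lift_wk[of 1 "length \<Delta>" 1 "wk (Suc m) (\<Delta> ! m)"]
      by (simp add: lift_lift_merge)
  qed
qed simp

lemma nth_subst_ctx:
  "n < length \<Delta> \<Longrightarrow> wk (Suc n) (subst_ctx s \<Delta> ! n) = subst (length \<Delta>) s (wk (Suc n) (\<Delta> ! n))"
proof (induction \<Delta> arbitrary: n)
  case (Cons B \<Delta>)
  show ?case
  proof (cases n)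
    case 0
    then show ?thesis using subst_wk[of "length \<Delta>" 1 s B] by simp
  next
    case (Suc m)
    then have "wk 1 (wk (Suc m) (subst_ctx s \<Delta> ! m)) = wk 1 (subst (length \<Delta>) s (wk (Suc m) (\<Delta> ! m)))"
      using Cons by simp
    then show ?thesis using Suc subst_wk[of "length \<Delta>" 1 s "wk (Suc m) (\<Delta> ! m)"]
      by (simp add: lift_lift_merge)
  qed
qed simp

lemma ctx_typing_ctx: "\<Gamma> \<turnstile> t \<^bold>: T \<Longrightarrow> ctx \<Gamma>"
proof -
  have "(ctx \<Gamma> \<longrightarrow> True) \<and> (\<Gamma> \<turnstile> t \<^bold>: T \<longrightarrow> ctx \<Gamma>)" for \<Gamma> t T
    by (induction rule: ctx_typing.induct) auto
  then show "\<Gamma> \<turnstile> t \<^bold>: T \<Longrightarrow> ctx \<Gamma>" by blast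
qed

text \<open>Binder rules extend the context on the left, so the induction has to insert
  \<open>D\<close> under an arbitrary telescope \<Delta>. Contexts and typing are mutually
  inductive, hence the conjunction.\<close>

lemma weakening_aux:
  "(ctx \<Gamma>' \<longrightarrow> (\<forall>\<Delta>. \<Gamma>' = \<Delta> @ \<Gamma> \<longrightarrow> \<Gamma> \<turnstile> D \<^bold>: Univ l \<longrightarrow> ctx (lift_ctx \<Delta> @ D # \<Gamma>))) \<and>
   (\<Gamma>' \<turnstile> t \<^bold>: T \<longrightarrow> (\<forall>\<Delta>. \<Gamma>' = \<Delta> @ \<Gamma> \<longrightarrow> \<Gamma> \<turnstile> D \<^bold>: Univ l \<longrightarrow>
      lift_ctx \<Delta> @ D # \<Gamma> \<turnstile> lift 1 (length \<Delta>) t \<^bold>: lift 1 (length \<Delta>) T))"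
proof (induction rule: ctx_typing.induct)
  case ctx_Nil
  then show ?case by (auto intro: ctx_typing.intros)
next
  case (ctx_Cons \<Gamma>' A i)
  show ?case
  proof (intro allI impI)
    fix \<Delta> assume *: "A # \<Gamma>' = \<Delta> @ \<Gamma>" "\<Gamma> \<turnstile> D \<^bold>: Univ l"
    show "ctx (lift_ctx \<Delta> @ D # \<Gamma>)"
    proof (cases \<Delta>)
      case Nil
      then show ?thesis using * ctx_Cons ctx_typing_ctx ctx_typing.ctx_Cons by fastforce
    next
      case (Cons B \<Delta>')
      then show ?thesis using * ctx_Cons ctx_typing.ctx_Cons by fastforce
    qed
  qed
next
  case (Var \<Gamma>' n)
  show ?case
  proof (intro allI impI)
    fix \<Delta> assume *: "\<Gamma>' = \<Delta> @ \<Gamma>" "\<Gamma> \<turnstile> D \<^bold>: Univ l"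
    then have c: "ctx (lift_ctx \<Delta> @ D # \<Gamma>)" using Var by blast
    show "lift_ctx \<Delta> @ D # \<Gamma> \<turnstile> lift 1 (length \<Delta>) (Var n) \<^bold>: lift 1 (length \<Delta>) (wk (Suc n) (\<Gamma>' ! n))"
    proof (cases "n < length \<Delta>")
      case True
      then show ?thesis using ctx_typing.Var[OF c, of n] * nth_lift_ctx[of n \<Delta>]
        by (simp add: nth_append)
    next
      case False
      then show ?thesis using ctx_typing.Var[OF c, of "Suc n"] * Var(2)
        by (simp add: nth_append lift_lift_merge Suc_diff_le)
    qed
  qed
next
  case (Conv \<Gamma>' t A B i)
  then show ?case by (simp, metis ctx_typing.Conv conv_lift)
next
  case (Pi \<Gamma>' A i B j)
  show ?case
  proof (intro allI impI)
    fix \<Delta> assume *: "\<Gamma>' = \<Delta> @ \<Gamma>" "\<Gamma> \<turnstile> D \<^bold>: Univ l"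
    then show "lift_ctx \<Delta> @ D # \<Gamma> \<turnstile> lift 1 (length \<Delta>) (Pi A B) \<^bold>: lift 1 (length \<Delta>) (Univ (max i j))"
      using Pi.IH(1)[rule_format, OF *] Pi.IH(2)[rule_format, of "A # \<Delta>"]
      by (auto intro: ctx_typing.Pi)
  qed
next
  case (Lam \<Gamma>' A B i b)
  show ?case
  proof (intro allI impI)
    fix \<Delta> assume *: "\<Gamma>' = \<Delta> @ \<Gamma>" "\<Gamma> \<turnstile> D \<^bold>: Univ l"
    then show "lift_ctx \<Delta> @ D # \<Gamma> \<turnstile> lift 1 (length \<Delta>) (Lam A b) \<^bold>: lift 1 (length \<Delta>) (Pi A B)"
      using Lam.IH(1)[rule_format, OF *] Lam.IH(2)[rule_format, of "A # \<Delta>"]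
      by (auto intro: ctx_typing.Lam)
  qed
next
  case (Sig \<Gamma>' A i B j)
  show ?case
  proof (intro allI impI)
    fix \<Delta> assume *: "\<Gamma>' = \<Delta> @ \<Gamma>" "\<Gamma> \<turnstile> D \<^bold>: Univ l"
    then show "lift_ctx \<Delta> @ D # \<Gamma> \<turnstile> lift 1 (length \<Delta>) (Sig A B) \<^bold>: lift 1 (length \<Delta>) (Univ (max i j))"
      using Sig.IH(1)[rule_format, OF *] Sig.IH(2)[rule_format, of "A # \<Delta>"]
      by (auto intro: ctx_typing.Sig)
  qed
next
  case (App \<Gamma>' f A B a)
  then show ?case by (auto simp: lift_subst_0 intro: ctx_typing.App)
next
  case (MkPair \<Gamma>' A B i a b)
  then show ?case by (auto simp: lift_subst_0 intro: ctx_typing.MkPair)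
next
  case (Split \<Gamma>' C A B k c p)
  \<comment> \<open>The simplifier turns \<open>1\<close> into \<open>Suc 0\<close>; unfolding the
    rule in the same way lets its premises match.\<close>
  then show ?case by (clarsimp simp: lift_wk_Suc) (rule ctx_typing.Split[unfolded One_nat_def], assumption+)
next
  case (Case \<Gamma>' C A B k f g s)
  then show ?case by (clarsimp simp: lift_wk_Suc) (rule ctx_typing.Case[unfolded One_nat_def], assumption+)
next
  case (J \<Gamma>' C A a k c b p)
  then show ?case by (clarsimp simp: lift_wk_Suc) (rule ctx_typing.J[unfolded One_nat_def], assumption+)
next
  case (TrRec \<Gamma>' P k h f A x)
  then show ?case by (clarsimp simp: lift_wk_Suc) (rule ctx_typing.TrRec[unfolded One_nat_def], assumption+)
next
  case (FunExt \<Gamma>' f A B g h)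
  then show ?case by (clarsimp simp: lift_wk_Suc) (rule ctx_typing.FunExt[unfolded One_nat_def], assumption+)
next
  case (PropExt \<Gamma>' P i Q p q f g)
  then show ?case by (clarsimp simp: lift_wk_Suc) (rule ctx_typing.PropExt[unfolded One_nat_def], assumption+)
next
  case (Abort \<Gamma>' C k e)
  then show ?case by (clarsimp simp: lift_wk_Suc) (rule ctx_typing.Abort[unfolded One_nat_def], assumption+)
next
  case (UElim \<Gamma>' C k c u)
  then show ?case by (clarsimp simp: lift_wk_Suc) (rule ctx_typing.UElim[unfolded One_nat_def], assumption+)
qed (auto intro: ctx_typing.intros)

lemma weakening: "\<Gamma> \<turnstile> t \<^bold>: T \<Longrightarrow> \<Gamma> \<turnstile> D \<^bold>: Univ l \<Longrightarrow> D # \<Gamma> \<turnstile> wk 1 t \<^bold>: wk 1 T"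
  using weakening_aux[of \<Gamma> \<Gamma> D l t T] by (auto dest: spec[where x = "[]"])

lemma weakening_1:
  "B # \<Gamma> \<turnstile> t \<^bold>: T \<Longrightarrow> \<Gamma> \<turnstile> D \<^bold>: Univ l \<Longrightarrow> wk 1 B # D # \<Gamma> \<turnstile> lift 1 1 t \<^bold>: lift 1 1 T"
  using weakening_aux[of "B # \<Gamma>" \<Gamma> D l t T] by (auto dest: spec[where x = "[B]"])

text \<open>Serves the variable case of substitution: a term typed over \<Gamma> replaces a variable
  that stands below a telescope.\<close>

lemma weakening_ctx: "\<Gamma> \<turnstile> t \<^bold>: T \<Longrightarrow> ctx (\<Theta> @ \<Gamma>) \<Longrightarrow> \<Theta> @ \<Gamma> \<turnstile> wk (length \<Theta>) t \<^bold>: wk (length \<Theta>) T"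
proof (induction \<Theta>)
  case Nil
  then show ?case by (simp add: lift_0)
next
  case (Cons D \<Theta>)
  from Cons.prems(2) obtain l where "\<Theta> @ \<Gamma> \<turnstile> D \<^bold>: Univ l" and "ctx (\<Theta> @ \<Gamma>)"
    by (auto elim: ctx.cases)
  with Cons show ?case using weakening[of "\<Theta> @ \<Gamma>" "wk (length \<Theta>) t" "wk (length \<Theta>) T" D l]
    by (simp add: lift_lift_merge)
qed
lemma substitution_aux:
  "(ctx \<Gamma>' \<longrightarrow> (\<forall>\<Delta>. \<Gamma>' = \<Delta> @ D # \<Gamma> \<longrightarrow> \<Gamma> \<turnstile> s \<^bold>: D \<longrightarrow> ctx (subst_ctx s \<Delta> @ \<Gamma>))) \<and>
   (\<Gamma>' \<turnstile> t \<^bold>: T \<longrightarrow> (\<forall>\<Delta>. \<Gamma>' = \<Delta> @ D # \<Gamma> \<longrightarrow> \<Gamma> \<turnstile> s \<^bold>: D \<longrightarrow>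
      subst_ctx s \<Delta> @ \<Gamma> \<turnstile> subst (length \<Delta>) s t \<^bold>: subst (length \<Delta>) s T))"
proof (induction rule: ctx_typing.induct)
  case ctx_Nil
  then show ?case by (auto intro: ctx_typing.intros)
next
  case (ctx_Cons \<Gamma>' A i)
  show ?case
  proof (intro allI impI)
    fix \<Delta> assume *: "A # \<Gamma>' = \<Delta> @ D # \<Gamma>" "\<Gamma> \<turnstile> s \<^bold>: D"
    show "ctx (subst_ctx s \<Delta> @ \<Gamma>)"
    proof (cases \<Delta>)
      case Nil
      then show ?thesis using * ctx_Cons ctx_typing_ctx ctx_typing.ctx_Cons by fastforce
    next
      case (Cons B \<Delta>')
      then show ?thesis using * ctx_Cons ctx_typing.ctx_Cons by fastforce
    qed
  qed
next
  case (Var \<Gamma>' n)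
  show ?case
  proof (intro allI impI)
    fix \<Delta> assume *: "\<Gamma>' = \<Delta> @ D # \<Gamma>" "\<Gamma> \<turnstile> s \<^bold>: D"
    then have c: "ctx (subst_ctx s \<Delta> @ \<Gamma>)" using Var by blast
    have "n < length \<Delta> \<or> n = length \<Delta> \<or> length \<Delta> < n" by arith
    then show "subst_ctx s \<Delta> @ \<Gamma> \<turnstile> subst (length \<Delta>) s (Var n) \<^bold>: subst (length \<Delta>) s (wk (Suc n) (\<Gamma>' ! n))"
    proof (elim disjE)
      assume "n < length \<Delta>"
      then show ?thesis using ctx_typing.Var[OF c, of n] * nth_subst_ctx[of n \<Delta> s]
        by (simp add: nth_append)
    next
      assume "n = length \<Delta>"
      then show ?thesis using weakening_ctx[OF *(2), of "subst_ctx s \<Delta>"] c *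
        by (simp add: nth_append subst_lift_cancel)
    next
      assume "length \<Delta> < n"
      then obtain m where "n = Suc m" "length \<Delta> \<le> m" by (cases n) auto
      then show ?thesis using ctx_typing.Var[OF c, of m] * Var(2)
        by (simp add: nth_append subst_lift_cancel Suc_diff_le)
    qed
  qed
next
  case (Conv \<Gamma>' t A B i)
  then show ?case by (simp, metis ctx_typing.Conv conv_subst)
next
  case (Pi \<Gamma>' A i B j)
  show ?case
  proof (intro allI impI)
    fix \<Delta> assume *: "\<Gamma>' = \<Delta> @ D # \<Gamma>" "\<Gamma> \<turnstile> s \<^bold>: D"
    then show "subst_ctx s \<Delta> @ \<Gamma> \<turnstile> subst (length \<Delta>) s (Pi A B) \<^bold>: subst (length \<Delta>) s (Univ (max i j))"
      using Pi.IH(1)[rule_format, OF *] Pi.IH(2)[rule_format, of "A # \<Delta>"]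
      by (auto intro: ctx_typing.Pi)
  qed
next
  case (Lam \<Gamma>' A B i b)
  show ?case
  proof (intro allI impI)
    fix \<Delta> assume *: "\<Gamma>' = \<Delta> @ D # \<Gamma>" "\<Gamma> \<turnstile> s \<^bold>: D"
    then show "subst_ctx s \<Delta> @ \<Gamma> \<turnstile> subst (length \<Delta>) s (Lam A b) \<^bold>: subst (length \<Delta>) s (Pi A B)"
      using Lam.IH(1)[rule_format, OF *] Lam.IH(2)[rule_format, of "A # \<Delta>"]
      by (auto intro: ctx_typing.Lam)
  qed
next
  case (Sig \<Gamma>' A i B j)
  show ?case
  proof (intro allI impI)
    fix \<Delta> assume *: "\<Gamma>' = \<Delta> @ D # \<Gamma>" "\<Gamma> \<turnstile> s \<^bold>: D"
    then show "subst_ctx s \<Delta> @ \<Gamma> \<turnstile> subst (length \<Delta>) s (Sig A B) \<^bold>: subst (length \<Delta>) s (Univ (max i j))"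
      using Sig.IH(1)[rule_format, OF *] Sig.IH(2)[rule_format, of "A # \<Delta>"]
      by (auto intro: ctx_typing.Sig)
  qed
next
  case (App \<Gamma>' f A B a)
  then show ?case by (auto simp: subst_subst_0 intro: ctx_typing.App)
next
  case (MkPair \<Gamma>' A B i a b)
  then show ?case by (auto simp: subst_subst_0 intro: ctx_typing.MkPair)
next
  case (Split \<Gamma>' C A B k c p)
  then show ?case by (clarsimp simp: subst_wk_Suc) (rule ctx_typing.Split[unfolded One_nat_def], assumption+)
next
  case (Case \<Gamma>' C A B k f g r)
  then show ?case by (clarsimp simp: subst_wk_Suc) (rule ctx_typing.Case[unfolded One_nat_def], assumption+)
next
  case (J \<Gamma>' C A a k c b p)
  then show ?case by (clarsimp simp: subst_wk_Suc) (rule ctx_typing.J[unfolded One_nat_def], assumption+)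
next
  case (TrRec \<Gamma>' P k h f A x)
  then show ?case by (clarsimp simp: subst_wk_Suc) (rule ctx_typing.TrRec[unfolded One_nat_def], assumption+)
next
  case (FunExt \<Gamma>' f A B g h)
  then show ?case by (clarsimp simp: subst_wk_Suc) (rule ctx_typing.FunExt[unfolded One_nat_def], assumption+)
next
  case (PropExt \<Gamma>' P i Q p q f g)
  then show ?case by (clarsimp simp: subst_wk_Suc) (rule ctx_typing.PropExt[unfolded One_nat_def], assumption+)
next
  case (Abort \<Gamma>' C k e)
  then show ?case by (clarsimp simp: subst_wk_Suc) (rule ctx_typing.Abort[unfolded One_nat_def], assumption+)
next
  case (UElim \<Gamma>' C k c u)
  then show ?case by (clarsimp simp: subst_wk_Suc) (rule ctx_typing.UElim[unfolded One_nat_def], assumption+)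
qed (auto intro: ctx_typing.intros)

lemma substitution: "D # \<Gamma> \<turnstile> t \<^bold>: T \<Longrightarrow> \<Gamma> \<turnstile> s \<^bold>: D \<Longrightarrow> \<Gamma> \<turnstile> subst 0 s t \<^bold>: subst 0 s T"
  using substitution_aux[of "D # \<Gamma>" D \<Gamma> s t T] by (auto dest: spec[where x = "[]"])

lemma substitution_Univ: "D # \<Gamma> \<turnstile> T \<^bold>: Univ k \<Longrightarrow> \<Gamma> \<turnstile> s \<^bold>: D \<Longrightarrow> \<Gamma> \<turnstile> subst 0 s T \<^bold>: Univ k"
  using substitution[of D \<Gamma> T "Univ k" s] by simp

lemma weakening_Univ: "\<Gamma> \<turnstile> T \<^bold>: Univ k \<Longrightarrow> \<Gamma> \<turnstile> D \<^bold>: Univ l \<Longrightarrow> D # \<Gamma> \<turnstile> wk 1 T \<^bold>: Univ k"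
  using weakening[of \<Gamma> T "Univ k" D l] by simp

lemma weakening_1_Univ:
  "B # \<Gamma> \<turnstile> T \<^bold>: Univ k \<Longrightarrow> \<Gamma> \<turnstile> D \<^bold>: Univ l \<Longrightarrow> wk 1 B # D # \<Gamma> \<turnstile> lift 1 1 T \<^bold>: Univ k"
  using weakening_1[of B \<Gamma> T "Univ k" D l] by simp

text \<open>\<open>T\<close> is left arbitrary: \<open>Conv\<close> changes the type of a term but
  not the term, so its case is the induction hypothesis.\<close>

lemma formation_inversion_aux:
  "\<Gamma> \<turnstile> t \<^bold>: T \<Longrightarrow>
    (\<forall>A B. t = Pi A B \<or> t = Sig A B \<longrightarrow> (\<exists>i j. \<Gamma> \<turnstile> A \<^bold>: Univ i \<and> A # \<Gamma> \<turnstile> B \<^bold>: Univ j)) \<and>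
    (\<forall>A B. t = Plus A B \<longrightarrow> (\<exists>i j. \<Gamma> \<turnstile> A \<^bold>: Univ i \<and> \<Gamma> \<turnstile> B \<^bold>: Univ j)) \<and>
    (\<forall>A a b. t = Eq A a b \<longrightarrow> (\<exists>i. \<Gamma> \<turnstile> A \<^bold>: Univ i) \<and> \<Gamma> \<turnstile> a \<^bold>: A \<and> \<Gamma> \<turnstile> b \<^bold>: A) \<and>
    (\<forall>A. t = Tr A \<longrightarrow> (\<exists>i. \<Gamma> \<turnstile> A \<^bold>: Univ i))"
proof -
  have "(ctx \<Gamma> \<longrightarrow> True) \<and> (\<Gamma> \<turnstile> t \<^bold>: T \<longrightarrow> 
    (\<forall>A B. t = Pi A B \<or> t = Sig A B \<longrightarrow> (\<exists>i j. \<Gamma> \<turnstile> A \<^bold>: Univ i \<and> A # \<Gamma> \<turnstile> B \<^bold>: Univ j)) \<and>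
    (\<forall>A B. t = Plus A B \<longrightarrow> (\<exists>i j. \<Gamma> \<turnstile> A \<^bold>: Univ i \<and> \<Gamma> \<turnstile> B \<^bold>: Univ j)) \<and>
    (\<forall>A a b. t = Eq A a b \<longrightarrow> (\<exists>i. \<Gamma> \<turnstile> A \<^bold>: Univ i) \<and> \<Gamma> \<turnstile> a \<^bold>: A \<and> \<Gamma> \<turnstile> b \<^bold>: A) \<and>
    (\<forall>A. t = Tr A \<longrightarrow> (\<exists>i. \<Gamma> \<turnstile> A \<^bold>: Univ i)))" for \<Gamma> t T
    by (induction rule: ctx_typing.induct) auto
  then show "\<Gamma> \<turnstile> t \<^bold>: T \<Longrightarrow> ?thesis" by blast
qed

definition is_type :: "tm list \<Rightarrow> tm \<Rightarrow> bool" where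
  "is_type \<Gamma> T \<longleftrightarrow> (\<exists>i. \<Gamma> \<turnstile> T \<^bold>: Univ i)"

lemma is_typeI: "\<Gamma> \<turnstile> T \<^bold>: Univ i \<Longrightarrow> is_type \<Gamma> T"
  by (auto simp: is_type_def)

lemma is_type_PiD: "is_type \<Gamma> (Pi A B) \<Longrightarrow> is_type \<Gamma> A \<and> is_type (A # \<Gamma>) B"
  unfolding is_type_def using formation_inversion_aux[of \<Gamma> "Pi A B"] by blast

lemma is_type_SigD: "is_type \<Gamma> (Sig A B) \<Longrightarrow> is_type \<Gamma> A \<and> is_type (A # \<Gamma>) B"
  unfolding is_type_def using formation_inversion_aux[of \<Gamma> "Sig A B"] by blast

lemma is_type_PlusD: "is_type \<Gamma> (Plus A B) \<Longrightarrow> is_type \<Gamma> A \<and> is_type \<Gamma> B"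
  unfolding is_type_def using formation_inversion_aux[of \<Gamma> "Plus A B"] by blast

lemma is_type_EqD: "is_type \<Gamma> (Eq A a b) \<Longrightarrow> is_type \<Gamma> A \<and> \<Gamma> \<turnstile> a \<^bold>: A \<and> \<Gamma> \<turnstile> b \<^bold>: A"
  unfolding is_type_def using formation_inversion_aux[of \<Gamma> "Eq A a b"] by blast

lemma is_type_TrD: "is_type \<Gamma> (Tr A) \<Longrightarrow> is_type \<Gamma> A"
  unfolding is_type_def using formation_inversion_aux[of \<Gamma> "Tr A"] by blast

lemma is_type_subst: "is_type (D # \<Gamma>) T \<Longrightarrow> \<Gamma> \<turnstile> s \<^bold>: D \<Longrightarrow> is_type \<Gamma> (subst 0 s T)"
  unfolding is_type_def using substitution_Univ by blast

lemma is_type_weaken: "is_type \<Gamma> T \<Longrightarrow> is_type \<Gamma> D \<Longrightarrow> is_type (D # \<Gamma>) (wk 1 T)"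
  unfolding is_type_def using weakening_Univ by blast

lemma is_type_Pi: "is_type \<Gamma> A \<Longrightarrow> is_type (A # \<Gamma>) B \<Longrightarrow> is_type \<Gamma> (Pi A B)"
  unfolding is_type_def using ctx_typing.Pi by blast

lemma is_type_Eq: "is_type \<Gamma> A \<Longrightarrow> \<Gamma> \<turnstile> a \<^bold>: A \<Longrightarrow> \<Gamma> \<turnstile> b \<^bold>: A \<Longrightarrow> is_type \<Gamma> (Eq A a b)"
  unfolding is_type_def using ctx_typing.Eq by blast

lemma is_type_motive:
  "\<Gamma> \<turnstile> C \<^bold>: Pi A (Univ k) \<Longrightarrow> \<Gamma> \<turnstile> a \<^bold>: A \<Longrightarrow> is_type \<Gamma> (App C a)"
  unfolding is_type_def using ctx_typing.App[of \<Gamma> C A "Univ k" a] by auto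

lemma is_type_nth: "ctx \<Gamma> \<Longrightarrow> n < length \<Gamma> \<Longrightarrow> is_type \<Gamma> (wk (Suc n) (\<Gamma> ! n))"
proof (induction \<Gamma> arbitrary: n)
  case (Cons D \<Gamma>)
  then obtain l where D: "\<Gamma> \<turnstile> D \<^bold>: Univ l" and "ctx \<Gamma>" by (auto elim: ctx.cases)
  show ?case
  proof (cases n)
    case 0
    then show ?thesis using weakening_Univ[OF D D] by (auto intro: is_typeI)
  next
    case (Suc m)
    with Cons \<open>ctx \<Gamma>\<close> have "is_type \<Gamma> (wk (Suc m) (\<Gamma> ! m))" by auto
    from is_type_weaken[OF this is_typeI[OF D]] Suc show ?thesis by (simp add: lift_lift_merge)
  qed
qed simp

text \<open>Recovers the presuppositions of a judgement from the judgement itself. Through it, a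
  function of inferred type \<open>Pi A B\<close> certifies \<open>A\<close> as a type before the
  argument is checked against it.\<close>

lemma regularity: "\<Gamma> \<turnstile> t \<^bold>: T \<Longrightarrow> is_type \<Gamma> T"
proof -
  have "(ctx \<Gamma> \<longrightarrow> True) \<and> (\<Gamma> \<turnstile> t \<^bold>: T \<longrightarrow> is_type \<Gamma> T)" for \<Gamma> t T
  proof (induction rule: ctx_typing.induct)
    case (App \<Gamma> f A B a)
    then show ?case using is_type_PiD is_type_subst by blast
  next
    case (Var \<Gamma> n)
    then show ?case using is_type_nth by blast
  next
    case (J \<Gamma> C A a k c b p)
    then show ?case
      using ctx_typing.App[of \<Gamma> C A "Pi (Eq (wk 1 A) (wk 1 a) (Var 0)) (Univ k)" b]
      by (auto simp: subst_wk_1 lift_0 intro: is_type_motive)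
  next
    case (Rfl \<Gamma> a A)
    then show ?case using is_type_Eq by blast
  next
    case (TrIn \<Gamma> a A)
    then show ?case unfolding is_type_def using ctx_typing.Tr by blast
  next
    case (TrProp \<Gamma> x A y)
    then show ?case using is_type_Eq by blast
  next
    case (FunExt \<Gamma> f A B g h)
    then show ?case using is_type_Eq by blast
  next
    case (PropExt \<Gamma> P i Q p q f g)
    then show ?case by (meson ctx_typing.Univ ctx_typing_ctx is_typeI is_type_Eq)
  qed (blast intro: is_typeI is_type_motive ctx_typing.Univ ctx_typing.Unit dest: ctx_typing_ctx)+
  then show "\<Gamma> \<turnstile> t \<^bold>: T \<Longrightarrow> is_type \<Gamma> T" by blast
qed

section \<open>Bidirectional type checking\<close>

lemma substitution_1:
  "E # D # \<Gamma> \<turnstile> t \<^bold>: T \<Longrightarrow> \<Gamma> \<turnstile> s \<^bold>: D \<Longrightarrow> subst 0 s E # \<Gamma> \<turnstile> subst 1 s t \<^bold>: subst 1 s T"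
  using substitution_aux[of "E # D # \<Gamma>" D \<Gamma> s t T] by (auto dest: spec[where x = "[E]"])

text \<open>Over \<open>B # A # \<Gamma>\<close>, the second component of the generic pair is
  expected in \<open>B\<close> at the first component, \<open>Var 1\<close>; this identifies that
  type with the declared one.\<close>

lemma subst_Var_1_lift: "subst k (Var (Suc 0)) (lift 2 (Suc k) t) = lift (Suc 0) k t"
  by (induction t arbitrary: k) auto

lemma is_type_ctx: "is_type \<Gamma> T \<Longrightarrow> ctx \<Gamma>"
  unfolding is_type_def using ctx_typing_ctx by blast

lemma typing_conv: "\<Gamma> \<turnstile> t \<^bold>: A \<Longrightarrow> A \<cong> B \<Longrightarrow> is_type \<Gamma> B \<Longrightarrow> \<Gamma> \<turnstile> t \<^bold>: B"
  unfolding is_type_def using ctx_typing.Conv by blast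

lemma typing_Lam: "is_type \<Gamma> A \<Longrightarrow> A # \<Gamma> \<turnstile> b \<^bold>: B \<Longrightarrow> \<Gamma> \<turnstile> Lam A b \<^bold>: Pi A B"
  using is_type_Pi[of \<Gamma> A B] regularity ctx_typing.Lam[of \<Gamma> A B _ b] unfolding is_type_def by blast

lemma is_type_IsProp: "is_type \<Gamma> P \<Longrightarrow> is_type \<Gamma> (IsProp P)"
proof -
  assume P: "is_type \<Gamma> P"
  have P1: "is_type (P # \<Gamma>) (wk 1 P)" by (rule is_type_weaken[OF P P])
  have P2: "is_type (wk 1 P # P # \<Gamma>) (wk 2 P)"
    using is_type_weaken[OF P1 P1] by (simp add: lift_lift_merge numeral_2_eq_2)
  have c: "ctx (wk 1 P # P # \<Gamma>)" by (rule is_type_ctx[OF P2])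
  have "wk 1 P # P # \<Gamma> \<turnstile> Var 1 \<^bold>: wk 2 P" "wk 1 P # P # \<Gamma> \<turnstile> Var 0 \<^bold>: wk 2 P"
    using ctx_typing.Var[OF c, of 0] ctx_typing.Var[OF c, of 1]
    by (simp_all add: lift_lift_merge numeral_2_eq_2)
  with P P1 P2 show ?thesis by (intro is_type_Pi is_type_Eq)
qed

text \<open>
  The views return the inspected term unless it has the expected head; so a normalised argument is
  evaluated only once when the equations of \<open>nf\<close> are used as rewrite rules.
\<close>

definition view_Lam :: "tm \<Rightarrow> tm + tm" where
  "view_Lam t = (case t of Lam A b \<Rightarrow> Inr b | _ \<Rightarrow> Inl t)"

definition view_MkPair :: "tm \<Rightarrow> tm + tm \<times> tm" where
  "view_MkPair t = (case t of MkPair a b \<Rightarrow> Inr (a, b) | _ \<Rightarrow> Inl t)"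

definition view_In :: "tm \<Rightarrow> tm + tm + tm" where
  "view_In t = (case t of InL a \<Rightarrow> Inr (Inl a) | InR b \<Rightarrow> Inr (Inr b) | _ \<Rightarrow> Inl t)"

definition view_Rfl :: "tm \<Rightarrow> tm + tm" where
  "view_Rfl t = (case t of Rfl a \<Rightarrow> Inr a | _ \<Rightarrow> Inl t)"

lemmas view_defs = view_Lam_def view_MkPair_def view_In_def view_Rfl_def

lemma view_Inl:
  "view_Lam t = Inl u \<Longrightarrow> t = u" "view_MkPair t = Inl u \<Longrightarrow> t = u"
  "view_In t = Inl u \<Longrightarrow> t = u" "view_Rfl t = Inl u \<Longrightarrow> t = u"
  unfolding view_defs by (cases t; simp)+

lemma view_Inr:
  "view_Lam t = Inr b \<Longrightarrow> \<exists>A. t = Lam A b"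
  "view_MkPair t = Inr (a, b) \<Longrightarrow> t = MkPair a b"
  "view_In t = Inr (Inl a) \<Longrightarrow> t = InL a"
  "view_In t = Inr (Inr b) \<Longrightarrow> t = InR b"
  "view_Rfl t = Inr a \<Longrightarrow> t = Rfl a"
  unfolding view_defs by (cases t; simp)+

text \<open>The first argument bounds the number of nested contractions.\<close>

fun nf :: "nat \<Rightarrow> tm \<Rightarrow> tm" where
  "nf n (Var i) = Var i"
| "nf n (Univ i) = Univ i"
| "nf n (Pi A B) = Pi (nf n A) (nf n B)"
| "nf n (Lam A b) = Lam (nf n A) (nf n b)"
| "nf 0 (App f a) = App f a"
| "nf (Suc n) (App f a) = (case view_Lam (nf (Suc n) f) of
      Inl f' \<Rightarrow> App f' (nf (Suc n) a)
    | Inr b \<Rightarrow> nf n (subst 0 a b))"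
| "nf n (Sig A B) = Sig (nf n A) (nf n B)"
| "nf n (MkPair a b) = MkPair (nf n a) (nf n b)"
| "nf 0 (Split C c p) = Split C c p"
| "nf (Suc n) (Split C c p) = (case view_MkPair (nf (Suc n) p) of
      Inl p' \<Rightarrow> Split (nf (Suc n) C) (nf (Suc n) c) p'
    | Inr (a, b) \<Rightarrow> nf n (App (App c a) b))"
| "nf n (Plus A B) = Plus (nf n A) (nf n B)"
| "nf n (InL a) = InL (nf n a)"
| "nf n (InR b) = InR (nf n b)"
| "nf 0 (Case C f g s) = Case C f g s"
| "nf (Suc n) (Case C f g s) = (case view_In (nf (Suc n) s) of
      Inl s' \<Rightarrow> Case (nf (Suc n) C) (nf (Suc n) f) (nf (Suc n) g) s'
    | Inr (Inl a) \<Rightarrow> nf n (App f a)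
    | Inr (Inr b) \<Rightarrow> nf n (App g b))"
| "nf n (Eq A a b) = Eq (nf n A) (nf n a) (nf n b)"
| "nf n (Rfl a) = Rfl (nf n a)"
| "nf n (J C c b p) = (case view_Rfl (nf n p) of
      Inl p' \<Rightarrow> J (nf n C) (nf n c) (nf n b) p'
    | Inr _ \<Rightarrow> nf n c)"
| "nf n (Tr A) = Tr (nf n A)"
| "nf n (TrIn a) = TrIn (nf n a)"
| "nf n t = t"

lemma conv_nf: "t \<cong> nf n t"
proof (induction n t rule: nf.induct)
  \<comment> \<open>The numbered cases of the induction are the redexes: application here, then pair
    elimination, sum elimination and \<open>J\<close>.\<close>
  case (6 n f a)
  show ?case
  proof (cases "view_Lam (nf (Suc n) f)")
    case (Inl f')
    with 6 view_Inl(1)[OF Inl] show ?thesis by (auto intro: conv.App)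
  next
    case (Inr b)
    then obtain A where A: "nf (Suc n) f = Lam A b" by (auto dest: view_Inr)
    have "App f a \<cong> App (Lam A b) a"
      using 6(1) A by (auto intro: conv.App conv.refl)
    moreover have "subst 0 a b \<cong> nf n (subst 0 a b)" using 6(3) Inr by auto
    ultimately show ?thesis using Inr conv.beta conv.trans by (simp, blast)
  qed
next
  case (10 n C c p)
  show ?case
  proof (cases "view_MkPair (nf (Suc n) p)")
    case (Inl p')
    with 10 view_Inl(2)[OF Inl] show ?thesis by (auto intro: conv.Split)
  next
    case (Inr ab)
    then obtain a b where ab: "ab = (a, b)" "nf (Suc n) p = MkPair a b"
      by (cases ab) (auto dest: view_Inr)
    have "Split C c p \<cong> Split C c (MkPair a b)"
      using 10(1) ab by (auto intro: conv.Split conv.refl)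
    moreover have "App (App c a) b \<cong> nf n (App (App c a) b)" using 10(4) Inr ab by auto
    ultimately show ?thesis using Inr ab conv.split_pair conv.trans by (simp, blast)
  qed
next
  case (15 n C f g s)
  show ?case
  proof (cases "view_In (nf (Suc n) s)")
    case (Inl s')
    with 15 view_Inl(3)[OF Inl] show ?thesis by (auto intro: conv.Case)
  next
    case (Inr i)
    show ?thesis
    proof (cases i)
      case (Inl a)
      then have "Case C f g s \<cong> Case C f g (InL a)"
        using 15(1) Inr view_Inr(3) by (auto intro: conv.Case conv.refl)
      moreover have "App f a \<cong> nf n (App f a)" using 15 Inr Inl by auto
      ultimately show ?thesis using Inr Inl conv.case_inl conv.trans by (simp, blast)
    next
      case i: (Inr b)
      then have "Case C f g s \<cong> Case C f g (InR b)"
        using 15(1) Inr view_Inr(4) by (auto intro: conv.Case conv.refl)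
      moreover have "App g b \<cong> nf n (App g b)" using 15 Inr i by auto
      ultimately show ?thesis using Inr i conv.case_inr conv.trans by (simp, blast)
    qed
  qed
next
  case (18 n C c b p)
  show ?case
  proof (cases "view_Rfl (nf n p)")
    case (Inl p')
    with 18 view_Inl(4)[OF Inl] show ?thesis by (auto intro: conv.J)
  next
    case (Inr a)
    then have "J C c b p \<cong> J C c b (Rfl a)"
      using 18(1) view_Inr(5)[OF Inr] by (auto intro: conv.J conv.refl)
    moreover have "c \<cong> nf n c" using 18 Inr by auto
    ultimately show ?thesis using Inr conv.J_refl conv.trans by (simp, blast)
  qed
\<comment> \<open>Reflexivity and the congruences only; symmetry and transitivity would make the
  search diverge.\<close>
qed (auto intro: conv.intros(7) conv.intros(10-))

lemma conv_by_nf: "nf n t = nf n u \<Longrightarrow> t \<cong> u"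
  by (metis conv_nf conv.sym conv.trans)

text \<open>The presuppositions are built into the judgements: inference may assume a well-formed
  context, checking may assume that the given type is one. Each rule re-establishes them for its
  premises, so no such side goals appear during a check.\<close>

definition infers :: "tm list \<Rightarrow> tm \<Rightarrow> tm \<Rightarrow> bool" where
  "infers \<Gamma> t T \<longleftrightarrow> (ctx \<Gamma> \<longrightarrow> \<Gamma> \<turnstile> t \<^bold>: T)"

definition checks :: "tm list \<Rightarrow> tm \<Rightarrow> tm \<Rightarrow> bool" where
  "checks \<Gamma> t T \<longleftrightarrow> (is_type \<Gamma> T \<longrightarrow> \<Gamma> \<turnstile> t \<^bold>: T)"

definition whnf :: "tm list \<Rightarrow> tm \<Rightarrow> tm \<Rightarrow> bool" where
  "whnf \<Gamma> T T' \<longleftrightarrow> (is_type \<Gamma> T \<longrightarrow> T \<cong> T' \<and> is_type \<Gamma> T')"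

text \<open>An equation to be solved by unification; other equations are solved by evaluation.\<close>

definition same :: "tm \<Rightarrow> tm \<Rightarrow> bool" where
  "same t u \<longleftrightarrow> t = u"

lemma sameI: "same t t"
  by (simp add: same_def)

lemma infersD: "infers \<Gamma> t T \<Longrightarrow> ctx \<Gamma> \<Longrightarrow> \<Gamma> \<turnstile> t \<^bold>: T"
  by (simp add: infers_def)

lemma checksD: "checks \<Gamma> t T \<Longrightarrow> is_type \<Gamma> T \<Longrightarrow> \<Gamma> \<turnstile> t \<^bold>: T"
  by (simp add: checks_def)

lemma infers_UnivD: "infers \<Gamma> T (Univ i) \<Longrightarrow> ctx \<Gamma> \<Longrightarrow> is_type \<Gamma> T"
  by (auto simp: infers_def intro: is_typeI)

lemma whnfD: "whnf \<Gamma> T T' \<Longrightarrow> \<Gamma> \<turnstile> t \<^bold>: T \<Longrightarrow> \<Gamma> \<turnstile> t \<^bold>: T'"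
  using regularity typing_conv unfolding whnf_def by blast

lemma is_type_Cons: "is_type \<Gamma> T \<Longrightarrow> ctx (T # \<Gamma>)"
  using is_type_ctx ctx_typing.ctx_Cons unfolding is_type_def by blast

lemma whnf_refl: "whnf \<Gamma> T T"
  by (simp add: whnf_def conv.refl)

text \<open>The second premise replaces subject reduction. The normal form is computed into
  \<open>U\<close> first and only then matched with the expected shape \<open>T'\<close>, which may
  contain unknowns.\<close>

lemma whnf_nf: "nf n T = U \<Longrightarrow> infers \<Gamma> U (Univ i) \<Longrightarrow> same U T' \<Longrightarrow> whnf \<Gamma> T T'"
  unfolding whnf_def same_def using conv_nf infers_UnivD is_type_ctx by blast

text \<open>Resolved entry by entry with \<open>lookup_0\<close> and \<open>lookup_Suc\<close>,
  which avoids arithmetic on context lengths.\<close>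

definition lookup :: "tm list \<Rightarrow> nat \<Rightarrow> tm \<Rightarrow> bool" where
  "lookup \<Gamma> n A \<longleftrightarrow> n < length \<Gamma> \<and> \<Gamma> ! n = A"

lemma lookup_0: "lookup (A # \<Gamma>) 0 A"
  by (simp add: lookup_def)

lemma lookup_Suc: "lookup \<Gamma> n A \<Longrightarrow> lookup (B # \<Gamma>) (Suc n) A"
  by (simp add: lookup_def)

lemma infers_Var: "lookup \<Gamma> n A \<Longrightarrow> wk (Suc n) A = T \<Longrightarrow> infers \<Gamma> (Var n) T"
  unfolding infers_def lookup_def using ctx_typing.Var by blast

lemma infers_Univ: "infers \<Gamma> (Univ i) (Univ (Suc i))"
  unfolding infers_def using ctx_typing.Univ by blast

lemma infers_Pi: "infers \<Gamma> A (Univ i) \<Longrightarrow> infers (A # \<Gamma>) B (Univ j) \<Longrightarrow> infers \<Gamma> (Pi A B) (Univ (max i j))"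
  unfolding infers_def using ctx_typing.Pi ctx_typing.ctx_Cons by blast

lemma infers_Sig: "infers \<Gamma> A (Univ i) \<Longrightarrow> infers (A # \<Gamma>) B (Univ j) \<Longrightarrow> infers \<Gamma> (Sig A B) (Univ (max i j))"
  unfolding infers_def using ctx_typing.Sig ctx_typing.ctx_Cons by blast

lemma infers_Lam: "infers \<Gamma> A (Univ i) \<Longrightarrow> infers (A # \<Gamma>) b B \<Longrightarrow> infers \<Gamma> (Lam A b) (Pi A B)"
  unfolding infers_def using ctx_typing.ctx_Cons is_typeI typing_Lam by blast

lemma infers_App:
  assumes f: "infers \<Gamma> f F" and F: "whnf \<Gamma> F (Pi A B)" and a: "checks \<Gamma> a A" and T: "subst 0 a B = T"
  shows "infers \<Gamma> (App f a) T"
  unfolding infers_def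
proof
  assume "ctx \<Gamma>"
  with f F have f': "\<Gamma> \<turnstile> f \<^bold>: Pi A B" using whnfD infersD by blast
  then have "\<Gamma> \<turnstile> a \<^bold>: A" using a checksD regularity is_type_PiD by blast
  with f' T show "\<Gamma> \<turnstile> App f a \<^bold>: T" using ctx_typing.App by blast
qed

lemma infers_Empty: "infers \<Gamma> Empty (Univ 0)"
  unfolding infers_def using ctx_typing.Empty by blast

lemma infers_Unit: "infers \<Gamma> Unit (Univ 0)"
  unfolding infers_def using ctx_typing.Unit by blast

lemma infers_Star: "infers \<Gamma> Star Unit"
  unfolding infers_def using ctx_typing.Star by blast

lemma infers_Plus: "infers \<Gamma> A (Univ i) \<Longrightarrow> infers \<Gamma> B (Univ j) \<Longrightarrow> infers \<Gamma> (Plus A B) (Univ (max i j))"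
  unfolding infers_def using ctx_typing.Plus by blast

lemma infers_Eq: "infers \<Gamma> A (Univ i) \<Longrightarrow> checks \<Gamma> a A \<Longrightarrow> checks \<Gamma> b A \<Longrightarrow> infers \<Gamma> (Eq A a b) (Univ i)"
  unfolding infers_def checks_def using ctx_typing.Eq is_typeI by blast

lemma infers_Tr: "infers \<Gamma> A (Univ i) \<Longrightarrow> infers \<Gamma> (Tr A) (Univ i)"
  unfolding infers_def using ctx_typing.Tr by blast

lemma infers_TrProp:
  "infers \<Gamma> x T \<Longrightarrow> whnf \<Gamma> T (Tr A) \<Longrightarrow> checks \<Gamma> y (Tr A) \<Longrightarrow> infers \<Gamma> (TrProp x y) (Eq (Tr A) x y)"
  unfolding infers_def using ctx_typing.TrProp whnfD checksD regularity by blast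

text \<open>Equational premises such as \<open>wk 1 P = P1\<close> compute a type before a later
  premise uses it. The scrutinee \<open>x\<close> precedes the branch \<open>f\<close> because
  \<open>A\<close> becomes known only from the type of \<open>x\<close>.\<close>

lemma infers_TrRec:
  assumes P: "infers \<Gamma> P (Univ k)" and lift: "wk 1 P = P1" "wk 2 P = P2"
    and h: "checks \<Gamma> h (Pi P (Pi P1 (Eq P2 (Var (Suc 0)) (Var 0))))"
    and x: "infers \<Gamma> x T" "whnf \<Gamma> T (Tr A)" and f: "checks \<Gamma> f (Pi A P1)"
  shows "infers \<Gamma> (TrRec P h f x) P"
  unfolding infers_def
proof
  assume c: "ctx \<Gamma>"
  have P': "is_type \<Gamma> P" using P c by (rule infers_UnivD)
  have x': "\<Gamma> \<turnstile> x \<^bold>: Tr A" using x c whnfD infersD by blast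
  then have A: "is_type \<Gamma> A" using regularity is_type_TrD by blast
  have "is_type \<Gamma> (Pi A P1)" using is_type_Pi[OF A is_type_weaken[OF P' A]] lift by simp
  then show "\<Gamma> \<turnstile> TrRec P h f x \<^bold>: P"
    using ctx_typing.TrRec[OF infersD[OF P c], of h f A x] checksD[OF f] checksD[OF h] lift
      is_type_IsProp[OF P'] x' by simp
qed

lemma checks_if_infers: "infers \<Gamma> t T' \<Longrightarrow> T' \<cong> T \<Longrightarrow> checks \<Gamma> t T"
  unfolding checks_def infers_def using typing_conv is_type_ctx by blast

lemma checks_Lam: "checks (A # \<Gamma>) b B \<Longrightarrow> checks \<Gamma> (Lam A b) (Pi A B)"
  unfolding checks_def using is_type_PiD typing_Lam by blast

text \<open>Declare \<open>A'\<close> below the variable of type \<open>A\<close>, then instantiate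
  that variable with the new one, whose type converts to \<open>A\<close>.\<close>

lemma typing_ctx_conv:
  assumes "A # \<Gamma> \<turnstile> t \<^bold>: T" "A \<cong> A'" "is_type \<Gamma> A'" "is_type \<Gamma> A"
  shows "A' # \<Gamma> \<turnstile> t \<^bold>: T"
proof -
  obtain l where l: "\<Gamma> \<turnstile> A' \<^bold>: Univ l" using assms unfolding is_type_def by blast
  have 1: "wk 1 A # A' # \<Gamma> \<turnstile> lift 1 1 t \<^bold>: lift 1 1 T" by (rule weakening_1[OF assms(1) l])
  have "A' # \<Gamma> \<turnstile> Var 0 \<^bold>: wk 1 A'"
    using ctx_typing.Var[OF is_type_Cons[OF assms(3)], of 0] by simp
  moreover have "wk 1 A' \<cong> wk 1 A" using assms(2) conv_lift conv.sym by blast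
  ultimately have "A' # \<Gamma> \<turnstile> Var 0 \<^bold>: wk 1 A"
    using typing_conv is_type_weaken assms by blast
  from substitution[OF 1 this] show ?thesis by (simp add: subst_Var_lift)
qed

text \<open>For an annotation that only converts to the expected domain. The body is checked with
  its variable at the annotated type, which is the form the body was written for.\<close>

lemma checks_Lam_conv:
  assumes A: "infers \<Gamma> A (Univ i)" "A \<cong> A'" and b: "checks (A # \<Gamma>) b B"
  shows "checks \<Gamma> (Lam A b) (Pi A' B)"
  unfolding checks_def
proof
  assume P: "is_type \<Gamma> (Pi A' B)"
  then have A': "is_type \<Gamma> A'" "is_type (A' # \<Gamma>) B" using is_type_PiD by blast+
  have TA: "is_type \<Gamma> A" using A P is_type_ctx infers_UnivD by blast
  have "is_type (A # \<Gamma>) B"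
    using A' TA A(2) typing_ctx_conv conv.sym unfolding is_type_def by blast
  then have "\<Gamma> \<turnstile> Lam A b \<^bold>: Pi A B" using b TA typing_Lam checksD by blast
  then show "\<Gamma> \<turnstile> Lam A b \<^bold>: Pi A' B"
    using typing_conv P A(2) conv.Pi conv.refl by blast
qed

lemma checks_MkPair:
  "checks \<Gamma> a A \<Longrightarrow> subst 0 a B = B' \<Longrightarrow> checks \<Gamma> b B' \<Longrightarrow> checks \<Gamma> (MkPair a b) (Sig A B)"
  unfolding checks_def using is_type_SigD is_type_subst ctx_typing.MkPair is_type_def by metis

lemma checks_InL: "checks \<Gamma> a A \<Longrightarrow> checks \<Gamma> (InL a) (Plus A B)"
  unfolding checks_def using is_type_PlusD ctx_typing.InL is_type_def by metis

lemma checks_InR: "checks \<Gamma> b B \<Longrightarrow> checks \<Gamma> (InR b) (Plus A B)"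
  unfolding checks_def using is_type_PlusD ctx_typing.InR is_type_def by metis

lemma checks_TrIn: "checks \<Gamma> a A \<Longrightarrow> checks \<Gamma> (TrIn a) (Tr A)"
  unfolding checks_def using is_type_TrD ctx_typing.TrIn by metis

lemma checks_whnf:
  "nf n T = U \<Longrightarrow> infers \<Gamma> U (Univ i) \<Longrightarrow> checks \<Gamma> t U \<Longrightarrow> checks \<Gamma> t T"
  unfolding checks_def using typing_conv conv_nf conv.sym infers_UnivD is_type_ctx by metis

lemma checks_Rfl: "checks \<Gamma> c A \<Longrightarrow> c \<cong> a \<Longrightarrow> c \<cong> b \<Longrightarrow> checks \<Gamma> (Rfl c) (Eq A a b)"
  unfolding checks_def using is_type_EqD ctx_typing.Rfl typing_conv conv.Eq conv.refl by metis

lemma checks_FunExt: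
  assumes f: "checks \<Gamma> f (Pi A B)" "f \<cong> f'" and g: "checks \<Gamma> g (Pi A B)" "g \<cong> g'"
    and lift: "wk 1 f = f1" "wk 1 g = g1"
    and h: "checks \<Gamma> h (Pi A (Eq B (App f1 (Var 0)) (App g1 (Var 0))))"
  shows "checks \<Gamma> (FunExt f g h) (Eq (Pi A B) f' g')"
  unfolding checks_def
proof
  assume E: "is_type \<Gamma> (Eq (Pi A B) f' g')"
  then have P: "is_type \<Gamma> (Pi A B)" using is_type_EqD by blast
  then have A: "is_type \<Gamma> A" "is_type (A # \<Gamma>) B" using is_type_PiD by blast+
  have c: "ctx (A # \<Gamma>)" using A(2) is_type_ctx by blast
  \<comment> \<open>Applying a weakened function to the newest variable returns to the codomain
    itself, by \<open>subst_Var_lift\<close>.\<close>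
  have app: "A # \<Gamma> \<turnstile> App (wk 1 e) (Var 0) \<^bold>: B" if "\<Gamma> \<turnstile> e \<^bold>: Pi A B" for e
  proof -
    obtain l where "\<Gamma> \<turnstile> A \<^bold>: Univ l" using A unfolding is_type_def by blast
    from weakening[OF that this] have "A # \<Gamma> \<turnstile> wk 1 e \<^bold>: Pi (wk 1 A) (lift 1 1 B)" by simp
    from ctx_typing.App[OF this, of "Var 0"] ctx_typing.Var[OF c, of 0] show ?thesis
      by (simp add: subst_Var_lift)
  qed
  have fg: "\<Gamma> \<turnstile> f \<^bold>: Pi A B" "\<Gamma> \<turnstile> g \<^bold>: Pi A B" using f g P checksD by blast+
  have "\<Gamma> \<turnstile> h \<^bold>: Pi A (Eq B (App f1 (Var 0)) (App g1 (Var 0)))"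
    using h A app[OF fg(1)] app[OF fg(2)] lift is_type_Pi is_type_Eq checksD by blast
  then have "\<Gamma> \<turnstile> FunExt f g h \<^bold>: Eq (Pi A B) f g" using fg lift ctx_typing.FunExt by blast
  then show "\<Gamma> \<turnstile> FunExt f g h \<^bold>: Eq (Pi A B) f' g'"
    using E typing_conv conv.Eq conv.refl f g by blast
qed

lemma checks_PropExt:
  assumes lift: "wk 1 P = P1" "wk 2 P = P2" "wk 1 Q = Q1" "wk 2 Q = Q2"
    and p: "checks \<Gamma> p (Pi P (Pi P1 (Eq P2 (Var (Suc 0)) (Var 0))))"
    and q: "checks \<Gamma> q (Pi Q (Pi Q1 (Eq Q2 (Var (Suc 0)) (Var 0))))"
    and f: "checks \<Gamma> f (Pi P Q1)" and g: "checks \<Gamma> g (Pi Q P1)"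
  shows "checks \<Gamma> (PropExt p q f g) (Eq (Univ i) P Q)"
  unfolding checks_def
proof
  assume "is_type \<Gamma> (Eq (Univ i) P Q)"
  then have PQ: "\<Gamma> \<turnstile> P \<^bold>: Univ i" "\<Gamma> \<turnstile> Q \<^bold>: Univ i" using is_type_EqD by blast+
  then have T: "is_type \<Gamma> P" "is_type \<Gamma> Q" by (auto intro: is_typeI)
  have "is_type \<Gamma> (Arr P Q)" "is_type \<Gamma> (Arr Q P)"
    using T is_type_Pi is_type_weaken by blast+
  with f g p q lift show "\<Gamma> \<turnstile> PropExt p q f g \<^bold>: Eq (Univ i) P Q"
    using ctx_typing.PropExt[OF PQ, of p q f g] T[THEN is_type_IsProp] by (simp add: checks_def)
qed

text \<open>
  For an eliminator whose motive is a \<open>\<lambda>\<close>-abstraction, the types of its branches and of the whole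
  term are taken in \<open>\<beta>\<close>-reduced form.
\<close>

lemma typing_motive:
  assumes "is_type \<Gamma> D" "D # \<Gamma> \<turnstile> T \<^bold>: Univ k"
  shows "\<Gamma> \<turnstile> Lam D T \<^bold>: Pi D (Univ k)"
  using assms typing_Lam by blast

lemma infers_Abort:
  assumes T: "infers (Empty # \<Gamma>) T (Univ k)" and e: "checks \<Gamma> e Empty" and R: "subst 0 e T = R"
  shows "infers \<Gamma> (Abort (Lam Empty T) e) R"
  unfolding infers_def
proof
  assume c: "ctx \<Gamma>"
  have E: "is_type \<Gamma> Empty" using c ctx_typing.Empty is_typeI by blast
  have T': "Empty # \<Gamma> \<turnstile> T \<^bold>: Univ k" using T E infersD is_type_Cons by blast
  have e': "\<Gamma> \<turnstile> e \<^bold>: Empty" using e E checksD by blast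
  have "\<Gamma> \<turnstile> Abort (Lam Empty T) e \<^bold>: App (Lam Empty T) e"
    by (rule ctx_typing.Abort[OF typing_motive[OF E T'] e'])
  moreover have "is_type \<Gamma> (subst 0 e T)"
    using substitution_Univ[OF T' e'] is_typeI by blast
  ultimately show "\<Gamma> \<turnstile> Abort (Lam Empty T) e \<^bold>: R" using typing_conv conv.beta R by blast
qed

lemma infers_Split:
  assumes S: "infers \<Gamma> (Sig A B) (Univ i)" and T: "infers (Sig A B # \<Gamma>) T (Univ k)"
    and T1: "lift 2 1 T = T1" and T2: "subst 0 (MkPair (Var (Suc 0)) (Var 0)) T1 = T2"
    and c: "checks \<Gamma> c (Pi A (Pi B T2))" and p: "checks \<Gamma> p (Sig A B)" and R: "subst 0 p T = R"
  shows "infers \<Gamma> (Split (Lam (Sig A B) T) c p) R"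
  unfolding infers_def
proof
  assume "ctx \<Gamma>"
  then have S': "is_type \<Gamma> (Sig A B)" using S infers_UnivD by blast
  then have A: "is_type \<Gamma> A" and B: "is_type (A # \<Gamma>) B" using is_type_SigD by blast+
  have T': "Sig A B # \<Gamma> \<turnstile> T \<^bold>: Univ k" using T S' infersD is_type_Cons by blast
  have p': "\<Gamma> \<turnstile> p \<^bold>: Sig A B" using p S' checksD by blast
  let ?C = "Lam (Sig A B) T"
  have C: "\<Gamma> \<turnstile> ?C \<^bold>: Pi (Sig A B) (Univ k)" by (rule typing_motive[OF S' T'])
  obtain l m where l: "\<Gamma> \<turnstile> A \<^bold>: Univ l" and m: "A # \<Gamma> \<turnstile> B \<^bold>: Univ m"
    using A B unfolding is_type_def by blast
  have "wk 1 (Sig A B) # A # \<Gamma> \<turnstile> lift 1 1 T \<^bold>: Univ k"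
    by (rule weakening_1_Univ[OF T' l])
  from weakening_1_Univ[OF this m]
  have T1': "wk 2 (Sig A B) # B # A # \<Gamma> \<turnstile> T1 \<^bold>: Univ k"
    using T1 by (simp add: lift_lift_merge numeral_2_eq_2)
  have S2: "is_type (B # A # \<Gamma>) (wk 2 (Sig A B))"
    using is_type_weaken[OF is_type_weaken[OF S' A] B] by (simp add: lift_lift_merge numeral_2_eq_2)
  have c2: "ctx (B # A # \<Gamma>)" using B by (rule is_type_Cons)
  have "B # A # \<Gamma> \<turnstile> Var 1 \<^bold>: wk 2 A" using ctx_typing.Var[OF c2, of 1] by (simp add: numeral_2_eq_2)
  moreover have "B # A # \<Gamma> \<turnstile> Var 0 \<^bold>: subst 0 (Var 1) (lift 2 1 B)"
    using ctx_typing.Var[OF c2, of 0] by (simp add: subst_Var_1_lift)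
  ultimately have pair: "B # A # \<Gamma> \<turnstile> MkPair (Var 1) (Var 0) \<^bold>: wk 2 (Sig A B)"
    using S2 ctx_typing.MkPair[of "B # A # \<Gamma>" "wk 2 A" "lift 2 1 B"] unfolding is_type_def by auto
  have T2': "is_type (B # A # \<Gamma>) T2" using substitution_Univ[OF T1' pair] T2 is_typeI by auto
  have C2: "B # A # \<Gamma> \<turnstile> wk 2 ?C \<^bold>: Pi (wk 2 (Sig A B)) (Univ k)"
    using weakening[OF weakening[OF C l] m] by (simp add: lift_lift_merge numeral_2_eq_2)
  have "is_type (B # A # \<Gamma>) (App (wk 2 ?C) (MkPair (Var 1) (Var 0)))"
    by (rule is_type_motive[OF C2 pair])
  then have "is_type \<Gamma> (Pi A (Pi B (App (wk 2 ?C) (MkPair (Var 1) (Var 0)))))"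
    using A B is_type_Pi by blast
  moreover have "\<Gamma> \<turnstile> c \<^bold>: Pi A (Pi B T2)" using c A B T2' checksD is_type_Pi by blast
  moreover have "T2 \<cong> App (wk 2 ?C) (MkPair (Var 1) (Var 0))"
    using conv.beta[of "wk 2 (Sig A B)" T1 "MkPair (Var 1) (Var 0)"] T1 T2 by (simp add: conv.sym)
  ultimately have "\<Gamma> \<turnstile> c \<^bold>: Pi A (Pi B (App (wk 2 ?C) (MkPair (Var 1) (Var 0))))"
    using typing_conv conv.Pi conv.refl by blast
  from ctx_typing.Split[OF C this p'] have "\<Gamma> \<turnstile> Split ?C c p \<^bold>: App ?C p" .
  moreover have "is_type \<Gamma> (subst 0 p T)" using substitution_Univ[OF T' p'] is_typeI by blast
  ultimately show "\<Gamma> \<turnstile> Split ?C c p \<^bold>: R" using typing_conv conv.beta R by blast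
qed

lemma infers_Case:
  assumes S: "infers \<Gamma> (Plus A B) (Univ i)" and T: "infers (Plus A B # \<Gamma>) T (Univ k)"
    and T1: "lift 1 1 T = T1"
    and TL: "subst 0 (InL (Var 0)) T1 = TL" and TR: "subst 0 (InR (Var 0)) T1 = TR"
    and f: "checks \<Gamma> f (Pi A TL)" and g: "checks \<Gamma> g (Pi B TR)"
    and s: "checks \<Gamma> s (Plus A B)" and R: "subst 0 s T = R"
  shows "infers \<Gamma> (Case (Lam (Plus A B) T) f g s) R"
  unfolding infers_def
proof
  assume "ctx \<Gamma>"
  then have S': "is_type \<Gamma> (Plus A B)" using S infers_UnivD by blast
  then have A: "is_type \<Gamma> A" and B: "is_type \<Gamma> B" using is_type_PlusD by blast+
  have T': "Plus A B # \<Gamma> \<turnstile> T \<^bold>: Univ k" using T S' infersD is_type_Cons by blast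
  have s': "\<Gamma> \<turnstile> s \<^bold>: Plus A B" using s S' checksD by blast
  let ?C = "Lam (Plus A B) T"
  have C: "\<Gamma> \<turnstile> ?C \<^bold>: Pi (Plus A B) (Univ k)" by (rule typing_motive[OF S' T'])
  have branch: "\<Gamma> \<turnstile> h \<^bold>: Pi D (App (wk 1 ?C) e)"
    if D: "is_type \<Gamma> D" and e: "D # \<Gamma> \<turnstile> e \<^bold>: wk 1 (Plus A B)" and h: "checks \<Gamma> h (Pi D (subst 0 e T1))" for D e h
  proof -
    obtain l where l: "\<Gamma> \<turnstile> D \<^bold>: Univ l" using D unfolding is_type_def by blast
    have "wk 1 (Plus A B) # D # \<Gamma> \<turnstile> T1 \<^bold>: Univ k" using weakening_1_Univ[OF T' l] T1 by simp
    from substitution_Univ[OF this e] have "is_type \<Gamma> (Pi D (subst 0 e T1))"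
      using D is_typeI is_type_Pi by blast
    with h have "\<Gamma> \<turnstile> h \<^bold>: Pi D (subst 0 e T1)" using checksD by blast
    moreover have "D # \<Gamma> \<turnstile> wk 1 ?C \<^bold>: Pi (wk 1 (Plus A B)) (Univ k)" using weakening[OF C l] by simp
    then have "is_type \<Gamma> (Pi D (App (wk 1 ?C) e))" using is_type_motive e is_type_Pi D by blast
    moreover have "subst 0 e T1 \<cong> App (wk 1 ?C) e"
      using conv.beta[of "wk 1 (Plus A B)" T1 e] T1 by (simp add: conv.sym)
    ultimately show ?thesis using typing_conv conv.Pi conv.refl by blast
  qed
  have inj: "is_type (D # \<Gamma>) (wk 1 (Plus A B))" "D # \<Gamma> \<turnstile> Var 0 \<^bold>: wk 1 D" if "is_type \<Gamma> D" for D
    using is_type_weaken[OF S' that] ctx_typing.Var[OF is_type_Cons[OF that], of 0] by auto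
  have "A # \<Gamma> \<turnstile> InL (Var 0) \<^bold>: wk 1 (Plus A B)" "B # \<Gamma> \<turnstile> InR (Var 0) \<^bold>: wk 1 (Plus A B)"
    using inj[OF A] inj[OF B] ctx_typing.InL ctx_typing.InR unfolding is_type_def by simp_all metis+
  then have "\<Gamma> \<turnstile> Case ?C f g s \<^bold>: App ?C s"
    using ctx_typing.Case[OF C] branch[OF A] branch[OF B] f g TL TR s' by blast
  moreover have "is_type \<Gamma> (subst 0 s T)" using substitution_Univ[OF T' s'] is_typeI by blast
  ultimately show "\<Gamma> \<turnstile> Case ?C f g s \<^bold>: R" using typing_conv conv.beta R by blast
qed

text \<open>\<open>J\<close> does not store the left endpoint. It is read off the motive:
  \<open>a1\<close> is a weakened term, so substituting anything for the missing variable, here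
  \<open>b\<close>, gives \<open>a\<close>, and \<open>wk 1 a = a1\<close> confirms the
  reading.\<close>

lemma infers_J:
  assumes A: "infers \<Gamma> A (Univ i)" and b: "checks \<Gamma> b A"
    and a1: "subst 0 b a1 = a" "wk 1 a = a1" "wk 1 A = A1" and a: "checks \<Gamma> a A"
    and T: "infers (Eq A1 a1 (Var 0) # A # \<Gamma>) T (Univ k)"
    and Ta: "subst 1 a T = Ta" "subst 0 (Rfl a) Ta = U" and c: "checks \<Gamma> c U"
    and p: "checks \<Gamma> p (Eq A a b)"
    and R: "subst 1 b T = Tb" "subst 0 p Tb = R"
  shows "infers \<Gamma> (J (Lam A (Lam (Eq A1 a1 (Var 0)) T)) c b p) R"
  unfolding infers_def
proof
  assume "ctx \<Gamma>"
  then have A': "is_type \<Gamma> A" using A infers_UnivD by blast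
  then have a': "\<Gamma> \<turnstile> a \<^bold>: A" and b': "\<Gamma> \<turnstile> b \<^bold>: A" using a b checksD by blast+
  have p': "\<Gamma> \<turnstile> p \<^bold>: Eq A a b" using p A' a' b' checksD is_type_Eq by blast
  let ?E = "Eq (wk 1 A) (wk 1 a) (Var 0)"
  obtain l where l: "\<Gamma> \<turnstile> A \<^bold>: Univ l" using A' unfolding is_type_def by blast
  have E: "is_type (A # \<Gamma>) ?E"
    using is_type_Eq[OF is_type_weaken[OF A' A'] weakening[OF a' l]]
      ctx_typing.Var[OF is_type_Cons[OF A'], of 0] by simp
  have T': "?E # A # \<Gamma> \<turnstile> T \<^bold>: Univ k"
    using T a1 infersD[of "?E # A # \<Gamma>"] is_type_Cons[OF E] by auto
  let ?C = "Lam A (Lam ?E T)"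
  have C: "\<Gamma> \<turnstile> ?C \<^bold>: Pi A (Pi ?E (Univ k))"
    using typing_Lam[OF A' typing_motive[OF E T']] .
  \<comment> \<open>Used at \<open>a\<close> with \<open>Rfl a\<close> for the branch and at
    \<open>b\<close> with \<open>p\<close> for the result; two contractions remove the two
    abstractions of the motive.\<close>
  have motive: "is_type \<Gamma> (subst 0 q (subst 1 d T)) \<and> App (App ?C d) q \<cong> subst 0 q (subst 1 d T)
      \<and> is_type \<Gamma> (App (App ?C d) q)"
    if d: "\<Gamma> \<turnstile> d \<^bold>: A" and q: "\<Gamma> \<turnstile> q \<^bold>: Eq A a d" for d q
  proof -
    have "Eq A a d # \<Gamma> \<turnstile> subst 1 d T \<^bold>: Univ k"
      using substitution_1[OF T' d] by (simp add: subst_wk_1 lift_0)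
    then have "is_type \<Gamma> (subst 0 q (subst 1 d T))" using q substitution_Univ is_typeI by blast
    moreover have "App (App ?C d) q \<cong> App (Lam (Eq A a d) (subst 1 d T)) q"
      using conv.beta[of A "Lam ?E T" d] by (simp add: subst_wk_1 lift_0 conv.App conv.refl)
    then have "App (App ?C d) q \<cong> subst 0 q (subst 1 d T)" using conv.beta conv.trans by blast
    moreover have "\<Gamma> \<turnstile> App ?C d \<^bold>: Pi (Eq A a d) (Univ k)"
      using ctx_typing.App[OF C d] by (simp add: subst_wk_1 lift_0)
    then have "is_type \<Gamma> (App (App ?C d) q)" using q is_type_motive by blast
    ultimately show ?thesis by blast
  qed
  have ma: "is_type \<Gamma> U" "App (App ?C a) (Rfl a) \<cong> U" "is_type \<Gamma> (App (App ?C a) (Rfl a))"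
    using motive[OF a' ctx_typing.Rfl[OF a']] Ta by auto
  then have "\<Gamma> \<turnstile> c \<^bold>: App (App ?C a) (Rfl a)" using c checksD typing_conv conv.sym by blast
  then have "\<Gamma> \<turnstile> J ?C c b p \<^bold>: App (App ?C b) p" by (rule ctx_typing.J[OF C _ b' p'])
  then have "\<Gamma> \<turnstile> J ?C c b p \<^bold>: R" using motive[OF b' p'] R typing_conv by blast
  then show "\<Gamma> \<turnstile> J (Lam A (Lam (Eq A1 a1 (Var 0)) T)) c b p \<^bold>: R" using a1 by simp
qed

section \<open>Derivations in the object theory\<close>

lemma inhabitedI: "infers [] (T 0) (Univ i) \<Longrightarrow> checks [] (t 0) (T 0) \<Longrightarrow> inhabited T"
  unfolding inhabited_def using infers_UnivD checksD ctx_typing.ctx_Nil by blast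

section \<open>Term constructors with named binders\<close>

definition star :: ex where
  "star = (\<lambda>d. Star)"

definition pair :: "ex \<Rightarrow> ex \<Rightarrow> ex" where
  "pair a b = (\<lambda>d. MkPair (a d) (b d))"

definition inl :: "ex \<Rightarrow> ex" where
  "inl a = (\<lambda>d. InL (a d))"

definition inr :: "ex \<Rightarrow> ex" where
  "inr b = (\<lambda>d. InR (b d))"

text \<open>The motive is constant, but its abstraction still binds a variable, hence the depth
  \<open>Suc d\<close>.\<close>

definition abort :: "ex \<Rightarrow> ex \<Rightarrow> ex" where
  "abort C e = (\<lambda>d. Abort (Lam Empty (C (Suc d))) (e d))"

definition rfl :: "ex \<Rightarrow> ex" where
  "rfl a = (\<lambda>d. Rfl (a d))"

definition path_ind :: "ex \<Rightarrow> ex \<Rightarrow> (ex \<Rightarrow> ex \<Rightarrow> ex) \<Rightarrow> ex \<Rightarrow> ex \<Rightarrow> ex \<Rightarrow> ex" where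
  "path_ind A a C c b p =
    (\<lambda>d. J (lam A (\<lambda>y. lam (eq A a y) (\<lambda>q. C y q)) d) (c d) (b d) (p d))"

definition sym :: "ex \<Rightarrow> ex \<Rightarrow> ex \<Rightarrow> ex \<Rightarrow> ex" where
  "sym A a b p = path_ind A a (\<lambda>y _. eq A y a) (rfl a) b p"

definition trans :: "ex \<Rightarrow> ex \<Rightarrow> ex \<Rightarrow> ex \<Rightarrow> ex \<Rightarrow> ex \<Rightarrow> ex" where
  "trans A a b c p q = path_ind A b (\<lambda>y _. eq A a y) p c q"

definition let_pair :: "ex \<Rightarrow> (ex \<Rightarrow> ex) \<Rightarrow> (ex \<Rightarrow> ex) \<Rightarrow> (ex \<Rightarrow> ex \<Rightarrow> ex) \<Rightarrow> ex \<Rightarrow> ex" where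
  "let_pair A B C c p = split (lam (sig A B) C) (lam A (\<lambda>a. lam (B a) (\<lambda>b. c a b))) p"

definition case_sum :: "ex \<Rightarrow> ex \<Rightarrow> (ex \<Rightarrow> ex) \<Rightarrow> (ex \<Rightarrow> ex) \<Rightarrow> (ex \<Rightarrow> ex) \<Rightarrow> ex \<Rightarrow> ex" where
  "case_sum A B C f g s = cases (lam (plus A B) C) (lam A f) (lam B g) s"

definition proj2 :: "ex \<Rightarrow> (ex \<Rightarrow> ex) \<Rightarrow> ex \<Rightarrow> ex" where
  "proj2 A B p = let_pair A B (\<lambda>q. B (proj1 A B q)) (\<lambda>a b. b) p"

definition tr :: "ex \<Rightarrow> ex" where
  "tr A = (\<lambda>d. Tr (A d))"

definition tr_in :: "ex \<Rightarrow> ex" where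
  "tr_in a = (\<lambda>d. TrIn (a d))"

definition tr_prop :: "ex \<Rightarrow> ex \<Rightarrow> ex" where
  "tr_prop a b = (\<lambda>d. TrProp (a d) (b d))"

definition tr_rec :: "ex \<Rightarrow> ex \<Rightarrow> ex \<Rightarrow> ex \<Rightarrow> ex" where
  "tr_rec P h f x = (\<lambda>d. TrRec (P d) (h d) (f d) (x d))"

definition funext :: "ex \<Rightarrow> ex \<Rightarrow> ex \<Rightarrow> ex" where
  "funext f g h = (\<lambda>d. FunExt (f d) (g d) (h d))"

definition propext :: "ex \<Rightarrow> ex \<Rightarrow> ex \<Rightarrow> ex \<Rightarrow> ex" where
  "propext p q f g = (\<lambda>d. PropExt (p d) (q d) (f d) (g d))"

text \<open>The two facts on subtraction evaluate the index \<open>d - Suc l\<close> of a bound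
  variable; unfolding thus leaves a plain de Bruijn term.\<close>

lemmas ex_defs = bound_def pi_def lam_def sig_def univ_def app_def arr_def both_def split_def
  empty_def unit_def plus_def cases_def eq_def proj1_def neg_def is_prop_def equiv_def small_def
  Omega_def Omega_notnot_def prop_valued_def reflexive_def transitive_def antisymmetric_def
  is_sup_def delta_def is_delta_sup_def delta_complete_def delta_sup_def nontrivial_def
  strictly_below_def positive_def locally_small_def small_poset_def
  small_delta_complete_poset_with_def nontrivial_small_poset_def positive_small_poset_def
  star_def pair_def inl_def inr_def abort_def rfl_def path_ind_def sym_def trans_def let_pair_def
  case_sum_def proj2_def tr_def tr_in_def tr_prop_def tr_rec_def funext_def propext_def
  diff_Suc_Suc diff_zero

text \<open>In unary form, so that the equations of \<open>nf\<close> for \<open>0\<close> and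
  \<open>Suc n\<close> rewrite directly.\<close>

abbreviation (input) "fuel \<equiv> Suc (Suc (Suc (Suc (Suc (Suc (Suc (Suc (Suc (Suc (Suc (Suc 0)))))))))))"

text \<open>Cheap rules come before general ones: syntactic equality and congruence before
  normalisation, introduction rules before the switch to inference. \<open>checks_whnf\<close> would
  apply to its own premise forever, so it is restricted to introduction forms against types whose
  head shows only after evaluation. In the proofs below, rules leave equations; evaluation must
  close them, and full simplification settles the rest, such as universe levels with
  \<open>max\<close>.\<close>

lemmas check_rules = lookup_0 lookup_Suc sameI whnf_refl whnf_nf[where n = fuel]
  conv.refl conv.Pi conv.Sig conv.Eq conv.Plus conv.Tr conv_by_nf[where n = fuel]
  checks_Lam checks_Lam_conv checks_MkPair checks_InL checks_InR checks_TrIn checks_Rfl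
  checks_FunExt checks_PropExt
  checks_whnf[where n = fuel and t = "Lam A b" and T = "App f a" for A b f a]
  checks_whnf[where n = fuel and t = "MkPair b c" and T = "App f a" for b c f a]
  checks_whnf[where n = fuel and t = "Lam A b" and T = "Split C c p" for A b C c p]
  checks_whnf[where n = fuel and t = "MkPair a b" and T = "Split C c p" for a b C c p]
  checks_if_infers
  infers_Var infers_App infers_Lam infers_Pi infers_Sig infers_Univ infers_Empty infers_Unit infers_Star
  infers_Plus infers_Eq
  infers_Tr infers_TrProp infers_TrRec infers_Abort infers_Split infers_Case infers_J

text \<open>
  Variables are lifted and substituted by simultaneous recursion on index and depth, where \<open>c\<close>
  counts the binders passed; this needs fewer rewrite steps than the comparisons in the definitions.
\<close>

fun lift_var :: "nat \<Rightarrow> nat \<Rightarrow> nat \<Rightarrow> nat \<Rightarrow> tm" where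
  "lift_var c d 0 n = Var (n + d + c)"
| "lift_var c d (Suc k) 0 = Var c"
| "lift_var c d (Suc k) (Suc n) = lift_var (Suc c) d k n"

fun subst_var :: "nat \<Rightarrow> tm \<Rightarrow> nat \<Rightarrow> nat \<Rightarrow> tm" where
  "subst_var 0 s 0 0 = s"
| "subst_var (Suc c) s 0 0 = wk (Suc c) s"
| "subst_var c s 0 (Suc n) = Var (n + c)"
| "subst_var c s (Suc k) 0 = Var c"
| "subst_var c s (Suc k) (Suc n) = subst_var (Suc c) s k n"

lemma lift_var_eq: "lift_var c d k n = Var (if n < k then n + c else n + d + c)"
  by (induction c d k n rule: lift_var.induct) auto

lemma subst_var_eq:
  "subst_var c s k n = (if n < k then Var (n + c) else if n = k then wk (k + c) s else Var (n - 1 + c))"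
  by (induction c s k n rule: subst_var.induct) (auto simp: lift_0)

lemma lift_Var: "lift d k (Var n) = lift_var 0 d k n"
  by (simp add: lift_var_eq)

lemma subst_Var: "subst k s (Var n) = subst_var 0 s k n"
  by (simp add: subst_var_eq)

lemmas eval_simps = lift_Var lift.simps(2-) subst_Var subst.simps(2-) lift_var.simps subst_var.simps
  nf.simps view_defs tm.case sum.case prod.case One_nat_def numeral_2_eq_2 add_Suc_right add_0_right

text \<open>The codomain of \<open>A \<rightarrow> B\<close> is \<open>B\<close> read at depth 1.
  The last premise says that \<open>B\<close> is a closed expression there, so that application
  returns \<open>B\<close> at depth 0; it is verified by evaluation at each use.\<close>

lemma inhabited_mp: "inhabited (A \<rightarrow> B) \<Longrightarrow> inhabited A \<Longrightarrow> B 1 = wk 1 (B 0) \<Longrightarrow> inhabited B"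
  unfolding inhabited_def arr_def pi_def
  using ctx_typing.App[of "[]" _ "A 0" "B 1"] by (metis One_nat_def subst_wk_1)

section \<open>Propositions, sets and equality of pairs\<close>

definition prop_is_set :: "nat \<Rightarrow> ex" where
  "prop_is_set i = pi (univ i) (\<lambda>A. is_prop A \<rightarrow> pi A (\<lambda>x. pi A (\<lambda>y. is_prop (eq A x y))))"

text \<open>The path \<open>K z\<close>, the inverse of \<open>h x x\<close> followed by
  \<open>h x z\<close>, is reflexivity at \<open>x\<close>. By path induction it equals every path
  from \<open>x\<close> to \<open>z\<close>, so any two such paths agree.\<close>

lemma inhabited_prop_is_set: "inhabited (prop_is_set i)"
  by (rule inhabitedI[where t = "lam (univ i) (\<lambda>A. lam (is_prop A) (\<lambda>h. lam A (\<lambda>x. lam A (\<lambda>y.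
      lam (eq A x y) (\<lambda>p. lam (eq A x y) (\<lambda>q.
        let K = (\<lambda>z. trans A x x z (sym A x x (h \<cdot> x \<cdot> x)) (h \<cdot> x \<cdot> z));
            L = (\<lambda>r. path_ind A x (\<lambda>z r. eq (eq A x z) (K z) r)
                   (path_ind A x (\<lambda>z r. eq (eq A z z) (trans A z x z (sym A x z r) r) (rfl z))
                     (rfl (rfl x)) x (h \<cdot> x \<cdot> x)) y r)
        in trans (eq A x y) p (K y) q (sym (eq A x y) (K y) p (L p)) (L q)))))))"],
    simp_all only: ex_defs prop_is_set_def Let_def,
    (rule check_rules | (simp only: eval_simps; fail) | simp add: view_defs)+)

definition prop_prop :: "nat \<Rightarrow> ex" where
  "prop_prop i = pi (univ i) (\<lambda>A. is_prop (is_prop A))"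

text \<open>Two proofs that \<open>A\<close> is a proposition are compared pointwise; their values
  are paths in \<open>A\<close>, which is a set by the first of these proofs.\<close>

lemma inhabited_prop_prop: "inhabited (prop_is_set i \<rightarrow> prop_prop i)"
  by (rule inhabitedI[where t = "lam (prop_is_set i) (\<lambda>S. lam (univ i) (\<lambda>A.
      lam (is_prop A) (\<lambda>h. lam (is_prop A) (\<lambda>k. funext h k (lam A (\<lambda>x.
        funext (h \<cdot> x) (k \<cdot> x) (lam A (\<lambda>y. S \<cdot> A \<cdot> h \<cdot> x \<cdot> y \<cdot> (h \<cdot> x \<cdot> y) \<cdot> (k \<cdot> x \<cdot> y)))))))))"],
    simp_all only: ex_defs prop_is_set_def prop_prop_def Let_def,
    (rule check_rules | (simp only: eval_simps; fail) | simp add: view_defs)+)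

definition prop_arr :: "nat \<Rightarrow> nat \<Rightarrow> ex" where
  "prop_arr i j = pi (univ i) (\<lambda>A. pi (univ j) (\<lambda>B. is_prop B \<rightarrow> is_prop (A \<rightarrow> B)))"

lemma inhabited_prop_arr: "inhabited (prop_arr i j)"
  by (rule inhabitedI[where t = "lam (univ i) (\<lambda>A. lam (univ j) (\<lambda>B. lam (is_prop B) (\<lambda>h.
      lam (A \<rightarrow> B) (\<lambda>f. lam (A \<rightarrow> B) (\<lambda>g. funext f g (lam A (\<lambda>x. h \<cdot> (f \<cdot> x) \<cdot> (g \<cdot> x))))))))"],
    simp_all only: ex_defs prop_arr_def Let_def,
    (rule check_rules | (simp only: eval_simps; fail) | simp add: view_defs)+)

text \<open>The second factor is a proposition under the assumption of the first. Stability has this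
  form: \<open>neg (neg P) \<rightarrow> P\<close> is a proposition because \<open>P\<close>
  is.\<close>

definition prop_both :: "nat \<Rightarrow> nat \<Rightarrow> ex" where
  "prop_both i j = pi (univ i) (\<lambda>A. pi (univ j) (\<lambda>B.
      is_prop A \<rightarrow> (A \<rightarrow> is_prop B) \<rightarrow> is_prop (A \<otimes> B)))"

lemma inhabited_prop_both: "inhabited (prop_both i j)"
  by (rule inhabitedI[where t = "lam (univ i) (\<lambda>A. lam (univ j) (\<lambda>B.
      lam (is_prop A) (\<lambda>h. lam (A \<rightarrow> is_prop B) (\<lambda>k. lam (A \<otimes> B) (\<lambda>p. lam (A \<otimes> B) (\<lambda>q.
        let_pair A (\<lambda>_. B) (\<lambda>p. eq (A \<otimes> B) p q) (\<lambda>a b.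
          let_pair A (\<lambda>_. B) (\<lambda>q. eq (A \<otimes> B) (pair a b) q) (\<lambda>a' b'.
            path_ind A a (\<lambda>x _. eq (A \<otimes> B) (pair a b) (pair x b'))
              (path_ind B b (\<lambda>y _. eq (A \<otimes> B) (pair a b) (pair a y))
                (rfl (pair a b)) b' (k \<cdot> a \<cdot> b \<cdot> b')) a' (h \<cdot> a \<cdot> a')) q) p))))))"],
    simp_all only: ex_defs prop_both_def Let_def,
    (rule check_rules | (simp only: eval_simps; fail) | simp add: view_defs)+)

definition sig_eq :: "nat \<Rightarrow> nat \<Rightarrow> ex" where
  "sig_eq i j = pi (univ i) (\<lambda>A. pi (A \<rightarrow> univ j) (\<lambda>B. pi A (\<lambda>x. is_prop (B \<cdot> x)) \<rightarrow>
      pi A (\<lambda>a. pi A (\<lambda>b. pi (B \<cdot> a) (\<lambda>u. pi (B \<cdot> b) (\<lambda>u'.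
        eq A a b \<rightarrow> eq (sig A (\<lambda>x. B \<cdot> x)) (pair a u) (pair b u')))))))"

text \<open>The second component over \<open>b\<close> is generalised before the path induction; at
  reflexivity both components lie in one fibre, where \<open>h\<close> identifies them.\<close>

lemma inhabited_sig_eq: "inhabited (sig_eq i j)"
  by (rule inhabitedI[where t = "lam (univ i) (\<lambda>A. lam (A \<rightarrow> univ j) (\<lambda>B.
      lam (pi A (\<lambda>x. is_prop (B \<cdot> x))) (\<lambda>h. lam A (\<lambda>a. lam A (\<lambda>b.
      lam (B \<cdot> a) (\<lambda>u. lam (B \<cdot> b) (\<lambda>u'. lam (eq A a b) (\<lambda>p.
        let S = sig A (\<lambda>x. B \<cdot> x) in
        path_ind A a (\<lambda>y _. pi (B \<cdot> y) (\<lambda>w. eq S (pair a u) (pair y w)))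
          (lam (B \<cdot> a) (\<lambda>w. path_ind (B \<cdot> a) u (\<lambda>w _. eq S (pair a u) (pair a w))
            (rfl (pair a u)) w (h \<cdot> a \<cdot> u \<cdot> w))) b p \<cdot> u'))))))))"],
    simp_all only: ex_defs sig_eq_def Let_def,
    (rule check_rules | (simp only: eval_simps; fail) | simp add: view_defs)+)

section \<open>Types of propositions and their extensionality\<close>

definition Om :: "nat \<Rightarrow> (ex \<Rightarrow> ex) \<Rightarrow> ex" where
  "Om v B = sig (univ v) B"

definition prop_of :: "nat \<Rightarrow> (ex \<Rightarrow> ex) \<Rightarrow> ex \<Rightarrow> ex" where
  "prop_of v B p = proj1 (univ v) B p"

text \<open>For \<open>Om\<close> ordered by implication this is also antisymmetry, and it is used
  as such.\<close>

definition Om_ext :: "nat \<Rightarrow> (ex \<Rightarrow> ex) \<Rightarrow> ex" where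
  "Om_ext v B = pi (Om v B) (\<lambda>p. pi (Om v B) (\<lambda>q.
     (prop_of v B p \<rightarrow> prop_of v B q) \<rightarrow> (prop_of v B q \<rightarrow> prop_of v B p) \<rightarrow> eq (Om v B) p q))"

lemmas Om_defs = Om_def prop_of_def Om_ext_def

text \<open>Here \<open>B\<close> is a variable of the object theory, so the derivation is checked
  once and then applied to the predicates \<open>stable\<close> and \<open>is_prop\<close>.\<close>

definition Om_ext_gen :: "nat \<Rightarrow> ex" where
  "Om_ext_gen v = pi (univ v \<rightarrow> univ v) (\<lambda>B. pi (univ v) (\<lambda>P. is_prop (B \<cdot> P)) \<rightarrow>
     pi (univ v) (\<lambda>P. B \<cdot> P \<rightarrow> is_prop P) \<rightarrow> Om_ext v (\<lambda>P. B \<cdot> P))"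

lemma inhabited_Om_ext_gen: "inhabited (sig_eq (Suc v) v \<rightarrow> Om_ext_gen v)"
  by (rule inhabitedI[where t = "lam (sig_eq (Suc v) v) (\<lambda>se. lam (univ v \<rightarrow> univ v) (\<lambda>B.
      lam (pi (univ v) (\<lambda>P. is_prop (B \<cdot> P))) (\<lambda>bp.
      lam (pi (univ v) (\<lambda>P. B \<cdot> P \<rightarrow> is_prop P)) (\<lambda>pr.
        let Z = Om v (\<lambda>P. B \<cdot> P); f = prop_of v (\<lambda>P. B \<cdot> P) in
        lam Z (\<lambda>p. let_pair (univ v) (\<lambda>P. B \<cdot> P)
          (\<lambda>p. pi Z (\<lambda>q. (f p \<rightarrow> f q) \<rightarrow> (f q \<rightarrow> f p) \<rightarrow> eq Z p q))
          (\<lambda>P b. lam Z (\<lambda>q. let_pair (univ v) (\<lambda>P. B \<cdot> P)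
            (\<lambda>q. (P \<rightarrow> f q) \<rightarrow> (f q \<rightarrow> P) \<rightarrow> eq Z (pair P b) q)
            (\<lambda>Q c. lam (P \<rightarrow> Q) (\<lambda>u. lam (Q \<rightarrow> P) (\<lambda>w.
              se \<cdot> univ v \<cdot> B \<cdot> bp \<cdot> P \<cdot> Q \<cdot> b \<cdot> c \<cdot> propext (pr \<cdot> P \<cdot> b) (pr \<cdot> Q \<cdot> c) u w))) q)) p)))))"],
    simp_all only: ex_defs sig_eq_def Om_ext_gen_def Om_defs Let_def,
    (rule check_rules | (simp only: eval_simps; fail) | simp add: view_defs)+)

section \<open>Universal property of the suprema of \<open>delta\<close>\<close>

definition delta_ub :: "nat \<Rightarrow> nat \<Rightarrow> nat \<Rightarrow> ex" where
  "delta_ub v w t = pi (univ w) (\<lambda>X. pi (X \<rightarrow> X \<rightarrow> univ t) (\<lambda>R. pi (delta_complete v X R) (\<lambda>c.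
     pi X (\<lambda>x. pi X (\<lambda>y. pi (R \<cdot> x \<cdot> y) (\<lambda>le. pi (univ v) (\<lambda>P. pi (is_prop P) (\<lambda>h.
       P \<rightarrow> R \<cdot> y \<cdot> delta_sup X R c x y le P h))))))))"

definition delta_least :: "nat \<Rightarrow> nat \<Rightarrow> nat \<Rightarrow> ex" where
  "delta_least v w t = pi (univ w) (\<lambda>X. pi (X \<rightarrow> X \<rightarrow> univ t) (\<lambda>R. pi (delta_complete v X R) (\<lambda>c.
     pi X (\<lambda>x. pi X (\<lambda>y. pi (R \<cdot> x \<cdot> y) (\<lambda>le. pi (univ v) (\<lambda>P. pi (is_prop P) (\<lambda>h.
       pi X (\<lambda>u. R \<cdot> x \<cdot> u \<rightarrow> (P \<rightarrow> R \<cdot> y \<cdot> u) \<rightarrow> R \<cdot> delta_sup X R c x y le P h \<cdot> u)))))))))"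

lemma inhabited_delta_ub: "inhabited (delta_ub v w t)"
  by (rule inhabitedI[where t = "lam (univ w) (\<lambda>X. lam (X \<rightarrow> X \<rightarrow> univ t) (\<lambda>R.
     lam (delta_complete v X R) (\<lambda>c. lam X (\<lambda>x. lam X (\<lambda>y. lam (R \<cdot> x \<cdot> y) (\<lambda>le.
     lam (univ v) (\<lambda>P. lam (is_prop P) (\<lambda>h. lam P (\<lambda>p.
       let I = plus unit P; d = delta X x y P; s = delta_sup X R c x y le P h in
       let_pair (pi I (\<lambda>i. R \<cdot> (d \<cdot> i) \<cdot> s)) (\<lambda>_. pi X (\<lambda>u. pi I (\<lambda>i. R \<cdot> (d \<cdot> i) \<cdot> u) \<rightarrow> R \<cdot> s \<cdot> u))
         (\<lambda>_. R \<cdot> y \<cdot> s) (\<lambda>ub _. ub \<cdot> inr p)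
         (proj2 X (\<lambda>s. is_delta_sup X R x y P s) (c \<cdot> x \<cdot> y \<cdot> le \<cdot> P \<cdot> h)))))))))))"],
    simp_all only: ex_defs delta_ub_def Let_def,
    (rule check_rules | (simp only: eval_simps; fail) | simp add: view_defs)+)

text \<open>The family computes to x on \<open>inl\<close> and to y on \<open>inr\<close>, so a case
  distinction turns the two implications into an upper bound in the sense of
  \<open>is_sup\<close>.\<close>

lemma inhabited_delta_least: "inhabited (delta_least v w t)"
  by (rule inhabitedI[where t = "lam (univ w) (\<lambda>X. lam (X \<rightarrow> X \<rightarrow> univ t) (\<lambda>R.
     lam (delta_complete v X R) (\<lambda>c. lam X (\<lambda>x. lam X (\<lambda>y. lam (R \<cdot> x \<cdot> y) (\<lambda>le.
     lam (univ v) (\<lambda>P. lam (is_prop P) (\<lambda>h. lam X (\<lambda>u. lam (R \<cdot> x \<cdot> u) (\<lambda>a. lam (P \<rightarrow> R \<cdot> y \<cdot> u) (\<lambda>b.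
       let I = plus unit P; d = delta X x y P; s = delta_sup X R c x y le P h in
       let_pair (pi I (\<lambda>i. R \<cdot> (d \<cdot> i) \<cdot> s)) (\<lambda>_. pi X (\<lambda>u. pi I (\<lambda>i. R \<cdot> (d \<cdot> i) \<cdot> u) \<rightarrow> R \<cdot> s \<cdot> u))
         (\<lambda>_. R \<cdot> s \<cdot> u)
         (\<lambda>_ least. least \<cdot> u \<cdot> lam I (\<lambda>i. case_sum unit P (\<lambda>i. R \<cdot> (d \<cdot> i) \<cdot> u) (\<lambda>_. a) (\<lambda>p. b \<cdot> p) i))
         (proj2 X (\<lambda>s. is_delta_sup X R x y P s) (c \<cdot> x \<cdot> y \<cdot> le \<cdot> P \<cdot> h)))))))))))))"],
    simp_all only: ex_defs delta_least_def Let_def,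
    (rule check_rules | (simp only: eval_simps; fail) | simp add: view_defs)+)

section \<open>Equivalences and small retracts\<close>

definition equiv_to :: "nat \<Rightarrow> nat \<Rightarrow> ex" where
  "equiv_to i j = pi (univ i) (\<lambda>A. pi (univ j) (\<lambda>B. equiv A B \<rightarrow> A \<rightarrow> B))"

definition equiv_from :: "nat \<Rightarrow> nat \<Rightarrow> ex" where
  "equiv_from i j = pi (univ i) (\<lambda>A. pi (univ j) (\<lambda>B. equiv A B \<rightarrow> B \<rightarrow> A))"

definition equiv_rinv :: "ex \<Rightarrow> ex \<Rightarrow> ex \<Rightarrow> ex" where
  "equiv_rinv A B f = sig (B \<rightarrow> A) (\<lambda>g. pi B (\<lambda>b. eq B (f \<cdot> (g \<cdot> b)) b))"

definition equiv_linv :: "ex \<Rightarrow> ex \<Rightarrow> ex \<Rightarrow> ex" where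
  "equiv_linv A B f = sig (B \<rightarrow> A) (\<lambda>h. pi A (\<lambda>a. eq A (h \<cdot> (f \<cdot> a)) a))"

lemma inhabited_equiv_to: "inhabited (equiv_to i j)"
  by (rule inhabitedI[where t = "lam (univ i) (\<lambda>A. lam (univ j) (\<lambda>B. lam (equiv A B) (\<lambda>e.
     let_pair (A \<rightarrow> B) (\<lambda>f. equiv_rinv A B f \<otimes> equiv_linv A B f) (\<lambda>_. A \<rightarrow> B) (\<lambda>f _. f) e)))"],
    simp_all only: ex_defs equiv_to_def equiv_rinv_def equiv_linv_def Let_def,
    (rule check_rules | (simp only: eval_simps; fail) | simp add: view_defs)+)

lemma inhabited_equiv_from: "inhabited (equiv_from i j)"
  by (rule inhabitedI[where t = "lam (univ i) (\<lambda>A. lam (univ j) (\<lambda>B. lam (equiv A B) (\<lambda>e.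
     let_pair (A \<rightarrow> B) (\<lambda>f. equiv_rinv A B f \<otimes> equiv_linv A B f) (\<lambda>_. B \<rightarrow> A)
       (\<lambda>f q. let_pair (equiv_rinv A B f) (\<lambda>_. equiv_linv A B f) (\<lambda>_. B \<rightarrow> A)
         (\<lambda>r _. let_pair (B \<rightarrow> A) (\<lambda>g. pi B (\<lambda>b. eq B (f \<cdot> (g \<cdot> b)) b)) (\<lambda>_. B \<rightarrow> A) (\<lambda>g _. g) r) q) e)))"],
    simp_all only: ex_defs equiv_from_def equiv_rinv_def equiv_linv_def Let_def,
    (rule check_rules | (simp only: eval_simps; fail) | simp add: view_defs)+)

text \<open>
  A retract \<open>Z\<close> of \<open>X\<close>, with section \<open>s\<close> and retraction \<open>r\<close>, consists of the \<open>x\<close> with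
  \<open>s (r x) = x\<close>.  This equation is replaced by \<open>S\<close> in both directions, which is small, and truncated,
  so that no proof that \<open>X\<close> is a set is needed.
\<close>

definition both_le :: "ex \<Rightarrow> ex \<Rightarrow> ex \<Rightarrow> ex" where
  "both_le S a b = S \<cdot> a \<cdot> b \<otimes> S \<cdot> b \<cdot> a"

definition retract_core :: "nat \<Rightarrow> nat \<Rightarrow> nat \<Rightarrow> nat \<Rightarrow> ex" where
  "retract_core v w t z =
    pi (univ w) (\<lambda>X. pi (X \<rightarrow> X \<rightarrow> univ t) (\<lambda>R.
    prop_valued X R \<rightarrow> antisymmetric X R \<rightarrow>
    pi (X \<rightarrow> X \<rightarrow> univ v) (\<lambda>S.
    pi X (\<lambda>x. pi X (\<lambda>y. S \<cdot> x \<cdot> y \<rightarrow> R \<cdot> x \<cdot> y)) \<rightarrow>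
    pi (univ v) (\<lambda>Y. pi (Y \<rightarrow> X) (\<lambda>f. pi (X \<rightarrow> Y) (\<lambda>g.
    pi X (\<lambda>x. eq X (f \<cdot> (g \<cdot> x)) x) \<rightarrow> pi Y (\<lambda>y. eq Y (g \<cdot> (f \<cdot> y)) y) \<rightarrow>
    pi (univ z) (\<lambda>Z. pi (Z \<rightarrow> X) (\<lambda>s. pi (X \<rightarrow> Z) (\<lambda>r.
    pi Z (\<lambda>q. eq Z (r \<cdot> (s \<cdot> q)) q) \<rightarrow>
    pi Z (\<lambda>q. let x = f \<cdot> (g \<cdot> (s \<cdot> q)) in both_le S (s \<cdot> (r \<cdot> x)) x) \<rightarrow> small v Z)))))))))"

definition retract :: "nat \<Rightarrow> nat \<Rightarrow> nat \<Rightarrow> nat \<Rightarrow> ex" where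
  "retract v w t z =
    pi (univ w) (\<lambda>X. pi (X \<rightarrow> X \<rightarrow> univ t) (\<lambda>R.
    prop_valued X R \<rightarrow> reflexive X R \<rightarrow> antisymmetric X R \<rightarrow>
    pi (X \<rightarrow> X \<rightarrow> univ v) (\<lambda>S. pi X (\<lambda>x. pi X (\<lambda>y. equiv (R \<cdot> x \<cdot> y) (S \<cdot> x \<cdot> y))) \<rightarrow>
    small v X \<rightarrow>
    pi (univ z) (\<lambda>Z. pi (Z \<rightarrow> X) (\<lambda>s. pi (X \<rightarrow> Z) (\<lambda>r.
    pi Z (\<lambda>q. eq Z (r \<cdot> (s \<cdot> q)) q) \<rightarrow> small v Z))))))"

text \<open>\<open>Y'\<close> is the set of fixed points transported to the small copy
  \<open>Y\<close>. One composite is the identity by \<open>rs\<close> after cancelling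
  \<open>f\<close> and \<open>g\<close>. For the other, the truncated pair is eliminated into the
  order, a proposition; antisymmetry yields the fixed point equation, and \<open>sig_eq\<close>
  lifts it to \<open>Y'\<close> because the truncation is a proposition.\<close>

lemma inhabited_retract_core: "inhabited (sig_eq v v \<rightarrow> retract_core v w t z)"
  by (rule inhabitedI[where t = "lam (sig_eq v v) (\<lambda>se.
    lam (univ w) (\<lambda>X. lam (X \<rightarrow> X \<rightarrow> univ t) (\<lambda>R.
    lam (prop_valued X R) (\<lambda>pv. lam (antisymmetric X R) (\<lambda>as.
    lam (X \<rightarrow> X \<rightarrow> univ v) (\<lambda>S.
    lam (pi X (\<lambda>x. pi X (\<lambda>y. S \<cdot> x \<cdot> y \<rightarrow> R \<cdot> x \<cdot> y))) (\<lambda>fr.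
    lam (univ v) (\<lambda>Y. lam (Y \<rightarrow> X) (\<lambda>f. lam (X \<rightarrow> Y) (\<lambda>g.
    lam (pi X (\<lambda>x. eq X (f \<cdot> (g \<cdot> x)) x)) (\<lambda>fg. lam (pi Y (\<lambda>y. eq Y (g \<cdot> (f \<cdot> y)) y)) (\<lambda>gf.
    lam (univ z) (\<lambda>Z. lam (Z \<rightarrow> X) (\<lambda>s. lam (X \<rightarrow> Z) (\<lambda>r.
    lam (pi Z (\<lambda>q. eq Z (r \<cdot> (s \<cdot> q)) q)) (\<lambda>rs.
    lam (pi Z (\<lambda>q. let x = f \<cdot> (g \<cdot> (s \<cdot> q)) in both_le S (s \<cdot> (r \<cdot> x)) x)) (\<lambda>E.
      let W = (\<lambda>y. tr (both_le S (s \<cdot> (r \<cdot> (f \<cdot> y))) (f \<cdot> y)));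
          Y' = sig Y W;
          F = lam Y' (\<lambda>q. let_pair Y W (\<lambda>_. Z) (\<lambda>y _. r \<cdot> (f \<cdot> y)) q);
          G = (\<lambda>q. pair (g \<cdot> (s \<cdot> q)) (tr_in (E \<cdot> q)));
          FG = lam Z (\<lambda>q. let x = s \<cdot> q in path_ind X x (\<lambda>x _. eq Z (r \<cdot> x) q) (rs \<cdot> q)
                 (f \<cdot> (g \<cdot> x)) (sym X (f \<cdot> (g \<cdot> x)) x (fg \<cdot> x)));
          le_of = (\<lambda>a b m. tr_rec (R \<cdot> a \<cdot> b) (pv \<cdot> a \<cdot> b)
                 (lam (both_le S a b) (\<lambda>q. fr \<cdot> a \<cdot> b \<cdot> proj1 (S \<cdot> a \<cdot> b) (\<lambda>_. S \<cdot> b \<cdot> a) q)) m);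
          ge_of = (\<lambda>a b m. tr_rec (R \<cdot> b \<cdot> a) (pv \<cdot> b \<cdot> a)
                 (lam (both_le S a b) (\<lambda>q. fr \<cdot> b \<cdot> a \<cdot> proj2 (S \<cdot> a \<cdot> b) (\<lambda>_. S \<cdot> b \<cdot> a) q)) m);
          e = (\<lambda>y m. let a = s \<cdot> (r \<cdot> (f \<cdot> y)) in
                 path_ind X (f \<cdot> y) (\<lambda>x _. eq Y (g \<cdot> x) y) (gf \<cdot> y) a
                   (sym X a (f \<cdot> y) (as \<cdot> a \<cdot> (f \<cdot> y) \<cdot> le_of a (f \<cdot> y) m \<cdot> ge_of a (f \<cdot> y) m)));
          GF = lam Y' (\<lambda>q. let_pair Y W (\<lambda>q. eq Y' (G (F \<cdot> q)) q)
                 (\<lambda>y m. se \<cdot> Y \<cdot> lam Y W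
                   \<cdot> lam Y (\<lambda>y. lam (W y) (\<lambda>a. lam (W y) (\<lambda>b. tr_prop a b)))
                   \<cdot> (g \<cdot> (s \<cdot> (r \<cdot> (f \<cdot> y)))) \<cdot> y \<cdot> tr_in (E \<cdot> (r \<cdot> (f \<cdot> y))) \<cdot> m \<cdot> e y m) q)
      in pair Y' (pair F (pair (pair (lam Z G) FG) (pair (lam Z G) GF))))))))))))))))))))"],
    simp_all only: ex_defs sig_eq_def retract_core_def both_le_def Let_def,
    (rule check_rules | (simp only: eval_simps; fail) | simp add: view_defs)+)

text \<open>An equivalence carries separate inverses: g on the right, h on the left. The equations g
  (f y) = h (f (g (f y))) = h (f y) = y make g two-sided. The assumption \<open>E\<close> of the
  core is reflexivity transported along \<open>rs\<close> and along f (g x) = x.\<close>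

lemma inhabited_retract:
  "inhabited (retract_core v w t z \<rightarrow> equiv_to t v \<rightarrow> equiv_from t v \<rightarrow> retract v w t z)"
  by (rule inhabitedI[where t = "lam (retract_core v w t z) (\<lambda>core.
    lam (equiv_to t v) (\<lambda>et. lam (equiv_from t v) (\<lambda>ef.
    lam (univ w) (\<lambda>X. lam (X \<rightarrow> X \<rightarrow> univ t) (\<lambda>R.
    lam (prop_valued X R) (\<lambda>pv. lam (reflexive X R) (\<lambda>rf. lam (antisymmetric X R) (\<lambda>as.
    lam (X \<rightarrow> X \<rightarrow> univ v) (\<lambda>S.
    lam (pi X (\<lambda>x. pi X (\<lambda>y. equiv (R \<cdot> x \<cdot> y) (S \<cdot> x \<cdot> y)))) (\<lambda>e. lam (small v X) (\<lambda>sm.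
    lam (univ z) (\<lambda>Z. lam (Z \<rightarrow> X) (\<lambda>s. lam (X \<rightarrow> Z) (\<lambda>r.
    lam (pi Z (\<lambda>q. eq Z (r \<cdot> (s \<cdot> q)) q)) (\<lambda>rs.
      let_pair (univ v) (\<lambda>Y. equiv Y X) (\<lambda>_. small v Z) (\<lambda>Y e'.
      let_pair (Y \<rightarrow> X) (\<lambda>f. equiv_rinv Y X f \<otimes> equiv_linv Y X f) (\<lambda>_. small v Z) (\<lambda>f e'.
      let_pair (equiv_rinv Y X f) (\<lambda>_. equiv_linv Y X f) (\<lambda>_. small v Z) (\<lambda>ri li.
      let_pair (X \<rightarrow> Y) (\<lambda>g. pi X (\<lambda>x. eq X (f \<cdot> (g \<cdot> x)) x)) (\<lambda>_. small v Z) (\<lambda>g fg.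
      let_pair (X \<rightarrow> Y) (\<lambda>h. pi Y (\<lambda>y. eq Y (h \<cdot> (f \<cdot> y)) y)) (\<lambda>_. small v Z) (\<lambda>h hf.
      let le = (\<lambda>a. et \<cdot> (R \<cdot> a \<cdot> a) \<cdot> (S \<cdot> a \<cdot> a) \<cdot> (e \<cdot> a \<cdot> a) \<cdot> (rf \<cdot> a));
          back = (\<lambda>x. sym X (f \<cdot> (g \<cdot> x)) x (fg \<cdot> x));
          E0 = (\<lambda>q. path_ind Z q (\<lambda>q' _. both_le S (s \<cdot> q') (s \<cdot> q)) (pair (le (s \<cdot> q)) (le (s \<cdot> q)))
                 (r \<cdot> (s \<cdot> q)) (sym Z (r \<cdot> (s \<cdot> q)) q (rs \<cdot> q)));
          E = (\<lambda>q. path_ind X (s \<cdot> q) (\<lambda>x _. both_le S (s \<cdot> (r \<cdot> x)) x) (E0 q)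
                 (f \<cdot> (g \<cdot> (s \<cdot> q))) (back (s \<cdot> q)));
          gf = (\<lambda>y. trans Y (g \<cdot> (f \<cdot> y)) (h \<cdot> (f \<cdot> (g \<cdot> (f \<cdot> y)))) y
                 (sym Y (h \<cdot> (f \<cdot> (g \<cdot> (f \<cdot> y)))) (g \<cdot> (f \<cdot> y)) (hf \<cdot> (g \<cdot> (f \<cdot> y))))
                 (path_ind X (f \<cdot> y) (\<lambda>x _. eq Y (h \<cdot> x) y) (hf \<cdot> y) (f \<cdot> (g \<cdot> (f \<cdot> y))) (back (f \<cdot> y))))
      in core \<cdot> X \<cdot> R \<cdot> pv \<cdot> as \<cdot> S
           \<cdot> lam X (\<lambda>x. lam X (\<lambda>y. ef \<cdot> (R \<cdot> x \<cdot> y) \<cdot> (S \<cdot> x \<cdot> y) \<cdot> (e \<cdot> x \<cdot> y)))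
           \<cdot> Y \<cdot> f \<cdot> g \<cdot> fg \<cdot> lam Y gf \<cdot> Z \<cdot> s \<cdot> r \<cdot> rs \<cdot> lam Z E)
      li) ri) e') e') sm)))))))))))))))"],
    simp_all only: ex_defs retract_core_def retract_def both_le_def
    equiv_to_def equiv_from_def equiv_rinv_def equiv_linv_def Let_def,
    (rule check_rules | (simp only: eval_simps; fail) | simp add: view_defs)+)

section \<open>From posets to smallness\<close>

definition stable :: "ex \<Rightarrow> ex" where
  "stable P = is_prop P \<otimes> (neg (neg P) \<rightarrow> P)"

abbreviation stable_prop :: "ex \<Rightarrow> ex \<Rightarrow> ex" where
  "stable_prop P b \<equiv> proj1 (is_prop P) (\<lambda>_. neg (neg P) \<rightarrow> P) b"

abbreviation stable_dne :: "ex \<Rightarrow> ex \<Rightarrow> ex" where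
  "stable_dne P b \<equiv> proj2 (is_prop P) (\<lambda>_. neg (neg P) \<rightarrow> P) b"

text \<open>Stability is itself a proposition, by \<open>prop_both\<close> with the second factor
  handled by \<open>prop_arr\<close>.\<close>

lemma inhabited_Om_ext_stable:
  "inhabited (Om_ext_gen v \<rightarrow> prop_prop v \<rightarrow> prop_arr v v \<rightarrow> prop_both v v \<rightarrow> Om_ext v stable)"
  by (rule inhabitedI[where t = "lam (Om_ext_gen v) (\<lambda>oe. lam (prop_prop v) (\<lambda>pp.
    lam (prop_arr v v) (\<lambda>pa. lam (prop_both v v) (\<lambda>pb.
      oe \<cdot> lam (univ v) stable
        \<cdot> lam (univ v) (\<lambda>P. pb \<cdot> is_prop P \<cdot> (neg (neg P) \<rightarrow> P) \<cdot> (pp \<cdot> P)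
            \<cdot> lam (is_prop P) (\<lambda>h. pa \<cdot> neg (neg P) \<cdot> P \<cdot> h))
        \<cdot> lam (univ v) (\<lambda>P. lam (stable P) (\<lambda>b. stable_prop P b))))))"],
    simp_all only: ex_defs Om_ext_gen_def Om_defs prop_prop_def prop_arr_def prop_both_def
    stable_def Let_def,
    (rule check_rules | (simp only: eval_simps; fail) | simp add: view_defs)+)

lemma inhabited_Om_ext_is_prop:
  "inhabited (Om_ext_gen v \<rightarrow> prop_prop v \<rightarrow> Om_ext v is_prop)"
  by (rule inhabitedI[where t = "lam (Om_ext_gen v) (\<lambda>oe. lam (prop_prop v) (\<lambda>pp.
      oe \<cdot> lam (univ v) is_prop \<cdot> lam (univ v) (\<lambda>P. pp \<cdot> P)
        \<cdot> lam (univ v) (\<lambda>P. lam (is_prop P) (\<lambda>b. b))))"],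
    simp_all only: ex_defs Om_ext_gen_def Om_defs prop_prop_def Let_def,
    (rule check_rules | (simp only: eval_simps; fail) | simp add: view_defs)+)

section \<open>Posets that retract onto types of propositions\<close>

definition poset_to :: "nat \<Rightarrow> nat \<Rightarrow> nat \<Rightarrow> (ex \<Rightarrow> ex \<Rightarrow> ex \<Rightarrow> ex \<Rightarrow> ex) \<Rightarrow> ex \<Rightarrow> ex" where
  "poset_to v w t E C =
    pi (univ w) (\<lambda>X. pi (X \<rightarrow> X \<rightarrow> univ t) (\<lambda>R. prop_valued X R \<rightarrow> reflexive X R \<rightarrow>
      pi (transitive X R) (\<lambda>tr. antisymmetric X R \<rightarrow>
        pi (X \<rightarrow> X \<rightarrow> univ v) (\<lambda>S. pi X (\<lambda>x. pi X (\<lambda>y. equiv (R \<cdot> x \<cdot> y) (S \<cdot> x \<cdot> y))) \<rightarrow> small v X \<rightarrow>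
          pi (delta_complete v X R) (\<lambda>c. E X R tr c \<rightarrow> C)))))"

text \<open>The retraction identity is required only as two implications; \<open>Om_ext\<close>
  turns them into an equality. \<open>s\<close> and \<open>r\<close> are given in curried form so
  that the cores below never handle pairs of a proposition and its witness.\<close>

definition Om_small :: "nat \<Rightarrow> nat \<Rightarrow> nat \<Rightarrow> (ex \<Rightarrow> ex) \<Rightarrow> ex" where
  "Om_small v w t B =
    pi (univ w) (\<lambda>X. pi (X \<rightarrow> X \<rightarrow> univ t) (\<lambda>R. prop_valued X R \<rightarrow> reflexive X R \<rightarrow> antisymmetric X R \<rightarrow>
    pi (X \<rightarrow> X \<rightarrow> univ v) (\<lambda>S. pi X (\<lambda>x. pi X (\<lambda>y. equiv (R \<cdot> x \<cdot> y) (S \<cdot> x \<cdot> y))) \<rightarrow> small v X \<rightarrow>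
    pi (pi (univ v) (\<lambda>P. B P \<rightarrow> X)) (\<lambda>s. pi (X \<rightarrow> univ v) (\<lambda>r. pi X (\<lambda>x. B (r \<cdot> x)) \<rightarrow>
    pi (univ v) (\<lambda>P. pi (B P) (\<lambda>b. r \<cdot> (s \<cdot> P \<cdot> b) \<rightarrow> P)) \<rightarrow>
    pi (univ v) (\<lambda>P. pi (B P) (\<lambda>b. P \<rightarrow> r \<cdot> (s \<cdot> P \<cdot> b))) \<rightarrow> small v (Om v B))))))"

definition Om_small_term :: "nat \<Rightarrow> nat \<Rightarrow> nat \<Rightarrow> (ex \<Rightarrow> ex) \<Rightarrow> ex" where
  "Om_small_term v w t B =
    lam (retract v w t (Suc v)) (\<lambda>ret. lam (Om_ext v B) (\<lambda>oe.
    lam (univ w) (\<lambda>X. lam (X \<rightarrow> X \<rightarrow> univ t) (\<lambda>R.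
    lam (prop_valued X R) (\<lambda>pv. lam (reflexive X R) (\<lambda>rf. lam (antisymmetric X R) (\<lambda>as.
    lam (X \<rightarrow> X \<rightarrow> univ v) (\<lambda>S.
    lam (pi X (\<lambda>x. pi X (\<lambda>y. equiv (R \<cdot> x \<cdot> y) (S \<cdot> x \<cdot> y)))) (\<lambda>e. lam (small v X) (\<lambda>sm.
    lam (pi (univ v) (\<lambda>P. B P \<rightarrow> X)) (\<lambda>s. lam (X \<rightarrow> univ v) (\<lambda>r. lam (pi X (\<lambda>x. B (r \<cdot> x))) (\<lambda>h.
    lam (pi (univ v) (\<lambda>P. pi (B P) (\<lambda>b. r \<cdot> (s \<cdot> P \<cdot> b) \<rightarrow> P))) (\<lambda>d.
    lam (pi (univ v) (\<lambda>P. pi (B P) (\<lambda>b. P \<rightarrow> r \<cdot> (s \<cdot> P \<cdot> b)))) (\<lambda>d'.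
      let Z = Om v B;
          s' = (\<lambda>q. let_pair (univ v) B (\<lambda>_. X) (\<lambda>P b. s \<cdot> P \<cdot> b) q);
          r' = (\<lambda>z. pair (r \<cdot> z) (h \<cdot> z))
      in ret \<cdot> X \<cdot> R \<cdot> pv \<cdot> rf \<cdot> as \<cdot> S \<cdot> e \<cdot> sm \<cdot> Z \<cdot> lam Z s' \<cdot> lam X r' \<cdot>
         lam Z (\<lambda>q. let_pair (univ v) B (\<lambda>q. eq Z (r' (s' q)) q)
           (\<lambda>P b. oe \<cdot> r' (s \<cdot> P \<cdot> b) \<cdot> pair P b \<cdot> (d \<cdot> P \<cdot> b) \<cdot> (d' \<cdot> P \<cdot> b)) q))))))))))))))))"

lemma inhabited_Om_small_stable:
  "inhabited (retract v w t (Suc v) \<rightarrow> Om_ext v stable \<rightarrow> Om_small v w t stable)"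
  by (rule inhabitedI[where t = "Om_small_term v w t stable"],
    simp_all only: ex_defs retract_def Om_defs Om_small_def Om_small_term_def stable_def Let_def,
    (rule check_rules | (simp only: eval_simps; fail) | simp add: view_defs)+)

lemma inhabited_Om_small_is_prop:
  "inhabited (retract v w t (Suc v) \<rightarrow> Om_ext v is_prop \<rightarrow> Om_small v w t is_prop)"
  by (rule inhabitedI[where t = "Om_small_term v w t is_prop"],
    simp_all only: ex_defs retract_def Om_defs Om_small_def Om_small_term_def Let_def,
    (rule check_rules | (simp only: eval_simps; fail) | simp add: view_defs)+)

text \<open>A negation is stable, so \<open>neg (S z x)\<close> is a legitimate value. If P fails, x
  bounds the family, so the supremum lies below x; contraposition and stability recover P. If P
  holds and the supremum lies below x, then so does y, and antisymmetry contradicts x \<noteq>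
  y.\<close>

lemma inhabited_nontrivial_core:
  "inhabited (Om_small v w t stable \<rightarrow> prop_arr v 0 \<rightarrow> delta_ub v w t \<rightarrow> delta_least v w t \<rightarrow>
    equiv_to t v \<rightarrow> equiv_from t v \<rightarrow>
    poset_to v w t (\<lambda>X R tr c. nontrivial X R) (small v (Om v stable)))"
  by (rule inhabitedI[where t = "lam (Om_small v w t stable) (\<lambda>os.
    lam (prop_arr v 0) (\<lambda>pa. lam (delta_ub v w t) (\<lambda>dub. lam (delta_least v w t) (\<lambda>dl.
    lam (equiv_to t v) (\<lambda>et. lam (equiv_from t v) (\<lambda>ef.
    lam (univ w) (\<lambda>X. lam (X \<rightarrow> X \<rightarrow> univ t) (\<lambda>R.
    lam (prop_valued X R) (\<lambda>pv. lam (reflexive X R) (\<lambda>rf. lam (transitive X R) (\<lambda>tr. lam (antisymmetric X R) (\<lambda>as.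
    lam (X \<rightarrow> X \<rightarrow> univ v) (\<lambda>S.
    lam (pi X (\<lambda>x. pi X (\<lambda>y. equiv (R \<cdot> x \<cdot> y) (S \<cdot> x \<cdot> y)))) (\<lambda>e. lam (small v X) (\<lambda>sm.
    lam (delta_complete v X R) (\<lambda>c. lam (nontrivial X R) (\<lambda>nt.
      let Z = Om v stable in
      let_pair X (\<lambda>x. sig X (\<lambda>y. R \<cdot> x \<cdot> y \<otimes> neg (eq X x y))) (\<lambda>_. small v Z) (\<lambda>x nt.
      let_pair X (\<lambda>y. R \<cdot> x \<cdot> y \<otimes> neg (eq X x y)) (\<lambda>_. small v Z) (\<lambda>y nt.
      let_pair (R \<cdot> x \<cdot> y) (\<lambda>_. neg (eq X x y)) (\<lambda>_. small v Z) (\<lambda>le ne.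
      let ds = (\<lambda>P b. delta_sup X R c x y le P (stable_prop P b))
      in os \<cdot> X \<cdot> R \<cdot> pv \<cdot> rf \<cdot> as \<cdot> S \<cdot> e \<cdot> sm
         \<cdot> lam (univ v) (\<lambda>P. lam (stable P) (ds P))
         \<cdot> lam X (\<lambda>z. neg (S \<cdot> z \<cdot> x))
         \<cdot> lam X (\<lambda>z. let A = S \<cdot> z \<cdot> x in
             pair (pa \<cdot> A \<cdot> empty \<cdot> lam empty (\<lambda>a. lam empty (\<lambda>b. abort (eq empty a b) a)))
                  (lam (neg (neg (neg A))) (\<lambda>k. lam A (\<lambda>a. k \<cdot> lam (neg A) (\<lambda>n. n \<cdot> a)))))
         \<cdot> lam (univ v) (\<lambda>P. lam (stable P) (\<lambda>b. 
             lam (neg (S \<cdot> ds P b \<cdot> x)) (\<lambda>n. stable_dne P b \<cdot> lam (neg P) (\<lambda>m.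
                 n \<cdot> (et \<cdot> (R \<cdot> ds P b \<cdot> x) \<cdot> (S \<cdot> ds P b \<cdot> x) \<cdot> (e \<cdot> ds P b \<cdot> x)
                   \<cdot> (dl \<cdot> X \<cdot> R \<cdot> c \<cdot> x \<cdot> y \<cdot> le \<cdot> P \<cdot> stable_prop P b \<cdot> x \<cdot> (rf \<cdot> x)
                        \<cdot> lam P (\<lambda>p. abort (R \<cdot> y \<cdot> x) (m \<cdot> p))))))))
         \<cdot> lam (univ v) (\<lambda>P. lam (stable P) (\<lambda>b.
             lam P (\<lambda>p. lam (S \<cdot> ds P b \<cdot> x) (\<lambda>k. ne \<cdot> (as \<cdot> x \<cdot> y \<cdot> le
                 \<cdot> (tr \<cdot> y \<cdot> ds P b \<cdot> x \<cdot> (dub \<cdot> X \<cdot> R \<cdot> c \<cdot> x \<cdot> y \<cdot> le \<cdot> P \<cdot> stable_prop P b \<cdot> p)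
                     \<cdot> (ef \<cdot> (R \<cdot> ds P b \<cdot> x) \<cdot> (S \<cdot> ds P b \<cdot> x) \<cdot> (e \<cdot> ds P b \<cdot> x) \<cdot> k)))))))) nt) nt) nt)))))))))))))))))"],
    simp_all only: ex_defs Om_defs Om_small_def prop_arr_def delta_ub_def delta_least_def
    equiv_to_def equiv_from_def poset_to_def stable_def Let_def,
    (rule check_rules | (simp only: eval_simps; fail) | simp add: view_defs)+)

text \<open>If y lies below the supremum, leastness makes the two equal, and strictness at z = y
  gives P. The proof \<open>le\<close> is composed by transitivity with reflexivity because
  \<open>delta_sup\<close> depends on it and must be the very term that
  \<open>strictly_below\<close> mentions at z = y.\<close>

lemma inhabited_positive_core:
  "inhabited (Om_small v w t is_prop \<rightarrow> delta_ub v w t \<rightarrow> delta_least v w t \<rightarrow>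
    equiv_to t v \<rightarrow> equiv_from t v \<rightarrow>
    poset_to v w t (\<lambda>X R tr c. positive v X R tr c) (small v (Om v is_prop)))"
  by (rule inhabitedI[where t = "lam (Om_small v w t is_prop) (\<lambda>os.
    lam (delta_ub v w t) (\<lambda>dub. lam (delta_least v w t) (\<lambda>dl.
    lam (equiv_to t v) (\<lambda>et. lam (equiv_from t v) (\<lambda>ef.
    lam (univ w) (\<lambda>X. lam (X \<rightarrow> X \<rightarrow> univ t) (\<lambda>R.
    lam (prop_valued X R) (\<lambda>pv. lam (reflexive X R) (\<lambda>rf. lam (transitive X R) (\<lambda>trn. lam (antisymmetric X R) (\<lambda>as.
    lam (X \<rightarrow> X \<rightarrow> univ v) (\<lambda>S.
    lam (pi X (\<lambda>x. pi X (\<lambda>y. equiv (R \<cdot> x \<cdot> y) (S \<cdot> x \<cdot> y)))) (\<lambda>e. lam (small v X) (\<lambda>sm.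
    lam (delta_complete v X R) (\<lambda>c. lam (positive v X R trn c) (\<lambda>po.
      let Z = Om v is_prop in
      let_pair X (\<lambda>x. sig X (\<lambda>y. strictly_below v X R trn c x y)) (\<lambda>_. small v Z) (\<lambda>x po.
      let_pair X (\<lambda>y. strictly_below v X R trn c x y) (\<lambda>_. small v Z) (\<lambda>y sb.
      let_pair (R \<cdot> x \<cdot> y) (\<lambda>xy. pi X (\<lambda>z. pi (R \<cdot> y \<cdot> z) (\<lambda>yz. pi (univ v) (\<lambda>P. pi (is_prop P) (\<lambda>h.
            eq X z (delta_sup X R c x z (trn \<cdot> x \<cdot> y \<cdot> z \<cdot> xy \<cdot> yz) P h) \<rightarrow> P))))) (\<lambda>_. small v Z) (\<lambda>xy sb.
      let le = trn \<cdot> x \<cdot> y \<cdot> y \<cdot> xy \<cdot> (rf \<cdot> y);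
          ds = (\<lambda>P h. delta_sup X R c x y le P h)
      in os \<cdot> X \<cdot> R \<cdot> pv \<cdot> rf \<cdot> as \<cdot> S \<cdot> e \<cdot> sm
         \<cdot> lam (univ v) (\<lambda>P. lam (is_prop P) (\<lambda>h. ds P h))
         \<cdot> lam X (\<lambda>z. tr (S \<cdot> y \<cdot> z))
         \<cdot> lam X (\<lambda>z. lam (tr (S \<cdot> y \<cdot> z)) (\<lambda>a. lam (tr (S \<cdot> y \<cdot> z)) (\<lambda>b. tr_prop a b)))
         \<cdot> lam (univ v) (\<lambda>P. lam (is_prop P) (\<lambda>h. lam (tr (S \<cdot> y \<cdot> ds P h)) (\<lambda>k.
             tr_rec P h (lam (S \<cdot> y \<cdot> ds P h) (\<lambda>m. sb \<cdot> y \<cdot> (rf \<cdot> y) \<cdot> P \<cdot> h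
               \<cdot> (as \<cdot> y \<cdot> ds P h \<cdot> (ef \<cdot> (R \<cdot> y \<cdot> ds P h) \<cdot> (S \<cdot> y \<cdot> ds P h) \<cdot> (e \<cdot> y \<cdot> ds P h) \<cdot> m)
                   \<cdot> (dl \<cdot> X \<cdot> R \<cdot> c \<cdot> x \<cdot> y \<cdot> le \<cdot> P \<cdot> h \<cdot> y \<cdot> xy \<cdot> lam P (\<lambda>_. rf \<cdot> y))))) k)))
         \<cdot> lam (univ v) (\<lambda>P. lam (is_prop P) (\<lambda>h. lam P (\<lambda>p.
             tr_in (et \<cdot> (R \<cdot> y \<cdot> ds P h) \<cdot> (S \<cdot> y \<cdot> ds P h) \<cdot> (e \<cdot> y \<cdot> ds P h)
               \<cdot> (dub \<cdot> X \<cdot> R \<cdot> c \<cdot> x \<cdot> y \<cdot> le \<cdot> P \<cdot> h \<cdot> p)))))) sb) po) po))))))))))))))))"],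
    simp_all only: ex_defs Om_defs Om_small_def delta_ub_def delta_least_def
    equiv_to_def equiv_from_def poset_to_def Let_def,
    (rule check_rules | (simp only: eval_simps; fail) | simp add: view_defs)+)

text \<open>Keeps the destructuring of the tuple apart from the mathematics, which works with the
  curried \<open>poset_to\<close>. \<open>T0\<close> to \<open>T6\<close> are the types of the
  remaining tails, needed to annotate the nested eliminations.\<close>

definition uncurry_term :: "nat \<Rightarrow> nat \<Rightarrow> nat \<Rightarrow> (ex \<Rightarrow> ex \<Rightarrow> ex \<Rightarrow> ex \<Rightarrow> ex) \<Rightarrow> ex \<Rightarrow> ex" where
  "uncurry_term v w t E C =
    lam (poset_to v w t E C) (\<lambda>f. lam (small_delta_complete_poset_with v w t E) (\<lambda>p.
      let T6 = (\<lambda>X R tr. sig (delta_complete v X R) (\<lambda>c. E X R tr c));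
          T5 = (\<lambda>X R tr. small_poset v X R \<otimes> T6 X R tr);
          T4 = (\<lambda>X R tr. antisymmetric X R \<otimes> T5 X R tr);
          T3 = (\<lambda>X R. sig (transitive X R) (T4 X R));
          T2 = (\<lambda>X R. reflexive X R \<otimes> T3 X R);
          T1 = (\<lambda>X R. prop_valued X R \<otimes> T2 X R);
          T0 = (\<lambda>X. sig (X \<rightarrow> X \<rightarrow> univ t) (\<lambda>R. T1 X R))
      in let_pair (univ w) T0 (\<lambda>_. C) (\<lambda>X p.
         let_pair (X \<rightarrow> X \<rightarrow> univ t) (T1 X) (\<lambda>_. C) (\<lambda>R p.
         let_pair (prop_valued X R) (\<lambda>_. T2 X R) (\<lambda>_. C) (\<lambda>pv p.
         let_pair (reflexive X R) (\<lambda>_. T3 X R) (\<lambda>_. C) (\<lambda>rf p.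
         let_pair (transitive X R) (T4 X R) (\<lambda>_. C) (\<lambda>tr p.
         let_pair (antisymmetric X R) (\<lambda>_. T5 X R tr) (\<lambda>_. C) (\<lambda>as p.
         let_pair (small_poset v X R) (\<lambda>_. T6 X R tr) (\<lambda>_. C) (\<lambda>sp p.
         let_pair (delta_complete v X R) (E X R tr) (\<lambda>_. C) (\<lambda>c q.
         let_pair (locally_small v X R) (\<lambda>_. small v X) (\<lambda>_. C) (\<lambda>ls sm.
         let_pair (X \<rightarrow> X \<rightarrow> univ v) (\<lambda>S. pi X (\<lambda>x. pi X (\<lambda>y. equiv (R \<cdot> x \<cdot> y) (S \<cdot> x \<cdot> y))))
           (\<lambda>_. C) (\<lambda>S e. f \<cdot> X \<cdot> R \<cdot> pv \<cdot> rf \<cdot> tr \<cdot> as \<cdot> S \<cdot> e \<cdot> sm \<cdot> c \<cdot> q) ls) sp) p) p) p) p) p) p) p) p))"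

lemma inhabited_nontrivial_uncurry:
  "inhabited (poset_to v w t (\<lambda>X R tr c. nontrivial X R) (small v (Omega_notnot v)) \<rightarrow>
    nontrivial_small_poset v w t \<rightarrow> small v (Omega_notnot v))"
  by (rule inhabitedI[where t = "uncurry_term v w t (\<lambda>X R tr c. nontrivial X R) (small v (Omega_notnot v))"],
    simp_all only: ex_defs poset_to_def uncurry_term_def Let_def,
    (rule check_rules | (simp only: eval_simps; fail) | simp add: view_defs)+)

lemma inhabited_positive_uncurry:
  "inhabited (poset_to v w t (\<lambda>X R tr c. positive v X R tr c) (small v (Omega v)) \<rightarrow>
    positive_small_poset v w t \<rightarrow> small v (Omega v))"
  by (rule inhabitedI[where t = "uncurry_term v w t (\<lambda>X R tr c. positive v X R tr c) (small v (Omega v))"],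
    simp_all only: ex_defs poset_to_def uncurry_term_def Let_def,
    (rule check_rules | (simp only: eval_simps; fail) | simp add: view_defs)+)

section \<open>From smallness to posets\<close>

definition prop_wit :: "nat \<Rightarrow> (ex \<Rightarrow> ex) \<Rightarrow> ex \<Rightarrow> ex" where
  "prop_wit v B p = proj2 (univ v) B p"

definition Om_le :: "nat \<Rightarrow> (ex \<Rightarrow> ex) \<Rightarrow> ex" where
  "Om_le v B = lam (Om v B) (\<lambda>p. lam (Om v B) (\<lambda>q. prop_of v B p \<rightarrow> prop_of v B q))"

text \<open>\<open>D\<close> has the universal property of \<open>P \<or> (A \<and> Q)\<close>, the supremum of \<open>\<delta>\<^sub>P\<^sub>,\<^sub>Q\<^sub>,\<^sub>A\<close>.\<close>

definition join_rec :: "nat \<Rightarrow> (ex \<Rightarrow> ex) \<Rightarrow> ex \<Rightarrow> ex \<Rightarrow> ex \<Rightarrow> ex \<Rightarrow> ex" where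
  "join_rec v B P Q A D = pi (univ v) (\<lambda>U. B U \<rightarrow> (P \<rightarrow> U) \<rightarrow> (A \<rightarrow> Q \<rightarrow> U) \<rightarrow> D \<rightarrow> U)"

definition joins :: "nat \<Rightarrow> (ex \<Rightarrow> ex) \<Rightarrow> ex" where
  "joins v B = pi (univ v) (\<lambda>P. pi (univ v) (\<lambda>Q. B P \<rightarrow> B Q \<rightarrow> pi (univ v) (\<lambda>A. is_prop A \<rightarrow>
     sig (univ v) (\<lambda>D. B D \<otimes> (P \<rightarrow> D) \<otimes> (A \<rightarrow> Q \<rightarrow> D) \<otimes> join_rec v B P Q A D))))"

text \<open>An upper bound \<open>u\<close>, evaluated at \<open>inl star\<close> and at
  \<open>inr a\<close>, is exactly the pair of implications that \<open>join_rec\<close> eliminates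
  with.\<close>

definition delta_complete_term :: "nat \<Rightarrow> (ex \<Rightarrow> ex) \<Rightarrow> ex" where
  "delta_complete_term v B = lam (joins v B) (\<lambda>jn.
     let Z = Om v B; R = Om_le v B; pr = prop_of v B; wi = prop_wit v B in
     lam Z (\<lambda>p. lam Z (\<lambda>q. lam (R \<cdot> p \<cdot> q) (\<lambda>le. lam (univ v) (\<lambda>A. lam (is_prop A) (\<lambda>h.
       let I = plus unit A; d = delta Z p q A; C = (\<lambda>_. sig Z (\<lambda>s. is_delta_sup Z R p q A s));
           T3 = join_rec v B (pr p) (pr q) A; T2 = (\<lambda>D. (A \<rightarrow> pr q \<rightarrow> D) \<otimes> T3 D);
           T1 = (\<lambda>D. (pr p \<rightarrow> D) \<otimes> T2 D)
       in let_pair (univ v) (\<lambda>D. B D \<otimes> T1 D) C (\<lambda>D k.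
          let_pair (B D) (\<lambda>_. T1 D) C (\<lambda>b k.
          let_pair (pr p \<rightarrow> D) (\<lambda>_. T2 D) C (\<lambda>i1 k.
          let_pair (A \<rightarrow> pr q \<rightarrow> D) (\<lambda>_. T3 D) C (\<lambda>i2 rec.
            pair (pair D b) (pair
              (lam I (\<lambda>i. case_sum unit A (\<lambda>i. R \<cdot> (d \<cdot> i) \<cdot> pair D b) (\<lambda>_. i1) (\<lambda>a. i2 \<cdot> a) i))
              (lam Z (\<lambda>u. lam (pi I (\<lambda>i. R \<cdot> (d \<cdot> i) \<cdot> u)) (\<lambda>k.
                rec \<cdot> pr u \<cdot> wi u \<cdot> (k \<cdot> inl star) \<cdot> lam A (\<lambda>a. k \<cdot> inr a))))))
          k) k) k) (jn \<cdot> pr p \<cdot> pr q \<cdot> wi p \<cdot> wi q \<cdot> A \<cdot> h)))))))"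

lemma inhabited_delta_complete_stable:
  "inhabited (joins v stable \<rightarrow> delta_complete v (Om v stable) (Om_le v stable))"
  by (rule inhabitedI[where t = "delta_complete_term v stable"],
    simp_all only: ex_defs Om_defs prop_wit_def Om_le_def join_rec_def joins_def
    delta_complete_term_def stable_def Let_def,
    (rule check_rules | (simp only: eval_simps; fail) | simp add: view_defs)+)

lemma inhabited_delta_complete_is_prop:
  "inhabited (joins v is_prop \<rightarrow> delta_complete v (Om v is_prop) (Om_le v is_prop))"
  by (rule inhabitedI[where t = "delta_complete_term v is_prop"],
    simp_all only: ex_defs Om_defs prop_wit_def Om_le_def join_rec_def joins_def
    delta_complete_term_def Let_def,
    (rule check_rules | (simp only: eval_simps; fail) | simp add: view_defs)+)

text \<open>\<open>D\<close> is the de Morgan form of the disjunction. Being a negation it is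
  stable, and it eliminates into stable propositions, the only targets that \<open>join_rec\<close>
  allows here.\<close>

lemma inhabited_joins_stable: "inhabited (prop_arr v 0 \<rightarrow> joins v stable)"
  by (rule inhabitedI[where t = "lam (prop_arr v 0) (\<lambda>pa.
    lam (univ v) (\<lambda>P. lam (univ v) (\<lambda>Q. lam (stable P) (\<lambda>b. lam (stable Q) (\<lambda>c.
    lam (univ v) (\<lambda>A. lam (is_prop A) (\<lambda>h.
      let M = neg P \<otimes> neg (A \<otimes> Q); D = neg M in
      pair D (pair
        (pair (pa \<cdot> M \<cdot> empty \<cdot> lam empty (\<lambda>a. lam empty (\<lambda>b. abort (eq empty a b) a)))
          (lam (neg (neg D)) (\<lambda>k. lam M (\<lambda>m. k \<cdot> lam D (\<lambda>j. j \<cdot> m)))))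
        (pair (lam P (\<lambda>p. lam M (\<lambda>m. proj1 (neg P) (\<lambda>_. neg (A \<otimes> Q)) m \<cdot> p)))
        (pair (lam A (\<lambda>a. lam Q (\<lambda>q. lam M (\<lambda>m. proj2 (neg P) (\<lambda>_. neg (A \<otimes> Q)) m \<cdot> pair a q))))
          (lam (univ v) (\<lambda>U. lam (stable U) (\<lambda>d. lam (P \<rightarrow> U) (\<lambda>f. lam (A \<rightarrow> Q \<rightarrow> U) (\<lambda>g. lam D (\<lambda>j.
            stable_dne U d \<cdot> lam (neg U) (\<lambda>n. j \<cdot> pair (lam P (\<lambda>p. n \<cdot> (f \<cdot> p)))
              (lam (A \<otimes> Q) (\<lambda>z. n \<cdot> (g \<cdot> proj1 A (\<lambda>_. Q) z \<cdot> proj2 A (\<lambda>_. Q) z))))))))))))))))))))"],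
    simp_all only: ex_defs prop_arr_def join_rec_def joins_def stable_def Let_def,
    (rule check_rules | (simp only: eval_simps; fail) | simp add: view_defs)+)

text \<open>The sum may have several elements; its truncation is a proposition and still eliminates
  into any proposition.\<close>

lemma inhabited_joins_is_prop: "inhabited (joins v is_prop)"
  by (rule inhabitedI[where t = "lam (univ v) (\<lambda>P. lam (univ v) (\<lambda>Q. lam (is_prop P) (\<lambda>b. lam (is_prop Q) (\<lambda>c.
    lam (univ v) (\<lambda>A. lam (is_prop A) (\<lambda>h.
      let M = plus P (A \<otimes> Q); D = tr M in
      pair D (pair (lam D (\<lambda>x. lam D (\<lambda>y. tr_prop x y)))
        (pair (lam P (\<lambda>p. tr_in (inl p)))
        (pair (lam A (\<lambda>a. lam Q (\<lambda>q. tr_in (inr (pair a q)))))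
          (lam (univ v) (\<lambda>U. lam (is_prop U) (\<lambda>d. lam (P \<rightarrow> U) (\<lambda>f. lam (A \<rightarrow> Q \<rightarrow> U) (\<lambda>g. lam D (\<lambda>j.
            tr_rec U d (lam M (\<lambda>m. case_sum P (A \<otimes> Q) (\<lambda>_. U) (\<lambda>p. f \<cdot> p)
              (\<lambda>z. g \<cdot> proj1 A (\<lambda>_. Q) z \<cdot> proj2 A (\<lambda>_. Q) z) m)) j)))))))))))))))"],
    simp_all only: ex_defs join_rec_def joins_def Let_def,
    (rule check_rules | (simp only: eval_simps; fail) | simp add: view_defs)+)

text \<open>An empty type in \<open>univ v\<close>, given any \<open>L : univ v\<close>; universes are not cumulative.\<close>

definition False_at :: "ex \<Rightarrow> ex" where
  "False_at L = L \<otimes> empty"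

text \<open>Padding the unit type with \<open>L\<close> would reproduce all elements of
  \<open>L\<close>; an implication between propositions stays a proposition and is inhabited by the
  identity.\<close>

definition True_at :: "ex \<Rightarrow> ex" where
  "True_at L = (False_at L \<rightarrow> False_at L)"

definition False_elim :: "ex \<Rightarrow> ex \<Rightarrow> ex \<Rightarrow> ex" where
  "False_elim L C a = abort C (proj2 L (\<lambda>_. empty) a)"

definition False_prop :: "ex \<Rightarrow> ex" where
  "False_prop L = lam (False_at L) (\<lambda>a. lam (False_at L) (\<lambda>b. False_elim L (eq (False_at L) a b) a))"

definition True_intro :: "ex \<Rightarrow> ex" where
  "True_intro L = lam (False_at L) (\<lambda>x. x)"

section \<open>Falsity and truth as designated elements\<close>

lemma inhabited_nontrivial_Om:
  "inhabited (prop_arr v v \<rightarrow> univ v \<rightarrow> nontrivial (Om v stable) (Om_le v stable))"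
  by (rule inhabitedI[where t = "lam (prop_arr v v) (\<lambda>pa. lam (univ v) (\<lambda>L.
      let F = False_at L; T = True_at L; Z = Om v stable;
          ff = pair F (pair (False_prop L)
            (lam (neg (neg F)) (\<lambda>n. abort F (n \<cdot> lam F (\<lambda>a. proj2 L (\<lambda>_. empty) a)))));
          tt = pair T (pair (pa \<cdot> F \<cdot> F \<cdot> False_prop L) (lam (neg (neg T)) (\<lambda>_. True_intro L)))
      in pair ff (pair tt (pair (lam F (\<lambda>_. True_intro L))
        (lam (eq Z ff tt) (\<lambda>e. proj2 L (\<lambda>_. empty)
          (path_ind Z tt (\<lambda>q _. prop_of v stable q) (True_intro L) ff (sym Z ff tt e))))))))"],
    simp_all only: ex_defs Om_defs prop_arr_def Om_le_def False_at_def True_at_def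
    False_elim_def False_prop_def True_intro_def stable_def Let_def,
    (rule check_rules | (simp only: eval_simps; fail) | simp add: view_defs)+)

text \<open>\<open>strictly_below\<close> refers to the transitivity proof and to the chosen
  suprema, so the claim is made for every such choice.\<close>

definition Om_positive :: "nat \<Rightarrow> ex" where
  "Om_positive v = (let Z = Om v is_prop; R = Om_le v is_prop in
     pi (transitive Z R) (\<lambda>tr. pi (delta_complete v Z R) (\<lambda>c. positive v Z R tr c)))"

text \<open>Let z lie above truth and equal the supremum for falsity, z and P. Then z holds, hence
  so does the supremum. The proposition P bounds the family, since falsity implies P and P makes
  every implication into P true; leastness therefore gives P.\<close>

lemma inhabited_Om_positive:
  "inhabited (prop_arr v v \<rightarrow> delta_least v (Suc v) v \<rightarrow> univ v \<rightarrow> Om_positive v)"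
  by (rule inhabitedI[where t = "lam (prop_arr v v) (\<lambda>pa. lam (delta_least v (Suc v) v) (\<lambda>dl. lam (univ v) (\<lambda>L.
      let F = False_at L; T = True_at L; Z = Om v is_prop; R = Om_le v is_prop;
          ff = pair F (False_prop L); tt = pair T (pa \<cdot> F \<cdot> F \<cdot> False_prop L);
          le = lam F (\<lambda>_. True_intro L)
      in lam (transitive Z R) (\<lambda>tr. lam (delta_complete v Z R) (\<lambda>c.
        pair ff (pair tt (pair le (lam Z (\<lambda>z. lam (R \<cdot> tt \<cdot> z) (\<lambda>yz.
          lam (univ v) (\<lambda>P. lam (is_prop P) (\<lambda>h.
            let le' = tr \<cdot> ff \<cdot> tt \<cdot> z \<cdot> le \<cdot> yz; s = delta_sup Z R c ff z le' P h in
            lam (eq Z z s) (\<lambda>e.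
              dl \<cdot> Z \<cdot> R \<cdot> c \<cdot> ff \<cdot> z \<cdot> le' \<cdot> P \<cdot> h \<cdot> pair P h \<cdot> lam F (\<lambda>a. False_elim L P a)
                 \<cdot> lam P (\<lambda>p. lam (prop_of v is_prop z) (\<lambda>_. p))
              \<cdot> path_ind Z z (\<lambda>q _. prop_of v is_prop q) (yz \<cdot> True_intro L) s e)))))))))))))"],
    simp_all only: ex_defs Om_defs prop_arr_def Om_le_def False_at_def True_at_def
    False_elim_def False_prop_def True_intro_def delta_least_def Om_positive_def Let_def,
    (rule check_rules | (simp only: eval_simps; fail) | simp add: view_defs)+)

text \<open>The order already takes values in \<open>univ v\<close>, so local smallness is witnessed
  by the order itself with identity equivalences; \<open>oe\<close> fills the place of antisymmetry.
  \<open>E\<close> receives the transitivity proof because positivity depends on it.\<close>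

definition poset_term ::
  "nat \<Rightarrow> (ex \<Rightarrow> ex) \<Rightarrow> ex \<Rightarrow> ex \<Rightarrow> (ex \<Rightarrow> ex) \<Rightarrow> ex \<Rightarrow> ex \<Rightarrow> (ex \<Rightarrow> ex) \<Rightarrow> ex" where
  "poset_term v B pa oe h c sm E =
     (let Z = Om v B; R = Om_le v B; pr = prop_of v B; refl_id = (\<lambda>A. lam A (\<lambda>x. x));
          inv = (\<lambda>A. pair (refl_id A) (lam A (\<lambda>x. rfl x)));
          tr = lam Z (\<lambda>p. lam Z (\<lambda>q. lam Z (\<lambda>r. lam (R \<cdot> p \<cdot> q) (\<lambda>f. lam (R \<cdot> q \<cdot> r) (\<lambda>g.
                 lam (pr p) (\<lambda>x. g \<cdot> (f \<cdot> x)))))))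
      in pair Z (pair R
         (pair (lam Z (\<lambda>p. lam Z (\<lambda>q. pa \<cdot> pr p \<cdot> pr q \<cdot> h q)))
         (pair (lam Z (\<lambda>p. refl_id (pr p)))
         (pair tr
         (pair oe
         (pair (pair (pair R (lam Z (\<lambda>p. lam Z (\<lambda>q. let A = R \<cdot> p \<cdot> q in
                   pair (refl_id A) (pair (inv A) (inv A)))))) sm)
         (pair c (E tr)))))))))"

lemma inhabited_nontrivial_small_poset:
  "inhabited (prop_arr v v \<rightarrow> Om_ext v stable \<rightarrow> delta_complete v (Om v stable) (Om_le v stable) \<rightarrow>
     nontrivial (Om v stable) (Om_le v stable) \<rightarrow>
     small v (Omega_notnot v) \<rightarrow> nontrivial_small_poset v (Suc v) v)"
  by (rule inhabitedI[where t = "lam (prop_arr v v) (\<lambda>pa. lam (Om_ext v stable) (\<lambda>oe.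
    lam (delta_complete v (Om v stable) (Om_le v stable)) (\<lambda>c.
    lam (nontrivial (Om v stable) (Om_le v stable)) (\<lambda>nt. lam (small v (Omega_notnot v)) (\<lambda>sm.
      poset_term v stable pa oe (\<lambda>q. stable_prop (prop_of v stable q) (prop_wit v stable q))
        c sm (\<lambda>_. nt))))))"],
    simp_all only: ex_defs Om_defs prop_wit_def prop_arr_def Om_le_def stable_def poset_term_def Let_def,
    (rule check_rules | (simp only: eval_simps; fail) | simp add: view_defs)+)

lemma inhabited_positive_small_poset:
  "inhabited (prop_arr v v \<rightarrow> Om_ext v is_prop \<rightarrow> delta_complete v (Om v is_prop) (Om_le v is_prop) \<rightarrow>
     Om_positive v \<rightarrow> small v (Omega v) \<rightarrow> positive_small_poset v (Suc v) v)"
  by (rule inhabitedI[where t = "lam (prop_arr v v) (\<lambda>pa. lam (Om_ext v is_prop) (\<lambda>oe.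
    lam (delta_complete v (Om v is_prop) (Om_le v is_prop)) (\<lambda>c.
    lam (Om_positive v) (\<lambda>po. lam (small v (Omega v)) (\<lambda>sm.
      poset_term v is_prop pa oe (prop_wit v is_prop) c sm (\<lambda>tr. po \<cdot> tr \<cdot> c))))))"],
    simp_all only: ex_defs Om_defs prop_wit_def prop_arr_def Om_le_def Om_positive_def poset_term_def Let_def,
    (rule check_rules | (simp only: eval_simps; fail) | simp add: view_defs)+)

text \<open>Supplies the \<open>L\<close> from which falsity at level \<open>v\<close> is
  built.\<close>

lemma inhabited_univ: "inhabited (univ v)"
proof -
  have "[] \<turnstile> (case v of 0 \<Rightarrow> Unit | Suc u \<Rightarrow> Univ u) \<^bold>: Univ v"
    by (cases v) (auto intro: ctx_typing.ctx_Nil ctx_typing.Unit ctx_typing.Univ)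
  then show ?thesis unfolding inhabited_def univ_def by blast
qed

lemmas type_defs = ex_defs prop_is_set_def prop_prop_def prop_arr_def prop_both_def sig_eq_def
  Om_defs Om_ext_gen_def delta_ub_def delta_least_def equiv_to_def equiv_from_def both_le_def
  retract_core_def retract_def stable_def poset_to_def Om_small_def Om_le_def join_rec_def joins_def
  Om_positive_def Let_def One_nat_def

theorem theorem4p24:
  fixes v :: nat
  shows "((\<forall>w t. inhabited (nontrivial_small_poset v w t \<rightarrow> small v (Omega_notnot v))) \<and>
          (\<exists>w t. inhabited (small v (Omega_notnot v) \<rightarrow> nontrivial_small_poset v w t))) \<and>
         ((\<forall>w t. inhabited (positive_small_poset v w t \<rightarrow> small v (Omega v))) \<and>
          (\<exists>w t. inhabited (small v (Omega v) \<rightarrow> positive_small_poset v w t)))"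
proof -
  have Omega: "Om v stable = Omega_notnot v" "Om v is_prop = Omega v"
    by (simp_all add: Om_def Omega_notnot_def Omega_def stable_def[abs_def])
  \<comment> \<open>Each underscore in the uses below is the closedness condition of one
    application; these conditions remain as goals and are evaluated.\<close>
  note mp1 = inhabited_mp
    and mp2 = inhabited_mp[OF inhabited_mp]
    and mp3 = inhabited_mp[OF inhabited_mp[OF inhabited_mp]]
    and mp4 = inhabited_mp[OF inhabited_mp[OF inhabited_mp[OF inhabited_mp]]]
  have prop_prop: "inhabited (prop_prop v)"
    by (rule mp1[OF inhabited_prop_prop inhabited_prop_is_set])
      (simp only: type_defs, simp only: eval_simps)
  have ext_gen: "inhabited (Om_ext_gen v)"
    by (rule mp1[OF inhabited_Om_ext_gen inhabited_sig_eq])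
      (simp only: type_defs, simp only: eval_simps)
  have ext_stable: "inhabited (Om_ext v stable)"
    by (rule mp4[OF inhabited_Om_ext_stable ext_gen _ prop_prop _ inhabited_prop_arr _ inhabited_prop_both])
      (simp only: type_defs, simp only: eval_simps)+
  have ext_prop: "inhabited (Om_ext v is_prop)"
    by (rule mp2[OF inhabited_Om_ext_is_prop ext_gen _ prop_prop])
      (simp only: type_defs, simp only: eval_simps)+
  have forward: "inhabited (nontrivial_small_poset v w t \<rightarrow> small v (Omega_notnot v))"
    "inhabited (positive_small_poset v w t \<rightarrow> small v (Omega v))" for w t
  proof -
    \<comment> \<open>The retract is a type of propositions of level \<open>v\<close>, which lives
      one universe higher.\<close>
    have "inhabited (retract_core v w t (Suc v))"
      by (rule mp1[OF inhabited_retract_core inhabited_sig_eq])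
        (simp only: type_defs, simp only: eval_simps)
    then have retract: "inhabited (retract v w t (Suc v))"
      by (rule mp3[OF inhabited_retract _ _ inhabited_equiv_to _ inhabited_equiv_from])
        (simp only: type_defs, simp only: eval_simps)+
    have small_stable: "inhabited (Om_small v w t stable)"
      by (rule mp2[OF inhabited_Om_small_stable retract _ ext_stable])
        (simp only: type_defs, simp only: eval_simps)+
    have small_prop: "inhabited (Om_small v w t is_prop)"
      by (rule mp2[OF inhabited_Om_small_is_prop retract _ ext_prop])
        (simp only: type_defs, simp only: eval_simps)+
    have "inhabited (equiv_to t v \<rightarrow> equiv_from t v \<rightarrow>
        poset_to v w t (\<lambda>X R tr c. nontrivial X R) (small v (Om v stable)))"
      by (rule mp4[OF inhabited_nontrivial_core small_stable _ inhabited_prop_arr _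
            inhabited_delta_ub _ inhabited_delta_least])
        (simp only: type_defs, simp only: eval_simps)+
    then have "inhabited (poset_to v w t (\<lambda>X R tr c. nontrivial X R) (small v (Om v stable)))"
      by (rule mp2[OF _ inhabited_equiv_to _ inhabited_equiv_from])
        (simp only: type_defs, simp only: eval_simps)+
    then show "inhabited (nontrivial_small_poset v w t \<rightarrow> small v (Omega_notnot v))"
      unfolding Omega by (rule mp1[OF inhabited_nontrivial_uncurry])
        (simp only: type_defs, simp only: eval_simps)
    have "inhabited (equiv_to t v \<rightarrow> equiv_from t v \<rightarrow>
        poset_to v w t (\<lambda>X R tr c. positive v X R tr c) (small v (Om v is_prop)))"
      by (rule mp3[OF inhabited_positive_core small_prop _ inhabited_delta_ub _ inhabited_delta_least])
        (simp only: type_defs, simp only: eval_simps)+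
    then have "inhabited (poset_to v w t (\<lambda>X R tr c. positive v X R tr c) (small v (Om v is_prop)))"
      by (rule mp2[OF _ inhabited_equiv_to _ inhabited_equiv_from])
        (simp only: type_defs, simp only: eval_simps)+
    then show "inhabited (positive_small_poset v w t \<rightarrow> small v (Omega v))"
      unfolding Omega by (rule mp1[OF inhabited_positive_uncurry])
        (simp only: type_defs, simp only: eval_simps)
  qed
  have "inhabited (joins v stable)"
    by (rule mp1[OF inhabited_joins_stable inhabited_prop_arr])
      (simp only: type_defs, simp only: eval_simps)
  then have complete_stable: "inhabited (delta_complete v (Om v stable) (Om_le v stable))"
    by (rule mp1[OF inhabited_delta_complete_stable])
      (simp only: type_defs, simp only: eval_simps)
  have complete_prop: "inhabited (delta_complete v (Om v is_prop) (Om_le v is_prop))"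
    by (rule mp1[OF inhabited_delta_complete_is_prop inhabited_joins_is_prop])
      (simp only: type_defs, simp only: eval_simps)
  have nontrivial: "inhabited (nontrivial (Om v stable) (Om_le v stable))"
    by (rule mp2[OF inhabited_nontrivial_Om inhabited_prop_arr _ inhabited_univ])
      (simp only: type_defs, simp only: eval_simps)+
  have positive: "inhabited (Om_positive v)"
    by (rule mp3[OF inhabited_Om_positive inhabited_prop_arr _ inhabited_delta_least _ inhabited_univ])
      (simp only: type_defs, simp only: eval_simps)+
  \<comment> \<open>The carrier is the type of propositions itself, in \<open>Univ (Suc v)\<close>,
    and implication takes values in \<open>Univ v\<close>.\<close>
  have "inhabited (small v (Omega_notnot v) \<rightarrow> nontrivial_small_poset v (Suc v) v)"
    by (rule mp4[OF inhabited_nontrivial_small_poset inhabited_prop_arr _ ext_stable _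
          complete_stable _ nontrivial])
      (simp only: type_defs, simp only: eval_simps)+
  moreover have "inhabited (small v (Omega v) \<rightarrow> positive_small_poset v (Suc v) v)"
    by (rule mp4[OF inhabited_positive_small_poset inhabited_prop_arr _ ext_prop _
          complete_prop _ positive])
      (simp only: type_defs, simp only: eval_simps)+
  ultimately show ?thesis using forward by blast
qed

end
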